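(* Let $F,G:\mathcal{K}\to\mathcal{L}$ be strongly class-accessible functors. Then the inserter category $\operatorname{Ins}(F,G)$ is a class-accessible category and the projection functor $P:\operatorname{Ins}(F,G)\to\mathcal{K}$ is strongly class-accessible.
   Context: Sets and classes are distinguished (Gödel–Bernays set theory); a category may have a proper class of objects but has hom-sets between any two objects. Colimits are small. For a regular cardinal $\lambda$, an object $K$ of a category $\mathcal{K}$ is $\lambda$-presentable if $\hom(K,-):\mathcal{K}\to\mathbf{Set}$ preserves $\lambda$-filtered colimits. $\mathcal{K}$ is class-$\lambda$-accessible if it has $\lambda$-filtered colimits and there is a class $\mathcal{A}$ of $\lambda$-presentable objects of $\mathcal{K}$ such that every object of $\mathcal{K}$ is a $\lambda$-filtered colimit of objects from $\mathcal{A}$; it is class-accessible if it is class-$\lambda$-accessible for some regular cardinal $\lambda$. A functor $F:\mathcal{K}\to\mathcal{L}$ is class-$\lambda$-accessible if $\mathcal{K}$ and $\mathcal{L}$ are class-$\lambda$-accessible and $F$ preserves $\lambda$-filtered colimits; it is strongly class-$\lambda$-accessible if moreover it preserves $\lambda$-presentable objects. $F$ is strongly class-accessible if it is strongly class-$\lambda$-accessible for some regular cardinal $\lambda$. The inserter category $\operatorname{Ins}(F,G)$ has as objects the morphisms $f:FK\to GK$ of $\mathcal{L}$ with $K\in\mathcal{K}$; a morphism from $f:FK\to GK$ to $f':FK'\to GK'$ is a morphism $k:K\to K'$ of $\mathcal{K}$ such that $G(k)f=f'F(k)$. The projection functor $P:\operatorname{Ins}(F,G)\to\mathcal{K}$ sends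 $f:FK\to GK$ to $K$. *)

theory Defs
  imports "HOL-Library.FuncSet"
begin

unbundle cardinal_syntax

(* Classes and sets in the sense of Goedel-Bernays are modelled over a type 'u that plays the
   universe of all sets: a class is a set of type "'u set", and it is a set ("small") iff it has
   fewer elements than the universe (limitation of size).  The axioms of infinity, replacement,
   union and power set say that the cardinality of 'u is strongly inaccessible. *)

definition small :: "'u set \<Rightarrow> bool" where
  "small A \<longleftrightarrow> |A| <o |UNIV :: 'u set|"

definition inaccessible :: "'u rel \<Rightarrow> bool" where
  "inaccessible r \<longleftrightarrow> Card_order r \<and> natLeq <o r \<and> regularCard r \<and>
     (\<forall>A. A \<subseteq> Field r \<and> |A| <o r \<longrightarrow> |Pow A| <o r)"

(* Every cardinal below |UNIV :: 'u set| is represented by a relation on 'u. *)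

definition regular_cardinal :: "'u rel \<Rightarrow> bool" where
  "regular_cardinal r \<longleftrightarrow> Cinfinite r \<and> regularCard r \<and> r <o |UNIV :: 'u set|"

(* An ordered pair operation of the universe; it is injective because 'u is infinite. *)

definition vpair :: "'u \<times> 'u \<Rightarrow> 'u" where
  "vpair = (SOME p. inj p)"

definition vfst :: "'u \<Rightarrow> 'u" where
  "vfst x = fst (inv vpair x)"

definition vsnd :: "'u \<Rightarrow> 'u" where
  "vsnd x = snd (inv vpair x)"


section \<open>Categories, functors and colimits\<close>

record ('o, 'a) cat =
  Obj :: "'o set"
  Arr :: "'a set"
  Dom :: "'a \<Rightarrow> 'o"
  Cod :: "'a \<Rightarrow> 'o"
  Ident :: "'o \<Rightarrow> 'a"
  Comp :: "'a \<Rightarrow> 'a \<Rightarrow> 'a"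

definition hom :: "('o, 'a) cat \<Rightarrow> 'o \<Rightarrow> 'o \<Rightarrow> 'a set" where
  "hom C A B = {f \<in> Arr C. Dom C f = A \<and> Cod C f = B}"

(* "Comp C g f" is the composite "first f, then g". *)

locale category =
  fixes C :: "('o, 'a) cat"
  assumes Dom_Obj: "f \<in> Arr C \<Longrightarrow> Dom C f \<in> Obj C"
    and Cod_Obj: "f \<in> Arr C \<Longrightarrow> Cod C f \<in> Obj C"
    and Ident_hom: "A \<in> Obj C \<Longrightarrow> Ident C A \<in> hom C A A"
    and Comp_hom: "f \<in> hom C A B \<Longrightarrow> g \<in> hom C B D \<Longrightarrow> Comp C g f \<in> hom C A D"
    and Comp_Ident: "f \<in> hom C A B \<Longrightarrow> Comp C f (Ident C A) = f"
    and Ident_Comp: "f \<in> hom C A B \<Longrightarrow> Comp C (Ident C B) f = f"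
    and Comp_assoc: "f \<in> hom C A B \<Longrightarrow> g \<in> hom C B D \<Longrightarrow> h \<in> hom C D E \<Longrightarrow>
      Comp C h (Comp C g f) = Comp C (Comp C h g) f"

definition locally_small :: "('o, 'u) cat \<Rightarrow> bool" where
  "locally_small C \<longleftrightarrow> (\<forall>A\<in>Obj C. \<forall>B\<in>Obj C. small (hom C A B))"

definition small_category :: "('u, 'u) cat \<Rightarrow> bool" where
  "small_category I \<longleftrightarrow> category I \<and> small (Obj I) \<and> small (Arr I)"

record ('o, 'a, 'p, 'b) fctr =
  FObj :: "'o \<Rightarrow> 'p"
  FArr :: "'a \<Rightarrow> 'b"

locale cat_functor = dom: category C + cod: category E
  for C :: "('o, 'a) cat" and E :: "('p, 'b) cat" and F :: "('o, 'a, 'p, 'b) fctr" +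
  assumes FObj_Obj: "A \<in> Obj C \<Longrightarrow> FObj F A \<in> Obj E"
    and FArr_hom: "f \<in> hom C A B \<Longrightarrow> FArr F f \<in> hom E (FObj F A) (FObj F B)"
    and FArr_Ident: "A \<in> Obj C \<Longrightarrow> FArr F (Ident C A) = Ident E (FObj F A)"
    and FArr_Comp: "f \<in> hom C A B \<Longrightarrow> g \<in> hom C B D \<Longrightarrow>
      FArr F (Comp C g f) = Comp E (FArr F g) (FArr F f)"

definition fctr_comp ::
    "('p, 'b, 'q, 'c) fctr \<Rightarrow> ('o, 'a, 'p, 'b) fctr \<Rightarrow> ('o, 'a, 'q, 'c) fctr" where
  "fctr_comp G F = \<lparr> FObj = (\<lambda>A. FObj G (FObj F A)), FArr = (\<lambda>f. FArr G (FArr F f)) \<rparr>"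

definition cocone ::
    "('i, 'j) cat \<Rightarrow> ('o, 'a) cat \<Rightarrow> ('i, 'j, 'o, 'a) fctr \<Rightarrow> 'o \<Rightarrow> ('i \<Rightarrow> 'a) \<Rightarrow> bool" where
  "cocone I C D c t \<longleftrightarrow> c \<in> Obj C \<and> (\<forall>i\<in>Obj I. t i \<in> hom C (FObj D i) c) \<and>
     (\<forall>u\<in>Arr I. Comp C (t (Cod I u)) (FArr D u) = t (Dom I u))"

definition colimit ::
    "('i, 'j) cat \<Rightarrow> ('o, 'a) cat \<Rightarrow> ('i, 'j, 'o, 'a) fctr \<Rightarrow> 'o \<Rightarrow> ('i \<Rightarrow> 'a) \<Rightarrow> bool" where
  "colimit I C D c t \<longleftrightarrow> cocone I C D c t \<and>
     (\<forall>d s. cocone I C D d s \<longrightarrow> (\<exists>!h. h \<in> hom C c d \<and> (\<forall>i\<in>Obj I. Comp C h (t i) = s i)))"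

(* Taking S empty in the first clause shows that a filtered category is nonempty. *)

definition filtered :: "'u rel \<Rightarrow> ('i, 'j) cat \<Rightarrow> bool" where
  "filtered r I \<longleftrightarrow>
     (\<forall>S. S \<subseteq> Obj I \<and> |S| <o r \<longrightarrow> (\<exists>c\<in>Obj I. \<forall>s\<in>S. hom I s c \<noteq> {})) \<and>
     (\<forall>a\<in>Obj I. \<forall>b\<in>Obj I. \<forall>S. S \<subseteq> hom I a b \<and> |S| <o r \<longrightarrow>
        (\<exists>c\<in>Obj I. \<exists>h\<in>hom I b c. \<forall>f\<in>S. \<forall>g\<in>S. Comp I h f = Comp I h g))"

(* Index categories are taken with objects and arrows in 'u; every small category is isomorphic
   to one of these. *)

definition has_filtered_colimits :: "'u rel \<Rightarrow> ('o, 'a) cat \<Rightarrow> bool" where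
  "has_filtered_colimits r C \<longleftrightarrow>
     (\<forall>(I :: ('u, 'u) cat) D. small_category I \<and> filtered r I \<and> cat_functor I C D \<longrightarrow>
        (\<exists>c t. colimit I C D c t))"

definition preserves_filtered_colimits ::
    "'u rel \<Rightarrow> ('o, 'a) cat \<Rightarrow> ('p, 'b) cat \<Rightarrow> ('o, 'a, 'p, 'b) fctr \<Rightarrow> bool" where
  "preserves_filtered_colimits r C E F \<longleftrightarrow>
     (\<forall>(I :: ('u, 'u) cat) D c t.
        small_category I \<and> filtered r I \<and> cat_functor I C D \<and> colimit I C D c t \<longrightarrow>
        colimit I E (fctr_comp F D) (FObj F c) (\<lambda>i. FArr F (t i)))"


section \<open>Presentable objects and class-accessibility\<close>

(* The category of small sets and functions; an arrow is a triple (domain, function, codomain). *)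

definition Set_cat :: "('u set, 'u set \<times> ('u \<Rightarrow> 'u) \<times> 'u set) cat" where
  "Set_cat = \<lparr>
     Obj = {X. small X},
     Arr = {(X, f, Y). small X \<and> small Y \<and> f \<in> X \<rightarrow>\<^sub>E Y},
     Dom = (\<lambda>(X, f, Y). X),
     Cod = (\<lambda>(X, f, Y). Y),
     Ident = (\<lambda>X. (X, \<lambda>x\<in>X. x, X)),
     Comp = (\<lambda>(Y, g, Z) (X, f, Y'). (X, compose X g f, Z)) \<rparr>"

definition hom_functor ::
    "('o, 'u) cat \<Rightarrow> 'o \<Rightarrow> ('o, 'u, 'u set, 'u set \<times> ('u \<Rightarrow> 'u) \<times> 'u set) fctr" where
  "hom_functor C A = \<lparr>
     FObj = (\<lambda>X. hom C A X),
     FArr = (\<lambda>f. (hom C A (Dom C f), \<lambda>x\<in>hom C A (Dom C f). Comp C f x, hom C A (Cod C f))) \<rparr>"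

definition presentable :: "'u rel \<Rightarrow> ('u, 'u) cat \<Rightarrow> 'u \<Rightarrow> bool" where
  "presentable r C A \<longleftrightarrow>
     A \<in> Obj C \<and> preserves_filtered_colimits r C Set_cat (hom_functor C A)"

definition class_accessible_at :: "'u rel \<Rightarrow> ('u, 'u) cat \<Rightarrow> bool" where
  "class_accessible_at r C \<longleftrightarrow>
     regular_cardinal r \<and> category C \<and> locally_small C \<and> has_filtered_colimits r C \<and>
     (\<exists>\<A>. (\<forall>A\<in>\<A>. presentable r C A) \<and>
        (\<forall>X\<in>Obj C. \<exists>(I :: ('u, 'u) cat) D t.
           small_category I \<and> filtered r I \<and> cat_functor I C D \<and>
           (\<forall>i\<in>Obj I. FObj D i \<in> \<A>) \<and> colimit I C D X t))"

definition class_accessible :: "('u, 'u) cat \<Rightarrow> bool" where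
  "class_accessible C \<longleftrightarrow> (\<exists>r. class_accessible_at r C)"

definition class_accessible_functor_at ::
    "'u rel \<Rightarrow> ('u, 'u) cat \<Rightarrow> ('u, 'u) cat \<Rightarrow> ('u, 'u, 'u, 'u) fctr \<Rightarrow> bool" where
  "class_accessible_functor_at r C E F \<longleftrightarrow>
     class_accessible_at r C \<and> class_accessible_at r E \<and> cat_functor C E F \<and>
     preserves_filtered_colimits r C E F"

definition strongly_class_accessible_at ::
    "'u rel \<Rightarrow> ('u, 'u) cat \<Rightarrow> ('u, 'u) cat \<Rightarrow> ('u, 'u, 'u, 'u) fctr \<Rightarrow> bool" where
  "strongly_class_accessible_at r C E F \<longleftrightarrow>
     class_accessible_functor_at r C E F \<and>
     (\<forall>A. presentable r C A \<longrightarrow> presentable r E (FObj F A))"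

definition strongly_class_accessible ::
    "('u, 'u) cat \<Rightarrow> ('u, 'u) cat \<Rightarrow> ('u, 'u, 'u, 'u) fctr \<Rightarrow> bool" where
  "strongly_class_accessible C E F \<longleftrightarrow> (\<exists>r. strongly_class_accessible_at r C E F)"


section \<open>Inserters\<close>

(* An object is a pair of an object A of K and a morphism f from F A to G A; an arrow is the
   underlying morphism k of K together with its domain and codomain. *)

definition ins_arr :: "'u \<Rightarrow> 'u \<Rightarrow> 'u \<Rightarrow> 'u" where
  "ins_arr x k y = vpair (x, vpair (k, y))"

definition ins_dom :: "'u \<Rightarrow> 'u" where
  "ins_dom m = vfst m"

definition ins_mor :: "'u \<Rightarrow> 'u" where
  "ins_mor m = vfst (vsnd m)"

definition ins_cod :: "'u \<Rightarrow> 'u" where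
  "ins_cod m = vsnd (vsnd m)"

definition Ins ::
    "('u, 'u) cat \<Rightarrow> ('u, 'u) cat \<Rightarrow> ('u, 'u, 'u, 'u) fctr \<Rightarrow> ('u, 'u, 'u, 'u) fctr \<Rightarrow> ('u, 'u) cat"
  where
  "Ins K L F G = \<lparr>
     Obj = {vpair (A, f) | A f. A \<in> Obj K \<and> f \<in> hom L (FObj F A) (FObj G A)},
     Arr = {ins_arr (vpair (A, f)) k (vpair (A', f')) | A f A' f' k.
        A \<in> Obj K \<and> f \<in> hom L (FObj F A) (FObj G A) \<and>
        A' \<in> Obj K \<and> f' \<in> hom L (FObj F A') (FObj G A') \<and>
        k \<in> hom K A A' \<and> Comp L (FArr G k) f = Comp L f' (FArr F k)},
     Dom = ins_dom,
     Cod = ins_cod,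
     Ident = (\<lambda>x. ins_arr x (Ident K (vfst x)) x),
     Comp = (\<lambda>n m. ins_arr (ins_dom m) (Comp K (ins_mor n) (ins_mor m)) (ins_cod n)) \<rparr>"

definition Ins_proj :: "('u, 'u, 'u, 'u) fctr" where
  "Ins_proj = \<lparr> FObj = vfst, FArr = ins_mor \<rparr>"

end

theory Submission
  imports Defs
begin

text \<open>
  Suppose that \<open>F\<close> and \<open>G\<close> are strongly class-accessible for the same regular cardinal \<open>r\<close>, and let
  \<open>f : F X \<rightarrow> G X\<close> be an object of the inserter. Write \<open>X\<close> as an \<open>r\<close>-filtered colimit of \<open>r\<close>-presentable
  objects \<open>D i\<close> with colimit cocone \<open>t\<close>. As \<open>F (D i)\<close> is \<open>r\<close>-presentable and \<open>G\<close> preserves the colimit, the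
  composite \<open>f \<circ> F (t_i)\<close> factors through some \<open>G (t_{n(i)})\<close>, so \<open>f\<close> is described by pieces
  \<open>\<phi>_i : F (D i) \<rightarrow> G (D (n(i)))\<close>, which are natural in \<open>i\<close> up to moving on in the diagram. Choose a
  regular cardinal \<open>s\<close> so large that closing a set of fewer than \<open>s\<close> elements under operations of arity
  below \<open>r\<close> gives fewer than \<open>s\<close> elements (\<open>sharply_below\<close>, \<open>closure_under_small_operations\<close>).
  Then the \<open>r\<close>-filtered subcategories of the index category that have fewer than \<open>s\<close> arrows and contain,
  with their objects \<open>i\<close>, the objects \<open>n(i)\<close> and witnesses for the naturality of the pieces form an
  \<open>s\<close>-directed family that covers the index category (\<open>filtered_subcategories\<close>). On the colimit \<open>Y\<close> of \<open>D\<close> over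
  such a subcategory the pieces glue to a structure map \<open>F Y \<rightarrow> G Y\<close>, and \<open>(X, f)\<close> is the
  \<open>s\<close>-directed colimit of the resulting objects of the inserter (\<open>presentable_decomposition\<close>).

  These objects are \<open>s\<close>-presentable in the inserter. First, \<open>Y\<close> is \<open>s\<close>-presentable, being a colimit of
  \<open>r\<close>-presentable objects over a category with fewer than \<open>s\<close> arrows (\<open>presentable_small_colimit\<close>). Second, an object of the inserter is
  \<open>s\<close>-presentable as soon as its underlying object and the image of that under \<open>F\<close> are
  (\<open>presentable_M\<close>); this uses that the projection creates the \<open>s\<close>-filtered colimits, which
  \<open>F\<close> preserves (\<open>colimit_lift\<close>). So the inserter is class-\<open>s\<close>-accessible. An \<open>s\<close>-presentable object of it is a
  retract of one of the objects just constructed, because its identity factors through one of them;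
  hence the projection preserves \<open>s\<close>-presentable objects.

  It remains to arrange that \<open>F\<close> and \<open>G\<close> are strongly class-accessible for the same \<open>r\<close>, and for \<open>s\<close> as well.
  The same decomposition, applied to bare objects of \<open>K\<close> and \<open>L\<close>, shows that a strongly
  class-\<open>r\<close>-accessible functor is strongly class-\<open>s\<close>-accessible whenever \<open>s\<close> is large compared with \<open>r\<close> in the
  above sense (\<open>strongly_class_accessible_at_raise\<close>); and the successor of \<open>2^\<alpha>\<close> is large compared with
  all cardinals up to \<open>\<alpha>\<close> (\<open>ex_sharply_above\<close>).
\<close>

section \<open>The universe of small sets\<close>

text \<open>
  The only parameter is the type of all sets, so that its inaccessibility is a hypothesis shared by all
  lemmas of the locale.
\<close>

locale universe =
  fixes universe_type :: "'u itself"
  assumes inacc: "inaccessible |UNIV :: 'u set|"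
begin

lemma infinite_univ: "infinite (UNIV :: 'u set)"
  using inacc unfolding inaccessible_def
  by (metis infinite_iff_natLeq_ordLeq ordLess_imp_ordLeq)

lemma inj_vpair: "inj (vpair :: 'u \<times> 'u \<Rightarrow> 'u)"
proof -
  have "|UNIV \<times> UNIV :: ('u \<times> 'u) set| \<le>o |UNIV :: 'u set|"
    using card_of_Times_same_infinite[OF infinite_univ] ordIso_iff_ordLeq by blast
  then have "\<exists>p :: 'u \<times> 'u \<Rightarrow> 'u. inj p"
    unfolding card_of_ordLeq[symmetric] by auto
  then show ?thesis
    unfolding vpair_def by (rule someI_ex)
qed

lemma vfst_vpair [simp]: "vfst (vpair (x, y) :: 'u) = x"
  unfolding vfst_def using inj_vpair by simp

lemma vsnd_vpair [simp]: "vsnd (vpair (x, y) :: 'u) = y"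
  unfolding vsnd_def using inj_vpair by simp

lemma vpair_eq [simp]: "vpair (x, y) = (vpair (x', y') :: 'u) \<longleftrightarrow> x = x' \<and> y = y'"
  using inj_vpair by (simp add: inj_eq)

lemma small_Pow: "small (A :: 'u set) \<Longrightarrow> |Pow A| <o |UNIV :: 'u set|"
  using inacc unfolding inaccessible_def small_def by (auto simp: Field_card_of)

lemma small_finite: "finite (A :: 'u set) \<Longrightarrow> small A"
  unfolding small_def using infinite_univ
  by (intro finite_ordLess_infinite card_of_Well_order) (auto simp: Field_card_of)

lemma small_subset: "small (B :: 'u set) \<Longrightarrow> A \<subseteq> B \<Longrightarrow> small A"
  unfolding small_def using card_of_mono1 ordLeq_ordLess_trans by blast

lemma small_inj:
  assumes "small (B :: 'u set)" "inj_on f A" "f ` A \<subseteq> B"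
  shows "small (A :: 'u set)"
proof -
  have "|A| \<le>o |B|"
    using assms(2,3) card_of_ordLeq[THEN iffD1] by metis
  then show ?thesis
    using assms(1) ordLeq_ordLess_trans unfolding small_def by blast
qed

lemma small_Times_image:
  fixes A B :: "'u set"
  assumes "small A" "small B"
  shows "small (vpair ` (A \<times> B))"
proof -
  have "|A \<times> B| <o |UNIV :: 'u set|"
  proof -
    have "Cinfinite |UNIV :: 'u set|" "regularCard |UNIV :: 'u set|"
      using inacc infinite_univ unfolding inaccessible_def cinfinite_def by (auto simp: Field_card_of)
    then have "stable |UNIV :: 'u set|"
      using regularCard_stable unfolding cinfinite_def by blast
    then have "|\<Union>a\<in>A. Pair a ` B| <o |UNIV :: 'u set|"
      using assms card_of_image ordLeq_ordLess_trans unfolding small_def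
      by (blast intro: stable_UNION)
    moreover have "(\<Union>a\<in>A. Pair a ` B) = A \<times> B" by blast
    ultimately show ?thesis by simp
  qed
  then show ?thesis
    unfolding small_def using card_of_image ordLeq_ordLess_trans by blast
qed

text \<open>
  Index categories have their objects and arrows in the universe, whereas the index sets that occur
  naturally, such as sets of subsets, do not. This moves them there.
\<close>

lemma copy_in_universe:
  assumes "|A| <o |UNIV :: 'u set|"
  obtains B :: "'u set" and e where "bij_betw e B A" "small B"
proof -
  obtain f where f: "inj_on f A" "f ` A \<subseteq> (UNIV :: 'u set)"
    using assms card_of_ordLeq[THEN iffD2] ordLess_imp_ordLeq by metis
  then have bij: "bij_betw f A (f ` A)"
    by (simp add: bij_betw_def)
  then have "bij_betw (inv_into A f) (f ` A) A"
    by (rule bij_betw_inv_into)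
  moreover have "small (f ` A)"
    unfolding small_def using assms card_of_image ordLeq_ordLess_trans by blast
  ultimately show thesis
    using that by blast
qed

end

section \<open>Sharply smaller cardinals\<close>

text \<open>
  A condition stronger than the usual relation \<open>r \<lhd> s\<close>, and more convenient: a set with fewer than
  \<open>s\<close> elements has fewer than \<open>s\<close> subsets with fewer than \<open>r\<close> elements, so that closing it under
  operations of arity below \<open>r\<close> adds fewer than \<open>s\<close> elements.
\<close>

definition sharply_below :: "'u rel \<Rightarrow> 'u rel \<Rightarrow> bool" where
  "sharply_below r s \<longleftrightarrow>
     r <o s \<and> (\<forall>A :: 'u set. |A| <o s \<longrightarrow> |{S. S \<subseteq> A \<and> |S| <o r}| <o s)"

text \<open>
  A nonempty subset with fewer than \<open>r \<le> \<alpha>\<close> elements is the range of a function from \<open>\<alpha>\<close>, and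
  \<open>(2^\<alpha>)^\<alpha> = 2^\<alpha>\<close>.
\<close>

lemma card_small_subsets:
  fixes A B :: "'a set" and \<alpha> :: "'a rel"
  assumes inf: "Cinfinite \<alpha>" and B: "|B| =o ctwo ^c \<alpha>" and A: "|A| \<le>o |B|" and r: "r \<le>o \<alpha>"
  shows "|{S. S \<subseteq> A \<and> |S| <o r}| \<le>o |B|"
proof -
  have co: "Card_order \<alpha>" using inf by simp
  have B_inf: "infinite B"
  proof -
    have "Cinfinite (ctwo ^c \<alpha>)"
      using inf by (simp add: Cinfinite_cexp ordLeq_refl Card_order_ctwo)
    then have "Cinfinite |B|"
      using B Cinfinite_cong ordIso_symmetric by blast
    then show ?thesis by (simp add: cinfinite_def Field_card_of)
  qed
  let ?F = "Func (Field \<alpha>) A"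
  have sub: "{S. S \<subseteq> A \<and> |S| <o r} \<subseteq> insert {} ((\<lambda>g. g ` Field \<alpha>) ` ?F)"
  proof
    fix S assume "S \<in> {S. S \<subseteq> A \<and> |S| <o r}"
    then have S: "S \<subseteq> A" "|S| <o r" by auto
    show "S \<in> insert {} ((\<lambda>g. g ` Field \<alpha>) ` ?F)"
    proof (cases "S = {}")
      case False
      have "|S| \<le>o |Field \<alpha>|"
        using S(2) r card_of_Field_ordIso[OF co]
        by (meson ordIso_symmetric ordLeq_ordIso_trans ordLess_imp_ordLeq ordLeq_transitive)
      then obtain g where g: "g ` Field \<alpha> = S"
        using False card_of_ordLeq2 by metis
      define g' where "g' x = (if x \<in> Field \<alpha> then g x else undefined)" for x
      have "g' \<in> ?F" "g' ` Field \<alpha> = S"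
        using g S(1) by (auto simp: Func_def g'_def)
      then show ?thesis by blast
    qed simp
  qed
  have "|?F| \<le>o |B|"
  proof -
    have "|?F| = |A| ^c \<alpha>"
      by (simp add: cexp_def Field_card_of)
    also have "|A| ^c \<alpha> \<le>o |B| ^c \<alpha>"
      using A co by (simp add: cexp_mono1)
    also have "|B| ^c \<alpha> =o (ctwo ^c \<alpha>) ^c \<alpha>"
      using B co by (simp add: cexp_cong1)
    also have "(ctwo ^c \<alpha>) ^c \<alpha> =o ctwo ^c (\<alpha> *c \<alpha>)"
      using cexp_cprod Card_order_ctwo by blast
    also have "ctwo ^c (\<alpha> *c \<alpha>) =o ctwo ^c \<alpha>"
      using cprod_infinite[OF inf] inf by (meson Card_order_cprod Card_order_ctwo cexp_cong2)
    also have "ctwo ^c \<alpha> =o |B|"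
      using B ordIso_symmetric by blast
    finally show ?thesis .
  qed
  then have im: "|(\<lambda>g. g ` Field \<alpha>) ` ?F| \<le>o |B|"
    using card_of_image ordLeq_transitive by blast
  have "|insert {} ((\<lambda>g. g ` Field \<alpha>) ` ?F)| \<le>o |B|"
  proof -
    have "|{{}} \<union> (\<lambda>g. g ` Field \<alpha>) ` ?F| \<le>o |B|"
    proof (rule card_of_Un_ordLeq_infinite_Field[OF _ _ im card_of_Card_order])
      show "infinite (Field |B| )"
        using B_inf by (simp add: Field_card_of)
      show "|{{} :: 'a set}| \<le>o |B|"
        using B_inf by (intro card_of_singl_ordLeq) auto
    qed
    then show ?thesis by simp
  qed
  then show ?thesis
    using card_of_mono1[OF sub] ordLeq_transitive by blast
qed

text \<open>
  Take the successor of \<open>2^\<alpha>\<close>, where \<open>\<alpha>\<close> is the larger of the two cardinals: below it there are only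
  sets with at most \<open>2^\<alpha>\<close> elements, to which the preceding count applies. Inaccessibility keeps this
  cardinal inside the universe.
\<close>

lemma (in universe) ex_sharply_above:
  fixes r1 r2 :: "'u rel"
  assumes r1: "regular_cardinal r1" and r2: "regular_cardinal r2"
  obtains s :: "'u rel" where "regular_cardinal s" "sharply_below r1 s" "sharply_below r2 s"
proof -
  have co: "Card_order r1" "Card_order r2"
    using r1 r2 unfolding regular_cardinal_def by auto
  obtain \<alpha> :: "'u rel" where \<alpha>: "Cinfinite \<alpha>" "r1 \<le>o \<alpha>" "r2 \<le>o \<alpha>" "\<alpha> <o |UNIV :: 'u set|"
  proof (cases "r1 \<le>o r2")
    case True
    then show ?thesis
      using that[of r2] r2 ordLeq_refl[OF co(2)] unfolding regular_cardinal_def by blast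
  next
    case False
    then have "r2 \<le>o r1"
      using ordLeq_total co unfolding card_order_on_def by blast
    then show ?thesis
      using that[of r1] r1 ordLeq_refl[OF co(1)] unfolding regular_cardinal_def by blast
  qed
  have small\<alpha>: "small (Field \<alpha>)"
    unfolding small_def using \<alpha>(1,4) card_of_Field_ordIso ordIso_ordLess_trans by blast
  obtain B :: "'u set" and e where B: "bij_betw e B (Pow (Field \<alpha>))" "small B"
    using copy_in_universe[OF small_Pow[OF small\<alpha>]] by blast
  have B_Pow: "|B| =o |Pow (Field \<alpha>)|"
    using B(1) card_of_ordIso by blast
  have B_exp: "|B| =o ctwo ^c \<alpha>"
    using ordIso_transitive[OF B_Pow card_of_Pow_Func]
    by (simp add: cexp_def ctwo_def Field_card_of)
  have \<alpha>_B: "\<alpha> <o |B|"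
    using ordLess_ctwo_cexp[of \<alpha>] \<alpha>(1) B_exp ordIso_symmetric ordLess_ordIso_trans by blast
  have B_inf: "Cinfinite |B|"
    using \<alpha>(1) \<alpha>_B cinfinite_mono ordLess_imp_ordLeq card_of_Card_order by blast
  have "cardSuc |B| \<le>o |Pow B|"
    by (rule cardSuc_least[OF card_of_Card_order card_of_Card_order card_of_Pow])
  then have suc_small: "cardSuc |B| <o |UNIV :: 'u set|"
    using small_Pow[OF B(2)] by (rule ordLeq_ordLess_trans)
  have "|Field (cardSuc |B| )| =o cardSuc |B|"
    by (rule card_of_Field_ordIso[OF cardSuc_Card_order[OF card_of_Card_order]])
  then obtain C :: "'u set" and e' where C: "bij_betw e' C (Field (cardSuc |B| ))" "small C"
    using copy_in_universe[OF ordIso_ordLess_trans[OF _ suc_small]] by metis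
  have C_suc: "|C| =o cardSuc |B|"
    using ordIso_transitive[OF card_of_ordIsoI[OF C(1)] \<open>|Field (cardSuc |B| )| =o cardSuc |B|\<close>] .
  have regC: "regular_cardinal |C|"
  proof -
    have ci: "Cinfinite (cardSuc |B| )"
      by (rule Cinfinite_cardSuc[OF B_inf])
    then have "Cinfinite |C|"
      by (rule Cinfinite_cong[OF ordIso_symmetric[OF C_suc]])
    moreover have "regularCard (cardSuc |B| )"
      using infinite_cardSuc_regularCard[OF _ card_of_Card_order] B_inf unfolding cinfinite_def by blast
    then have "regularCard |C|"
      by (rule regularCard_ordIso[OF ordIso_symmetric[OF C_suc] ci])
    ultimately show ?thesis
      using C(2) unfolding regular_cardinal_def small_def by blast
  qed
  have sharp: "sharply_below r |C|" if "r \<le>o \<alpha>" for r :: "'u rel"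
    unfolding sharply_below_def
  proof (intro conjI allI impI)
    have B_C: "|B| <o |C|"
      by (rule ordLess_ordIso_trans[OF cardSuc_greater[OF card_of_Card_order] ordIso_symmetric[OF C_suc]])
    show "r <o |C|"
      by (rule ordLeq_ordLess_trans[OF that ordLess_transitive[OF \<alpha>_B B_C]])
    fix A :: "'u set" assume "|A| <o |C|"
    then have "|A| <o cardSuc |B|"
      using C_suc by (rule ordLess_ordIso_trans)
    then have "|A| \<le>o |B|"
      by (simp add: cardSuc_ordLeq_ordLess[OF card_of_Card_order card_of_Card_order])
    then have "|{S. S \<subseteq> A \<and> |S| <o r}| \<le>o |B|"
      by (rule card_small_subsets[OF \<alpha>(1) B_exp _ that])
    then show "|{S. S \<subseteq> A \<and> |S| <o r}| <o |C|"
      using B_C by (rule ordLeq_ordLess_trans)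
  qed
  show thesis
    using that[OF regC sharp[OF \<alpha>(2)] sharp[OF \<alpha>(3)]] .
qed

text \<open>
  The pairs \<open>(i, x)\<close> such that \<open>x\<close> has been reached from \<open>A\<close> at the \<open>i\<close>-th step of the transfinite iteration
  of the operation along the well-order \<open>r\<close>. An inductive definition of the graph avoids a recursion
  over \<open>r\<close>.
\<close>

inductive_set stage :: "'u rel \<Rightarrow> ('u set \<Rightarrow> 'u set) \<Rightarrow> 'u set \<Rightarrow> ('u \<times> 'u) set"
  for r :: "'u rel" and op :: "'u set \<Rightarrow> 'u set" and A :: "'u set" where
  stage_base: "i \<in> Field r \<Longrightarrow> x \<in> A \<Longrightarrow> (i, x) \<in> stage r op A"
| stage_step: "(j, i) \<in> r \<Longrightarrow> j \<noteq> i \<Longrightarrow> \<forall>y\<in>S. (j, y) \<in> stage r op A \<Longrightarrow> |S| <o r \<Longrightarrow> x \<in> op S \<Longrightarrow>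
    (i, x) \<in> stage r op A"

lemma regular_UNION:
  assumes "regular_cardinal s" "|I| <o s" "\<And>i. i \<in> I \<Longrightarrow> |A i| <o s"
  shows "|\<Union>i\<in>I. A i| <o s"
  using stable_UNION[OF regularCard_stable, of s I A] assms
  unfolding regular_cardinal_def cinfinite_def by blast

lemma regular_Un:
  assumes "regular_cardinal s" "|A| <o s" "|B| <o s"
  shows "|A \<union> B| <o s"
  using assms card_of_Un_ordLess_infinite_Field[of s A B]
  unfolding regular_cardinal_def cinfinite_def by blast

lemma regular_finite:
  assumes "regular_cardinal s" "finite A"
  shows "|A| <o s"
proof -
  have s: "Card_order s" "infinite (Field s)"
    using assms(1) unfolding regular_cardinal_def cinfinite_def by auto
  have "|A| <o |Field s|"
    using assms(2) s(2) by (intro finite_ordLess_infinite card_of_Well_order) (auto simp: Field_card_of)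
  then show ?thesis
    using card_of_Field_ordIso[OF s(1)] ordLess_ordIso_trans by blast
qed

text \<open>
  The operation that chooses a \<open>W\<close> for each \<open>S\<close> is iterated \<open>r\<close> times. Each stage has fewer than \<open>s\<close>
  elements because \<open>r\<close> is sharply below \<open>s\<close> and \<open>s\<close> is regular. The union of the stages is closed because,
  by regularity of \<open>r\<close>, a subset with fewer than \<open>r\<close> elements already lies in one stage.
\<close>

lemma closure_under_small_operations:
  fixes r s :: "'u rel" and U A :: "'u set"
  assumes r: "regular_cardinal r" and s: "regular_cardinal s" and rs: "sharply_below r s"
    and A: "A \<subseteq> U" "|A| <o s"
    and R: "\<And>S. S \<subseteq> U \<Longrightarrow> |S| <o r \<Longrightarrow> \<exists>W. W \<subseteq> U \<and> |W| <o s \<and> R S W"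
  shows "\<exists>T. A \<subseteq> T \<and> T \<subseteq> U \<and> |T| <o s \<and> (\<forall>S. S \<subseteq> T \<and> |S| <o r \<longrightarrow> (\<exists>W\<subseteq>T. R S W))"
proof -
  obtain op where op: "\<And>S. S \<subseteq> U \<Longrightarrow> |S| <o r \<Longrightarrow> op S \<subseteq> U \<and> |op S| <o s \<and> R S (op S)"
    using R by metis
  define T where "T i = {x. (i, x) \<in> stage r op A}" for i
  have r': "Cinfinite r" "Card_order r" "regularCard r" "infinite (Field r)"
    using r unfolding regular_cardinal_def cinfinite_def by auto
  have wo: "Well_order r"
    using r'(2) unfolding card_order_on_def by blast
  have tr: "trans r"
    using wo unfolding well_order_on_def linear_order_on_def partial_order_on_def preorder_on_def
    by blast
  have antisym: "antisym r"
    using wo unfolding well_order_on_def linear_order_on_def partial_order_on_def by blast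
  have wf: "wf (r - Id)"
    using wo unfolding well_order_on_def by blast
  have r_s: "r <o s"
    using rs unfolding sharply_below_def by blast
  have TU: "T i \<subseteq> U" for i
  proof -
    have "(i, x) \<in> stage r op A \<Longrightarrow> x \<in> U" for x
    proof (induction rule: stage.induct)
      case (stage_step j i S x)
      then have "S \<subseteq> U" by blast
      then show ?case using op[of S] stage_step by blast
    qed (use A in blast)
    then show ?thesis unfolding T_def by blast
  qed
  have T_eq: "T i \<subseteq> A \<union> (\<Union>j\<in>underS r i. \<Union>S\<in>{S. S \<subseteq> T j \<and> |S| <o r}. op S)" for i
  proof
    fix x assume "x \<in> T i"
    then have "(i, x) \<in> stage r op A" by (simp add: T_def)
    then show "x \<in> A \<union> (\<Union>j\<in>underS r i. \<Union>S\<in>{S. S \<subseteq> T j \<and> |S| <o r}. op S)"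
      by cases (auto simp: T_def underS_def)
  qed
  have card_T: "|T i| <o s" if "i \<in> Field r" for i
    using that
  proof (induction i rule: wf_induct_rule[OF wf])
    case (1 i)
    have "|underS r i| <o r"
      using card_of_underS[OF r'(2)] 1(2) by blast
    then have u: "|underS r i| <o s"
      using r_s ordLess_transitive by blast
    have "|\<Union>S\<in>{S. S \<subseteq> T j \<and> |S| <o r}. op S| <o s" if "j \<in> underS r i" for j
    proof (rule regular_UNION[OF s])
      have "j \<in> Field r" using that unfolding underS_def Field_def by blast
      then have "|T j| <o s"
        using 1(1)[of j] that unfolding underS_def by blast
      then show "|{S. S \<subseteq> T j \<and> |S| <o r}| <o s"
        using rs unfolding sharply_below_def by blast
    qed (use op TU in blast)
    then have "|\<Union>j\<in>underS r i. \<Union>S\<in>{S. S \<subseteq> T j \<and> |S| <o r}. op S| <o s"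
      by (rule regular_UNION[OF s u])
    then have "|A \<union> (\<Union>j\<in>underS r i. \<Union>S\<in>{S. S \<subseteq> T j \<and> |S| <o r}. op S)| <o s"
      by (rule regular_Un[OF s A(2)])
    then show ?case
      by (rule ordLeq_ordLess_trans[OF card_of_mono1[OF T_eq]])
  qed
  have mono: "T i \<subseteq> T j" if "(i, j) \<in> r" for i j
  proof (cases "i = j")
    case False
    show ?thesis
    proof
      fix x assume "x \<in> T i"
      then have "(i, x) \<in> stage r op A" by (simp add: T_def)
      then have "(j, x) \<in> stage r op A"
      proof cases
        case stage_base
        moreover have "j \<in> Field r" using that by (auto simp: Field_def)
        ultimately show ?thesis by (blast intro: stage.stage_base)
      next
        case (stage_step k S)
        have "(k, j) \<in> r" using stage_step(1) that tr by (meson transD)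
        moreover have "k \<noteq> j"
          using stage_step(1,2) that antisym by (metis antisymD)
        ultimately show ?thesis
          using stage_step by (auto intro: stage.stage_step)
      qed
      then show "x \<in> T j" by (simp add: T_def)
    qed
  qed simp
  define TT where "TT = (\<Union>i\<in>Field r. T i)"
  have "|Field r| <o s"
    using card_of_Field_ordIso[OF r'(2)] r_s by (rule ordIso_ordLess_trans)
  then have "|TT| <o s"
    unfolding TT_def using card_T by (rule regular_UNION[OF s])
  moreover have "A \<subseteq> TT"
  proof -
    obtain i where "i \<in> Field r"
      using r'(4) by (metis all_not_in_conv finite.emptyI)
    then show ?thesis unfolding TT_def T_def by (blast intro: stage_base)
  qed
  moreover have "TT \<subseteq> U"
    unfolding TT_def using TU by blast
  moreover have "\<exists>W\<subseteq>TT. R S W" if S: "S \<subseteq> TT" "|S| <o r" for S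
  proof -
    have "relChain r T"
      unfolding relChain_def using mono by blast
    then obtain i where i: "i \<in> Field r" "S \<subseteq> T i"
      using regularCard_UNION[OF r'(2,3) _ S(1)[unfolded TT_def] S(2)] r'(1)
      unfolding cinfinite_def by blast
    obtain j where j: "j \<in> Field r" "i \<noteq> j" "(i, j) \<in> r"
      using infinite_Card_order_limit[OF r'(2,4) i(1)] by blast
    have "op S \<subseteq> T j"
      using stage_step[OF j(3,2) _ S(2)] i(2) unfolding T_def by blast
    moreover have "R S (op S)"
      using op[of S] i(2) TU S(2) by blast
    ultimately show ?thesis
      unfolding TT_def using j(1) by blast
  qed
  ultimately show ?thesis by blast
qed

section \<open>Cocones and colimits\<close>

context category begin

lemma hom_Arr: "f \<in> Arr C \<Longrightarrow> f \<in> hom C (Dom C f) (Cod C f)"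
  by (simp add: hom_def)

lemma hom_Dom: "f \<in> hom C A B \<Longrightarrow> A \<in> Obj C"
  using Dom_Obj by (auto simp: hom_def)

lemma hom_Cod: "f \<in> hom C A B \<Longrightarrow> B \<in> Obj C"
  using Cod_Obj by (auto simp: hom_def)

end

lemma hom_simps: "f \<in> hom C A B \<Longrightarrow> f \<in> Arr C \<and> Dom C f = A \<and> Cod C f = B"
  by (simp add: hom_def)

lemma fctr_comp_simps [simp]:
  "FObj (fctr_comp G F) A = FObj G (FObj F A)"
  "FArr (fctr_comp G F) f = FArr G (FArr F f)"
  by (simp_all add: fctr_comp_def)

lemma cat_functor_comp:
  assumes "cat_functor C E F" "cat_functor E H G"
  shows "cat_functor C H (fctr_comp G F)"
proof -
  interpret F: cat_functor C E F by fact
  interpret G: cat_functor E H G by fact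
  show ?thesis
  proof unfold_locales
    show "FArr (fctr_comp G F) (Comp C g f) = Comp H (FArr (fctr_comp G F) g) (FArr (fctr_comp G F) f)"
      if "f \<in> hom C A B" "g \<in> hom C B D" for f g A B D
      using G.FArr_Comp[OF F.FArr_hom F.FArr_hom] F.FArr_Comp that by simp
  qed (auto simp: F.FObj_Obj G.FObj_Obj F.FArr_hom G.FArr_hom F.FArr_Ident G.FArr_Ident)
qed

lemma cocone_hom: "cocone I C D c t \<Longrightarrow> i \<in> Obj I \<Longrightarrow> t i \<in> hom C (FObj D i) c"
  by (simp add: cocone_def)

lemma cocone_natural: "cocone I C D c t \<Longrightarrow> u \<in> hom I i j \<Longrightarrow> Comp C (t j) (FArr D u) = t i"
  by (auto simp: cocone_def hom_def)

lemma cocone_Obj: "cocone I C D c t \<Longrightarrow> c \<in> Obj C"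
  by (simp add: cocone_def)

lemma coconeI:
  assumes "category I" "c \<in> Obj C" "\<And>i. i \<in> Obj I \<Longrightarrow> t i \<in> hom C (FObj D i) c"
    and "\<And>i j u. u \<in> hom I i j \<Longrightarrow> Comp C (t j) (FArr D u) = t i"
  shows "cocone I C D c t"
  using assms by (auto simp: cocone_def category.hom_Arr)

lemma colimit_cocone: "colimit I C D c t \<Longrightarrow> cocone I C D c t"
  by (simp add: colimit_def)

lemmas colimit_hom = cocone_hom[OF colimit_cocone]
lemmas colimit_natural = cocone_natural[OF colimit_cocone]
lemmas colimit_Obj = cocone_Obj[OF colimit_cocone]

lemma colimit_factor:
  assumes "colimit I C D c t" "cocone I C D d s"
  obtains h where "h \<in> hom C c d" "\<And>i. i \<in> Obj I \<Longrightarrow> Comp C h (t i) = s i"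
  using assms unfolding colimit_def by metis

lemma cocone_comp:
  assumes D: "cat_functor I C D" and t: "cocone I C D c t" and g: "g \<in> hom C c d"
  shows "cocone I C D d (\<lambda>i. Comp C g (t i))"
proof -
  interpret D: cat_functor I C D by fact
  show ?thesis
  proof (rule coconeI)
    show "category I" by unfold_locales
    show "d \<in> Obj C" using D.cod.hom_Cod[OF g] .
    show "Comp C g (t i) \<in> hom C (FObj D i) d" if "i \<in> Obj I" for i
      using D.cod.Comp_hom[OF cocone_hom[OF t that] g] .
    show "Comp C (Comp C g (t j)) (FArr D u) = Comp C g (t i)" if u: "u \<in> hom I i j" for i j u
      using D.cod.Comp_assoc[OF D.FArr_hom[OF u] cocone_hom[OF t D.dom.hom_Cod[OF u]] g]
        cocone_natural[OF t u] by simp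
  qed
qed

lemma colimit_eqI:
  assumes D: "cat_functor I C D" and t: "colimit I C D c t"
    and g: "g \<in> hom C c d" and g': "g' \<in> hom C c d"
    and eq: "\<And>i. i \<in> Obj I \<Longrightarrow> Comp C g (t i) = Comp C g' (t i)"
  shows "g = g'"
proof -
  have "cocone I C D d (\<lambda>i. Comp C g (t i))"
    using cocone_comp[OF D colimit_cocone[OF t] g] .
  then have "\<exists>!h. h \<in> hom C c d \<and> (\<forall>i\<in>Obj I. Comp C h (t i) = Comp C g (t i))"
    using t unfolding colimit_def by blast
  then show ?thesis
    using g g' eq by metis
qed

lemma colimitI:
  assumes "cocone I C D c t"
    and "\<And>d s. cocone I C D d s \<Longrightarrow> \<exists>h\<in>hom C c d. \<forall>i\<in>Obj I. Comp C h (t i) = s i"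
    and "\<And>d h h'. h \<in> hom C c d \<Longrightarrow> h' \<in> hom C c d \<Longrightarrow>
      \<forall>i\<in>Obj I. Comp C h (t i) = Comp C h' (t i) \<Longrightarrow> h = h'"
  shows "colimit I C D c t"
  unfolding colimit_def
proof (intro conjI allI impI)
  fix d s assume "cocone I C D d s"
  then obtain h where "h\<in>hom C c d" "\<forall>i\<in>Obj I. Comp C h (t i) = s i"
    using assms(2) by blast
  then show "\<exists>!h. h \<in> hom C c d \<and> (\<forall>i\<in>Obj I. Comp C h (t i) = s i)"
    using assms(3) by (intro ex1I[of _ h]) auto
qed (fact assms(1))

lemma colimit_cong:
  assumes "category I" "colimit I C D c t" "\<And>i. i \<in> Obj I \<Longrightarrow> t i = t' i"
  shows "colimit I C D c t'"
proof -
  have "t (Dom I u) = t' (Dom I u)" "t (Cod I u) = t' (Cod I u)" if "u \<in> Arr I" for u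
    using assms(3) category.Dom_Obj[OF assms(1) that] category.Cod_Obj[OF assms(1) that] by auto
  then have "cocone I C D c t'"
    using colimit_cocone[OF assms(2)] assms(3) unfolding cocone_def by auto
  moreover have "(\<forall>i\<in>Obj I. Comp C h (t i) = s i) = (\<forall>i\<in>Obj I. Comp C h (t' i) = s i)" for h s
    using assms(3) by auto
  ultimately show ?thesis
    using assms(2) unfolding colimit_def by simp
qed

lemma colimit_unique:
  assumes D: "cat_functor I C D" and t: "colimit I C D c t" and s: "colimit I C D d s"
  obtains f g where "f \<in> hom C c d" "g \<in> hom C d c" "Comp C g f = Ident C c" "Comp C f g = Ident C d"
    "\<And>i. i \<in> Obj I \<Longrightarrow> Comp C f (t i) = s i"
proof -
  interpret D: cat_functor I C D by fact
  obtain f where f: "f \<in> hom C c d" "\<And>i. i \<in> Obj I \<Longrightarrow> Comp C f (t i) = s i"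
    using colimit_factor[OF t colimit_cocone[OF s]] by blast
  obtain g where g: "g \<in> hom C d c" "\<And>i. i \<in> Obj I \<Longrightarrow> Comp C g (s i) = t i"
    using colimit_factor[OF s colimit_cocone[OF t]] by blast
  have "Comp C g f = Ident C c"
  proof (rule colimit_eqI[OF D t D.cod.Comp_hom[OF f(1) g(1)] D.cod.Ident_hom[OF colimit_Obj[OF t]]])
    fix i assume i: "i \<in> Obj I"
    show "Comp C (Comp C g f) (t i) = Comp C (Ident C c) (t i)"
      using D.cod.Comp_assoc[OF colimit_hom[OF t i] f(1) g(1)] f(2)[OF i] g(2)[OF i]
        D.cod.Ident_Comp[OF colimit_hom[OF t i]] by simp
  qed
  moreover have "Comp C f g = Ident C d"
  proof (rule colimit_eqI[OF D s D.cod.Comp_hom[OF g(1) f(1)] D.cod.Ident_hom[OF colimit_Obj[OF s]]])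
    fix i assume i: "i \<in> Obj I"
    show "Comp C (Comp C f g) (s i) = Comp C (Ident C d) (s i)"
      using D.cod.Comp_assoc[OF colimit_hom[OF s i] g(1) f(1)] f(2)[OF i] g(2)[OF i]
        D.cod.Ident_Comp[OF colimit_hom[OF s i]] by simp
  qed
  ultimately show thesis
    using that f g by blast
qed

lemma colimit_iso:
  assumes D: "cat_functor I C D" and t: "colimit I C D c t"
    and f: "f \<in> hom C c d" and g: "g \<in> hom C d c"
    and gf: "Comp C g f = Ident C c" and fg: "Comp C f g = Ident C d"
  shows "colimit I C D d (\<lambda>i. Comp C f (t i))"
proof (rule colimitI)
  interpret D: cat_functor I C D by fact
  show "cocone I C D d (\<lambda>i. Comp C f (t i))"
    using cocone_comp[OF D colimit_cocone[OF t] f] .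
  show "\<exists>h\<in>hom C d e. \<forall>i\<in>Obj I. Comp C h (Comp C f (t i)) = s i" if s: "cocone I C D e s" for e s
  proof -
    obtain h where h: "h \<in> hom C c e" "\<And>i. i \<in> Obj I \<Longrightarrow> Comp C h (t i) = s i"
      using colimit_factor[OF t s] by blast
    have "Comp C (Comp C h g) (Comp C f (t i)) = s i" if i: "i \<in> Obj I" for i
    proof -
      have ti: "t i \<in> hom C (FObj D i) c" using colimit_hom[OF t i] .
      have "Comp C (Comp C h g) (Comp C f (t i)) = Comp C h (Comp C g (Comp C f (t i)))"
        using D.cod.Comp_assoc[OF D.cod.Comp_hom[OF ti f] g h(1)] by simp
      also have "Comp C g (Comp C f (t i)) = t i"
        using D.cod.Comp_assoc[OF ti f g] gf D.cod.Ident_Comp[OF ti] by simp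
      finally show ?thesis using h(2)[OF i] by simp
    qed
    then show ?thesis using D.cod.Comp_hom[OF g h(1)] by blast
  qed
  show "h = h'" if h: "h \<in> hom C d e" "h' \<in> hom C d e"
    and eq: "\<forall>i\<in>Obj I. Comp C h (Comp C f (t i)) = Comp C h' (Comp C f (t i))" for e h h'
  proof -
    have "Comp C h f = Comp C h' f"
    proof (rule colimit_eqI[OF D t D.cod.Comp_hom[OF f h(1)] D.cod.Comp_hom[OF f h(2)]])
      fix i assume i: "i \<in> Obj I"
      show "Comp C (Comp C h f) (t i) = Comp C (Comp C h' f) (t i)"
        using D.cod.Comp_assoc[OF colimit_hom[OF t i] f] h eq i by auto
    qed
    then have "Comp C h (Comp C f g) = Comp C h' (Comp C f g)"
      using D.cod.Comp_assoc[OF g f] h by auto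
    then show ?thesis
      using fg D.cod.Comp_Ident h by metis
  qed
qed

text \<open>
  Whether a functor preserves the colimit of a given diagram can be tested on any one colimit cocone.
  For the projection from the inserter, this is the cocone lifted from the base.
\<close>

lemma colimit_preserved_of_one:
  assumes D: "cat_functor I C D" and P: "cat_functor C E P"
    and t: "colimit I C D c t" and Pt: "colimit I E (fctr_comp P D) (FObj P c) (\<lambda>i. FArr P (t i))"
    and s: "colimit I C D d s"
  shows "colimit I E (fctr_comp P D) (FObj P d) (\<lambda>i. FArr P (s i))"
proof -
  interpret D: cat_functor I C D by fact
  interpret P: cat_functor C E P by fact
  obtain f g where fg: "f \<in> hom C c d" "g \<in> hom C d c" "Comp C g f = Ident C c" "Comp C f g = Ident C d"
    and fi: "\<And>i. i \<in> Obj I \<Longrightarrow> Comp C f (t i) = s i"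
    using colimit_unique[OF D t s] by blast
  have "colimit I E (fctr_comp P D) (FObj P d) (\<lambda>i. Comp E (FArr P f) (FArr P (t i)))"
  proof (rule colimit_iso[OF cat_functor_comp[OF D P] Pt P.FArr_hom[OF fg(1)] P.FArr_hom[OF fg(2)]])
    show "Comp E (FArr P g) (FArr P f) = Ident E (FObj P c)"
      using P.FArr_Comp[OF fg(1,2)] fg(3) P.FArr_Ident[OF D.cod.hom_Dom[OF fg(1)]] by simp
    show "Comp E (FArr P f) (FArr P g) = Ident E (FObj P d)"
      using P.FArr_Comp[OF fg(2,1)] fg(4) P.FArr_Ident[OF D.cod.hom_Dom[OF fg(2)]] by simp
  qed
  then show ?thesis
  proof (rule colimit_cong[rotated])
    show "category I" by unfold_locales
    fix i assume i: "i \<in> Obj I"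
    show "Comp E (FArr P f) (FArr P (t i)) = FArr P (s i)"
      using P.FArr_Comp[OF colimit_hom[OF t i] fg(1)] fi[OF i] by simp
  qed
qed

section \<open>Filtered categories\<close>

lemma filteredD_bound:
  "filtered r I \<Longrightarrow> S \<subseteq> Obj I \<Longrightarrow> |S| <o r \<Longrightarrow> \<exists>c\<in>Obj I. \<forall>s\<in>S. hom I s c \<noteq> {}"
  by (simp add: filtered_def)

lemma filteredD_coequalizer:
  "filtered r I \<Longrightarrow> a \<in> Obj I \<Longrightarrow> b \<in> Obj I \<Longrightarrow> S \<subseteq> hom I a b \<Longrightarrow> |S| <o r \<Longrightarrow>
     \<exists>c\<in>Obj I. \<exists>h\<in>hom I b c. \<forall>f\<in>S. \<forall>g\<in>S. Comp I h f = Comp I h g"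
  by (simp add: filtered_def)

lemma card_image_less: "|A| <o r \<Longrightarrow> |f ` A| <o r"
  by (rule ordLeq_ordLess_trans[OF card_of_image])

lemma filtered_coequalizer:
  assumes "filtered r I" "category I" "b \<in> Obj I" "S \<subseteq> hom I a b" "|S| <o r"
  obtains c h where "h \<in> hom I b c" "\<forall>f\<in>S. \<forall>g\<in>S. Comp I h f = Comp I h g"
proof (cases "S = {}")
  case True
  then show ?thesis using that[of "Ident I b" b] category.Ident_hom[OF assms(2,3)] by blast
next
  case False
  then have "a \<in> Obj I" using category.hom_Dom[OF assms(2)] assms(4) by blast
  then obtain c h where "h \<in> hom I b c" "\<forall>f\<in>S. \<forall>g\<in>S. Comp I h f = Comp I h g"
    using filteredD_coequalizer[OF assms(1) _ assms(3,4,5)] by auto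
  then show ?thesis using that by blast
qed

lemma filtered_pair:
  assumes "filtered r I" "regular_cardinal r" "i \<in> Obj I" "j \<in> Obj I"
  obtains k u v where "u \<in> hom I i k" "v \<in> hom I j k"
proof -
  have "|{i, j}| <o r" by (rule regular_finite[OF assms(2)]) simp
  then have "\<exists>c\<in>Obj I. \<forall>s\<in>{i, j}. hom I s c \<noteq> {}"
    using assms(3,4) by (intro filteredD_bound[OF assms(1)]) auto
  then show ?thesis using that by auto
qed

lemma filtered_parallel:
  assumes "filtered r I" "regular_cardinal r" "category I" "u \<in> hom I i j" "v \<in> hom I i j"
  obtains k h where "h \<in> hom I j k" "Comp I h u = Comp I h v"
proof -
  have "|{u, v}| <o r" by (rule regular_finite[OF assms(2)]) simp
  then have "\<exists>c\<in>Obj I. \<exists>h\<in>hom I j c. \<forall>f\<in>{u, v}. \<forall>g\<in>{u, v}. Comp I h f = Comp I h g"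
    using assms(4,5) category.hom_Dom[OF assms(3)] category.hom_Cod[OF assms(3)]
    by (intro filteredD_coequalizer[OF assms(1)]) auto
  then show ?thesis using that by auto
qed

lemma filtered_square:
  assumes f: "filtered r I" and r: "regular_cardinal r" and I: "category I"
    and u: "u \<in> hom I i j" and v: "v \<in> hom I i k"
  obtains l p q where "p \<in> hom I j l" "q \<in> hom I k l" "Comp I p u = Comp I q v"
proof -
  interpret category I by fact
  obtain m a b where ab: "a \<in> hom I j m" "b \<in> hom I k m"
    using filtered_pair[OF f r hom_Cod[OF u] hom_Cod[OF v]] .
  obtain l h where h: "h \<in> hom I m l" "Comp I h (Comp I a u) = Comp I h (Comp I b v)"
    using filtered_parallel[OF f r I Comp_hom[OF u ab(1)] Comp_hom[OF v ab(2)]] .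
  show thesis
    using that[OF Comp_hom[OF ab(1) h(1)] Comp_hom[OF ab(2) h(1)]] h(2)
      Comp_assoc[OF u ab(1) h(1)] Comp_assoc[OF v ab(2) h(1)] by simp
qed

text \<open>
  Fewer than \<open>r\<close> arrows out of one object are composed to arrows with a common target, and these are
  then coequalized. Adding the identity to the arrows covers the case of an empty family.
\<close>

lemma filtered_wide_span:
  fixes I :: "('i, 'j) cat" and r :: "'u rel"
  assumes f: "filtered r I" and r: "regular_cardinal r" and I: "category I"
    and i: "i \<in> Obj I" and S: "\<And>u. u \<in> S \<Longrightarrow> u \<in> Arr I \<and> Dom I u = i" "|S| <o r"
  obtains c w where "w \<in> hom I i c" "\<forall>u\<in>S. \<exists>v\<in>hom I (Cod I u) c. Comp I v u = w"
proof -
  interpret category I by fact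
  let ?S = "insert (Ident I i) S"
  have S': "u \<in> hom I i (Cod I u)" if "u \<in> ?S" for u
    using that S(1) Ident_hom[OF i] by (auto simp: hom_def)
  have "|?S| <o r"
    using regular_Un[OF r regular_finite[OF r, of "{Ident I i}"] S(2)] by simp
  then have cS: "|Cod I ` ?S| <o r" "|?S| <o r"
    by (simp_all only: card_image_less)
  have "Cod I ` ?S \<subseteq> Obj I" using S' hom_Cod by blast
  then have "\<exists>b\<in>Obj I. \<forall>s\<in>Cod I ` ?S. hom I s b \<noteq> {}"
    by (rule filteredD_bound[OF f _ cS(1)])
  then obtain b where b: "b \<in> Obj I" "\<forall>s\<in>Cod I ` ?S. hom I s b \<noteq> {}" by blast
  then have "\<forall>u\<in>?S. \<exists>a. a \<in> hom I (Cod I u) b" by auto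
  then obtain a where a: "\<And>u. u \<in> ?S \<Longrightarrow> a u \<in> hom I (Cod I u) b" by metis
  have sub: "(\<lambda>u. Comp I (a u) u) ` ?S \<subseteq> hom I i b"
    using Comp_hom[OF S' a] by auto
  have "|(\<lambda>u. Comp I (a u) u) ` ?S| <o r"
    using cS(2) by (rule card_image_less)
  then obtain c h where h: "h \<in> hom I b c" and
    eq: "\<forall>p\<in>(\<lambda>u. Comp I (a u) u) ` ?S. \<forall>q\<in>(\<lambda>u. Comp I (a u) u) ` ?S. Comp I h p = Comp I h q"
    by (rule filtered_coequalizer[OF f I b(1) sub])
  define w where "w = Comp I h (Comp I (a (Ident I i)) (Ident I i))"
  show thesis
  proof (rule that)
    show "w \<in> hom I i c"
      unfolding w_def using sub by (intro Comp_hom[OF _ h]) auto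
    show "\<forall>u\<in>S. \<exists>v\<in>hom I (Cod I u) c. Comp I v u = w"
    proof
      fix u assume u: "u \<in> S"
      then have uS: "u \<in> ?S" by simp
      have "Comp I h (Comp I (a u) u) = w"
        unfolding w_def by (rule eq[rule_format, OF imageI[OF uS] imageI]) simp
      then have "Comp I (Comp I h (a u)) u = w"
        using Comp_assoc[OF S'[OF uS] a[OF uS] h] by simp
      then show "\<exists>v\<in>hom I (Cod I u) c. Comp I v u = w"
        using Comp_hom[OF a[OF uS] h] by blast
    qed
  qed
qed

text \<open>
  Conditions that hold after some step in a filtered category and persist afterwards can be met
  simultaneously, if there are fewer than \<open>r\<close> of them. This is the form in which filteredness is used
  to show that small colimits of presentable objects are presentable.
\<close>

lemma filtered_simultaneously:
  fixes I :: "('i, 'j) cat" and r :: "'u rel"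
  assumes f: "filtered r I" and r: "regular_cardinal r" and I: "category I"
    and i: "i \<in> Obj I" and X: "|X| <o r"
    and ex: "\<And>x. x \<in> X \<Longrightarrow> \<exists>j. \<exists>u\<in>hom I i j. Q x u"
    and up: "\<And>x j k u v. x \<in> X \<Longrightarrow> u \<in> hom I i j \<Longrightarrow> v \<in> hom I j k \<Longrightarrow> Q x u \<Longrightarrow> Q x (Comp I v u)"
  shows "\<exists>j. \<exists>w\<in>hom I i j. \<forall>x\<in>X. Q x w"
proof -
  have "\<forall>x\<in>X. \<exists>u j. u \<in> hom I i j \<and> Q x u" using ex by blast
  then obtain u j where u: "\<And>x. x \<in> X \<Longrightarrow> u x \<in> hom I i (j x) \<and> Q x (u x)" by metis
  have uX: "|u ` X| <o r" using X by (rule card_image_less)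
  have aX: "a \<in> Arr I \<and> Dom I a = i" if "a \<in> u ` X" for a
    using that u hom_simps by fast
  obtain w c where w: "w \<in> hom I i c" "\<forall>a\<in>u ` X. \<exists>v\<in>hom I (Cod I a) c. Comp I v a = w"
    by (rule filtered_wide_span[OF f r I i aX uX])
  have "Q x w" if x: "x \<in> X" for x
  proof -
    have Cx: "Cod I (u x) = j x" using u[OF x] hom_simps by fast
    obtain v where "v \<in> hom I (j x) c" "Comp I v (u x) = w"
      using bspec[OF w(2), of "u x"] x Cx by auto
    then show ?thesis using up[OF x, of "u x" "j x" v c] u[OF x] by simp
  qed
  then show ?thesis using w(1) by blast
qed

lemma filtered_mono:
  fixes I :: "('i, 'j) cat"
  assumes "filtered s I" "r \<le>o s"
  shows "filtered r I"
proof -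
  have "|S| <o s" if "|S| <o r" for S :: "'j set"
    using that assms(2) by (rule ordLess_ordLeq_trans)
  moreover have "|S| <o s" if "|S| <o r" for S :: "'i set"
    using that assms(2) by (rule ordLess_ordLeq_trans)
  ultimately show ?thesis
    using assms(1) by (simp add: filtered_def)
qed

section \<open>Presentable objects in elementary terms\<close>

lemma Set_cat_hom:
  "m \<in> hom Set_cat X Y \<longleftrightarrow> (\<exists>f. m = (X, f, Y) \<and> small X \<and> small Y \<and> f \<in> X \<rightarrow>\<^sub>E Y)"
  by (auto simp: hom_def Set_cat_def)

lemma Set_cat_Comp [simp]: "Comp Set_cat (Y, g, Z) (X, f, Y') = (X, compose X g f, Z)"
  by (simp add: Set_cat_def)

lemma Set_cat_Obj [simp]: "X \<in> Obj Set_cat \<longleftrightarrow> small X"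
  by (simp add: Set_cat_def)

text \<open>
  A cocone in the category of sets under the diagram \<open>hom(A, D i)\<close>, stripped of the bookkeeping of
  domains, codomains and extensionality.
\<close>

definition hom_cone ::
    "('i, 'j) cat \<Rightarrow> ('o, 'u) cat \<Rightarrow> ('i, 'j, 'o, 'u) fctr \<Rightarrow> 'o \<Rightarrow> 'u set \<Rightarrow> ('i \<Rightarrow> 'u \<Rightarrow> 'u) \<Rightarrow> bool" where
  "hom_cone I C D A d \<phi> \<longleftrightarrow>
     (\<forall>i\<in>Obj I. \<forall>x\<in>hom C A (FObj D i). \<phi> i x \<in> d) \<and>
     (\<forall>i j u x. u \<in> hom I i j \<and> x \<in> hom C A (FObj D i) \<longrightarrow> \<phi> j (Comp C (FArr D u) x) = \<phi> i x)"

text \<open>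
  A diagram together with the object whose hom-functor is applied to it. The lemmas of this locale
  translate between colimits in the category of sets and statements about arrows.
\<close>

locale hom_diagram = D: cat_functor I C D
  for I :: "('i, 'j) cat" and C :: "('o, 'u) cat" and D :: "('i, 'j, 'o, 'u) fctr" +
  fixes A :: 'o
  assumes A_Obj: "A \<in> Obj C" and loc_small: "locally_small C"
begin

abbreviation H where "H \<equiv> fctr_comp (hom_functor C A) D"

lemma small_hom: "X \<in> Obj C \<Longrightarrow> small (hom C A X)"
  using loc_small A_Obj by (simp add: locally_small_def)

lemma FObj_H [simp]: "FObj (hom_functor C A) X = hom C A X"
  by (simp add: hom_functor_def)

lemma FArr_H: "f \<in> hom C X Y \<Longrightarrow>
    FArr (hom_functor C A) f = (hom C A X, \<lambda>x\<in>hom C A X. Comp C f x, hom C A Y)"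
  by (simp add: hom_functor_def hom_def)

lemma FArr_H_hom: "f \<in> hom C X Y \<Longrightarrow> FArr (hom_functor C A) f \<in> hom Set_cat (hom C A X) (hom C A Y)"
  unfolding FArr_H Set_cat_hom using small_hom D.cod.hom_Dom D.cod.hom_Cod
  by (auto intro: D.cod.Comp_hom)

lemma cocone_of_hom_cone:
  assumes "hom_cone I C D A d \<phi>" "small d"
  shows "cocone I Set_cat H d (\<lambda>i. (hom C A (FObj D i), restrict (\<phi> i) (hom C A (FObj D i)), d))"
proof (rule coconeI)
  show "category I" by unfold_locales
  show "d \<in> Obj Set_cat" using assms(2) by simp
  show "(hom C A (FObj D i), restrict (\<phi> i) (hom C A (FObj D i)), d) \<in> hom Set_cat (FObj H i) d"
    if "i \<in> Obj I" for i
    using assms that small_hom[OF D.FObj_Obj[OF that]] by (auto simp: Set_cat_hom hom_cone_def)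
  show "Comp Set_cat (hom C A (FObj D j), restrict (\<phi> j) (hom C A (FObj D j)), d) (FArr H u) =
      (hom C A (FObj D i), restrict (\<phi> i) (hom C A (FObj D i)), d)"
    if u: "u \<in> hom I i j" for i j u
  proof -
    have "compose (hom C A (FObj D i)) (restrict (\<phi> j) (hom C A (FObj D j)))
        (\<lambda>x\<in>hom C A (FObj D i). Comp C (FArr D u) x) = restrict (\<phi> i) (hom C A (FObj D i))"
    proof
      fix x
      show "compose (hom C A (FObj D i)) (restrict (\<phi> j) (hom C A (FObj D j)))
        (\<lambda>x\<in>hom C A (FObj D i). Comp C (FArr D u) x) x = restrict (\<phi> i) (hom C A (FObj D i)) x"
      proof (cases "x \<in> hom C A (FObj D i)")
        case True
        have "Comp C (FArr D u) x \<in> hom C A (FObj D j)"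
          using D.cod.Comp_hom[OF True D.FArr_hom[OF u]] .
        moreover have "\<phi> j (Comp C (FArr D u) x) = \<phi> i x"
          using assms(1) u True by (simp add: hom_cone_def)
        ultimately show ?thesis using True by (simp add: compose_def)
      qed (simp add: compose_def)
    qed
    then show ?thesis using FArr_H[OF D.FArr_hom[OF u]] by simp
  qed
qed

lemma hom_cone_of_cocone:
  assumes s: "cocone I Set_cat H d s"
  defines "\<phi> \<equiv> \<lambda>i. fst (snd (s i))"
  shows "hom_cone I C D A d \<phi>" "small d"
    "\<And>i. i \<in> Obj I \<Longrightarrow> s i = (hom C A (FObj D i), restrict (\<phi> i) (hom C A (FObj D i)), d)"
proof -
  have si: "s i = (hom C A (FObj D i), \<phi> i, d)" "\<phi> i \<in> hom C A (FObj D i) \<rightarrow>\<^sub>E d"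
    if "i \<in> Obj I" for i
    using cocone_hom[OF s that] unfolding Set_cat_hom \<phi>_def by auto
  show "small d" using cocone_Obj[OF s] by simp
  show "s i = (hom C A (FObj D i), restrict (\<phi> i) (hom C A (FObj D i)), d)" if "i \<in> Obj I" for i
    using si[OF that] by (simp add: PiE_restrict)
  show "hom_cone I C D A d \<phi>"
    unfolding hom_cone_def
  proof (intro conjI ballI allI impI)
    show "\<phi> i x \<in> d" if "i \<in> Obj I" "x \<in> hom C A (FObj D i)" for i x
      using si(2)[OF that(1)] that(2) by auto
    fix i j u x assume "u \<in> hom I i j \<and> x \<in> hom C A (FObj D i)"
    then have u: "u \<in> hom I i j" and x: "x \<in> hom C A (FObj D i)" by auto
    have "Comp Set_cat (s j) (FArr H u) = s i" using cocone_natural[OF s u] .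
    then have "compose (hom C A (FObj D i)) (\<phi> j) (\<lambda>x\<in>hom C A (FObj D i). Comp C (FArr D u) x) = \<phi> i"
      using si(1)[OF D.dom.hom_Dom[OF u]] si(1)[OF D.dom.hom_Cod[OF u]] FArr_H[OF D.FArr_hom[OF u]]
      by simp
    from fun_cong[OF this, of x] show "\<phi> j (Comp C (FArr D u) x) = \<phi> i x"
      using x by (simp add: compose_def)
  qed
qed

context
  fixes c t assumes t: "cocone I C D c t"
begin

abbreviation Ht where "Ht \<equiv> \<lambda>i. FArr (hom_functor C A) (t i)"

lemma Set_comp_Ht:
  assumes "i \<in> Obj I"
  shows "Comp Set_cat (hom C A c, h, d) (Ht i) =
    (hom C A (FObj D i), \<lambda>x\<in>hom C A (FObj D i). h (Comp C (t i) x), d)"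
  using FArr_H[OF cocone_hom[OF t assms]] by (auto simp: compose_def)

lemma hom_colimit_factor:
  assumes col: "colimit I Set_cat H (hom C A c) Ht" and \<phi>: "hom_cone I C D A d \<phi>" "small d"
  shows "\<exists>h. \<forall>i\<in>Obj I. \<forall>x\<in>hom C A (FObj D i). h (Comp C (t i) x) = \<phi> i x"
proof -
  obtain m where m: "m \<in> hom Set_cat (hom C A c) d"
    "\<And>i. i \<in> Obj I \<Longrightarrow> Comp Set_cat m (Ht i) = (hom C A (FObj D i), restrict (\<phi> i) (hom C A (FObj D i)), d)"
    using colimit_factor[OF col cocone_of_hom_cone[OF \<phi>]] by blast
  then obtain h where h: "m = (hom C A c, h, d)" "h \<in> hom C A c \<rightarrow>\<^sub>E d"
    unfolding Set_cat_hom by blast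
  show ?thesis
  proof (intro exI ballI)
    fix i x assume i: "i \<in> Obj I" and x: "x \<in> hom C A (FObj D i)"
    have "(\<lambda>x\<in>hom C A (FObj D i). h (Comp C (t i) x)) = restrict (\<phi> i) (hom C A (FObj D i))"
      using m(2)[OF i] unfolding h(1) Set_comp_Ht[OF i] by simp
    from fun_cong[OF this, of x] show "h (Comp C (t i) x) = \<phi> i x" using x by simp
  qed
qed

lemma hom_colimit_unique:
  assumes col: "colimit I Set_cat H (hom C A c) Ht"
    and d: "small (d :: 'u set)" "\<And>x. x \<in> hom C A c \<Longrightarrow> h x \<in> d" "\<And>x. x \<in> hom C A c \<Longrightarrow> h' x \<in> d"
    and eq: "\<And>i x. i \<in> Obj I \<Longrightarrow> x \<in> hom C A (FObj D i) \<Longrightarrow> h (Comp C (t i) x) = h' (Comp C (t i) x)"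
    and x: "x \<in> hom C A c"
  shows "h x = h' x"
proof -
  let ?s = "\<lambda>i. (hom C A (FObj D i), restrict (\<lambda>x. h (Comp C (t i) x)) (hom C A (FObj D i)), d)"
  have "hom_cone I C D A d (\<lambda>i x. h (Comp C (t i) x))"
    unfolding hom_cone_def
  proof (intro conjI ballI allI impI)
    show "h (Comp C (t i) x) \<in> d" if "i \<in> Obj I" "x \<in> hom C A (FObj D i)" for i x
      using d(2)[OF D.cod.Comp_hom[OF that(2) cocone_hom[OF t that(1)]]] .
    fix i j u x assume "u \<in> hom I i j \<and> x \<in> hom C A (FObj D i)"
    then have u: "u \<in> hom I i j" and x: "x \<in> hom C A (FObj D i)" by auto
    have "Comp C (t j) (Comp C (FArr D u) x) = Comp C (t i) x"
      using D.cod.Comp_assoc[OF x D.FArr_hom[OF u] cocone_hom[OF t D.dom.hom_Cod[OF u]]]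
        cocone_natural[OF t u] by simp
    then show "h (Comp C (t j) (Comp C (FArr D u) x)) = h (Comp C (t i) x)" by simp
  qed
  note s = cocone_of_hom_cone[OF this d(1)]
  have c: "small (hom C A c)" using small_hom[OF cocone_Obj[OF t]] .
  have tx: "Comp C (t i) x \<in> hom C A c" if "i \<in> Obj I" "x \<in> hom C A (FObj D i)" for i x
    using D.cod.Comp_hom[OF that(2) cocone_hom[OF t that(1)]] .
  have 1: "(hom C A c, restrict h (hom C A c), d) \<in> hom Set_cat (hom C A c) d"
    using d(1,2) c by (auto simp: Set_cat_hom)
  have 2: "(hom C A c, restrict h' (hom C A c), d) \<in> hom Set_cat (hom C A c) d"
    using d(1,3) c by (auto simp: Set_cat_hom)
  have 3: "Comp Set_cat (hom C A c, restrict h (hom C A c), d) (Ht i) = ?s i" if "i \<in> Obj I" for i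
    unfolding Set_comp_Ht[OF that] using tx[OF that] by (auto intro!: restrict_ext)
  have 4: "Comp Set_cat (hom C A c, restrict h' (hom C A c), d) (Ht i) = ?s i" if "i \<in> Obj I" for i
    unfolding Set_comp_Ht[OF that] using tx[OF that] eq[OF that] by (auto intro!: restrict_ext)
  have "(hom C A c, restrict h (hom C A c), d) = (hom C A c, restrict h' (hom C A c), d)"
  proof -
    have "\<exists>!m. m \<in> hom Set_cat (hom C A c) d \<and> (\<forall>i\<in>Obj I. Comp Set_cat m (Ht i) = ?s i)"
      using col s by (simp add: colimit_def)
    then show ?thesis using 1 2 3 4 by blast
  qed
  then have "restrict h (hom C A c) x = restrict h' (hom C A c) x" by simp
  then show ?thesis using x by simp
qed

lemma hom_colimitI:
  assumes ex: "\<And>d \<phi>. small d \<Longrightarrow> hom_cone I C D A d \<phi> \<Longrightarrow>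
      \<exists>h. \<forall>i\<in>Obj I. \<forall>x\<in>hom C A (FObj D i). h (Comp C (t i) x) = \<phi> i x"
    and onto: "\<And>y. y \<in> hom C A c \<Longrightarrow> \<exists>i\<in>Obj I. \<exists>x\<in>hom C A (FObj D i). Comp C (t i) x = y"
  shows "colimit I Set_cat H (hom C A c) Ht"
proof (rule colimitI)
  have c: "small (hom C A c)" using small_hom[OF cocone_Obj[OF t]] .
  show "cocone I Set_cat H (hom C A c) Ht"
  proof (rule coconeI)
    show "category I" by unfold_locales
    show "hom C A c \<in> Obj Set_cat" using c by simp
    show "Ht i \<in> hom Set_cat (FObj H i) (hom C A c)" if "i \<in> Obj I" for i
      using FArr_H_hom[OF cocone_hom[OF t that]] by simp
    fix i j u assume u: "u \<in> hom I i j"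
    have "Comp C (t j) (Comp C (FArr D u) x) = Comp C (t i) x" if x: "x \<in> hom C A (FObj D i)" for x
      using D.cod.Comp_assoc[OF x D.FArr_hom[OF u] cocone_hom[OF t D.dom.hom_Cod[OF u]]]
        cocone_natural[OF t u] by simp
    then show "Comp Set_cat (Ht j) (FArr H u) = Ht i"
      using FArr_H[OF cocone_hom[OF t D.dom.hom_Dom[OF u]]] FArr_H[OF cocone_hom[OF t D.dom.hom_Cod[OF u]]]
        FArr_H[OF D.FArr_hom[OF u]] D.cod.Comp_hom[OF _ D.FArr_hom[OF u]]
      by (auto simp: compose_def intro!: restrict_ext)
  qed
next
  fix d s assume s: "cocone I Set_cat H d s"
  note hc = hom_cone_of_cocone[OF s]
  obtain h where h: "\<forall>i\<in>Obj I. \<forall>x\<in>hom C A (FObj D i). h (Comp C (t i) x) = fst (snd (s i)) x"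
    using ex[OF hc(2,1)] by blast
  have hd: "h y \<in> d" if y: "y \<in> hom C A c" for y
  proof -
    obtain i x where ix: "i \<in> Obj I" "x \<in> hom C A (FObj D i)" "Comp C (t i) x = y"
      using onto[OF y] by blast
    have "h (Comp C (t i) x) = fst (snd (s i)) x"
      using h ix(1,2) by blast
    moreover have "fst (snd (s i)) x \<in> d"
      using ix(1,2) hc(1) unfolding hom_cone_def by blast
    ultimately show ?thesis using ix(3) by simp
  qed
  have "(hom C A c, restrict h (hom C A c), d) \<in> hom Set_cat (hom C A c) d"
    using hc(2) small_hom[OF cocone_Obj[OF t]] hd by (auto simp: Set_cat_hom)
  moreover have "Comp Set_cat (hom C A c, restrict h (hom C A c), d) (Ht i) = s i" if i: "i \<in> Obj I" for i
  proof -
    have "(\<lambda>x\<in>hom C A (FObj D i). restrict h (hom C A c) (Comp C (t i) x)) =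
        restrict (fst (snd (s i))) (hom C A (FObj D i))"
      by (rule restrict_ext) (use h i D.cod.Comp_hom[OF _ cocone_hom[OF t i]] in simp)
    then show ?thesis
      unfolding Set_comp_Ht[OF i] by (subst hc(3)[OF i]) simp
  qed
  ultimately show "\<exists>m\<in>hom Set_cat (hom C A c) d. \<forall>i\<in>Obj I. Comp Set_cat m (Ht i) = s i"
    by blast
next
  fix d m m' assume m: "m \<in> hom Set_cat (hom C A c) d" "m' \<in> hom Set_cat (hom C A c) d"
    and eq: "\<forall>i\<in>Obj I. Comp Set_cat m (Ht i) = Comp Set_cat m' (Ht i)"
  obtain h h' where h: "m = (hom C A c, h, d)" "h \<in> hom C A c \<rightarrow>\<^sub>E d"
    "m' = (hom C A c, h', d)" "h' \<in> hom C A c \<rightarrow>\<^sub>E d"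
    using m unfolding Set_cat_hom by blast
  have "h y = h' y" if y: "y \<in> hom C A c" for y
  proof -
    obtain i x where i: "i \<in> Obj I" and x: "x \<in> hom C A (FObj D i)" "Comp C (t i) x = y"
      using onto[OF y] by blast
    have "(\<lambda>x\<in>hom C A (FObj D i). h (Comp C (t i) x)) = (\<lambda>x\<in>hom C A (FObj D i). h' (Comp C (t i) x))"
      using bspec[OF eq i] unfolding h(1,3) Set_comp_Ht[OF i] by simp
    from fun_cong[OF this, of x] show ?thesis using x by simp
  qed
  then have "h = h'" using PiE_ext[OF h(2,4)] by blast
  then show "m = m'" using h by simp
qed

end

end

text \<open>
  Arrows from \<open>A\<close> to the colimit come from the diagram, and two arrows into the diagram are identified by
  the colimit only if they become equal at a later stage of the diagram: the familiar description of
  \<open>hom(A, colim D) = colim hom(A, D)\<close> for a filtered colimit.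
\<close>

definition factors_essentially_uniquely ::
    "('i, 'j) cat \<Rightarrow> ('o, 'a) cat \<Rightarrow> ('i, 'j, 'o, 'a) fctr \<Rightarrow> 'o \<Rightarrow> ('i \<Rightarrow> 'a) \<Rightarrow> 'o \<Rightarrow> bool" where
  "factors_essentially_uniquely I C D c t A \<longleftrightarrow>
     (\<forall>f\<in>hom C A c. \<exists>i\<in>Obj I. \<exists>g\<in>hom C A (FObj D i). Comp C (t i) g = f) \<and>
     (\<forall>i\<in>Obj I. \<forall>g\<in>hom C A (FObj D i). \<forall>g'\<in>hom C A (FObj D i). Comp C (t i) g = Comp C (t i) g' \<longrightarrow>
        (\<exists>j. \<exists>u\<in>hom I i j. Comp C (FArr D u) g = Comp C (FArr D u) g'))"

text \<open>
  Maps into a two-element set suffice. Surjectivity: the characteristic function of the set of arrows that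
  factor agrees with a constant on all of them. Injectivity: being identified with a given arrow \<open>g\<close> at
  some later stage is invariant under the transition maps, hence a function on the colimit.
\<close>

lemma (in hom_diagram) Set_colimit_imp_factors:
  fixes r :: "'k rel" and p q :: 'u
  assumes I: "filtered r I" "regular_cardinal r" and two: "p \<noteq> q" "small {p, q}"
    and t: "cocone I C D c t" and col: "colimit I Set_cat H (hom C A c) (\<lambda>i. FArr (hom_functor C A) (t i))"
  shows "factors_essentially_uniquely I C D c t A"
  unfolding factors_essentially_uniquely_def
proof (intro conjI ballI impI)
  fix f assume f: "f \<in> hom C A c"
  let ?im = "{Comp C (t i) g | i g. i \<in> Obj I \<and> g \<in> hom C A (FObj D i)}"
  \<comment> \<open>Both functions take the value \<open>p\<close> on arrows that factor, so uniqueness makes them agree on \<open>f\<close>.\<close>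
  have "(\<lambda>x. p) f = (\<lambda>x. if x \<in> ?im then p else q) f"
    by (rule hom_colimit_unique[OF t col two(2)]) (use f in auto)
  then show "\<exists>i\<in>Obj I. \<exists>g\<in>hom C A (FObj D i). Comp C (t i) g = f"
    using two(1) by (auto split: if_splits)
next
  fix i g g' assume i: "i \<in> Obj I" and g: "g \<in> hom C A (FObj D i)" and g': "g' \<in> hom C A (FObj D i)"
    and eq: "Comp C (t i) g = Comp C (t i) g'"
  have catI: "category I" by unfold_locales
  \<comment> \<open>The arrows that become equal to \<open>g\<close> at a later stage.\<close>
  define R where "R j x \<longleftrightarrow> (\<exists>k. \<exists>a\<in>hom I j k. \<exists>b\<in>hom I i k. Comp C (FArr D a) x = Comp C (FArr D b) g)" for j x
  have R_natural: "R j' (Comp C (FArr D w) x) \<longleftrightarrow> R j x"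
    if w: "w \<in> hom I j j'" and x: "x \<in> hom C A (FObj D j)" for j j' w x
  proof
    assume "R j' (Comp C (FArr D w) x)"
    then obtain k a b where ab: "a \<in> hom I j' k" "b \<in> hom I i k"
      "Comp C (FArr D a) (Comp C (FArr D w) x) = Comp C (FArr D b) g"
      unfolding R_def by blast
    then have "Comp C (FArr D (Comp I a w)) x = Comp C (FArr D b) g"
      using D.FArr_Comp[OF w ab(1)] D.cod.Comp_assoc[OF x D.FArr_hom[OF w] D.FArr_hom[OF ab(1)]] by simp
    then show "R j x"
      unfolding R_def using D.dom.Comp_hom[OF w ab(1)] ab(2) by blast
  next
    assume "R j x"
    then obtain k a b where ab: "a \<in> hom I j k" "b \<in> hom I i k"
      "Comp C (FArr D a) x = Comp C (FArr D b) g"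
      unfolding R_def by blast
    obtain l m n where l: "m \<in> hom I j' l" "n \<in> hom I k l" "Comp I m w = Comp I n a"
      using filtered_square[OF I catI w ab(1)] .
    have "Comp C (FArr D m) (Comp C (FArr D w) x) = Comp C (FArr D (Comp I m w)) x"
      using D.FArr_Comp[OF w l(1)] D.cod.Comp_assoc[OF x D.FArr_hom[OF w] D.FArr_hom[OF l(1)]] by simp
    also have "\<dots> = Comp C (FArr D n) (Comp C (FArr D a) x)"
      using l(3) D.FArr_Comp[OF ab(1) l(2)]
        D.cod.Comp_assoc[OF x D.FArr_hom[OF ab(1)] D.FArr_hom[OF l(2)]] by simp
    also have "\<dots> = Comp C (FArr D (Comp I n b)) g"
      using ab(3) D.FArr_Comp[OF ab(2) l(2)]
        D.cod.Comp_assoc[OF g D.FArr_hom[OF ab(2)] D.FArr_hom[OF l(2)]] by simp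
    finally show "R j' (Comp C (FArr D w) x)"
      unfolding R_def using l(1) D.dom.Comp_hom[OF ab(2) l(2)] by blast
  qed
  have "hom_cone I C D A {p, q} (\<lambda>j x. if R j x then p else q)"
    unfolding hom_cone_def by (auto simp: R_natural)
  from hom_colimit_factor[OF t col this two(2)]
  obtain h where h: "\<forall>j\<in>Obj I. \<forall>x\<in>hom C A (FObj D j). h (Comp C (t j) x) = (if R j x then p else q)"
    by blast
  have "R i g"
    unfolding R_def using D.dom.Ident_hom[OF i] by blast
  then have "R i g'"
    using h[rule_format, OF i g] h[rule_format, OF i g'] eq two(1) by (auto split: if_splits)
  then obtain k a b where ab: "a \<in> hom I i k" "b \<in> hom I i k"
      "Comp C (FArr D a) g' = Comp C (FArr D b) g"
      unfolding R_def by blast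
  obtain l n where n: "n \<in> hom I k l" "Comp I n a = Comp I n b"
    using filtered_parallel[OF I catI ab(1,2)] .
  have "Comp C (FArr D (Comp I n a)) g' = Comp C (FArr D n) (Comp C (FArr D a) g')"
    using D.FArr_Comp[OF ab(1) n(1)] D.cod.Comp_assoc[OF g' D.FArr_hom[OF ab(1)] D.FArr_hom[OF n(1)]] by simp
  also have "\<dots> = Comp C (FArr D (Comp I n b)) g"
    using ab(3) D.FArr_Comp[OF ab(2) n(1)] D.cod.Comp_assoc[OF g D.FArr_hom[OF ab(2)] D.FArr_hom[OF n(1)]] by simp
  finally have "Comp C (FArr D (Comp I n a)) g = Comp C (FArr D (Comp I n a)) g'"
    using n(2) by simp
  then show "\<exists>j. \<exists>u\<in>hom I i j. Comp C (FArr D u) g = Comp C (FArr D u) g'"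
    using D.dom.Comp_hom[OF ab(1) n(1)] by blast
qed

text \<open>
  The induced map sends \<open>t_i \<circ> x\<close> to \<open>\<phi>_i(x)\<close>; that this does not depend on the chosen factorization
  is the uniqueness part of the hypothesis together with filteredness.
\<close>

lemma (in hom_diagram) factors_imp_Set_colimit:
  fixes r :: "'k rel"
  assumes I: "filtered r I" "regular_cardinal r"
    and t: "cocone I C D c t" and fac: "factors_essentially_uniquely I C D c t A"
  shows "colimit I Set_cat H (hom C A c) (\<lambda>i. FArr (hom_functor C A) (t i))"
proof (rule hom_colimitI[OF t])
  show "\<exists>i\<in>Obj I. \<exists>x\<in>hom C A (FObj D i). Comp C (t i) x = y" if "y \<in> hom C A c" for y
    using fac that unfolding factors_essentially_uniquely_def by simp
next
  fix d \<phi> assume \<phi>: "hom_cone I C D A d \<phi>"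
  have nat: "\<phi> j (Comp C (FArr D u) x) = \<phi> i x" if "u \<in> hom I i j" "x \<in> hom C A (FObj D i)" for i j u x
    using \<phi> that unfolding hom_cone_def by simp
  have catI: "category I" by unfold_locales
  \<comment> \<open>Two factorizations of the same arrow meet in the diagram.\<close>
  have wd: "\<phi> i x = \<phi> j y" if i: "i \<in> Obj I" and j: "j \<in> Obj I"
    and x: "x \<in> hom C A (FObj D i)" and y: "y \<in> hom C A (FObj D j)"
    and eq: "Comp C (t i) x = Comp C (t j) y" for i j x y
  proof -
    obtain k a b where ab: "a \<in> hom I i k" "b \<in> hom I j k"
      using filtered_pair[OF I i j] .
    have x': "Comp C (FArr D a) x \<in> hom C A (FObj D k)" using D.cod.Comp_hom[OF x D.FArr_hom[OF ab(1)]] .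
    have y': "Comp C (FArr D b) y \<in> hom C A (FObj D k)" using D.cod.Comp_hom[OF y D.FArr_hom[OF ab(2)]] .
    have k: "k \<in> Obj I" using D.dom.hom_Cod[OF ab(1)] .
    have "Comp C (t k) (Comp C (FArr D a) x) = Comp C (t k) (Comp C (FArr D b) y)"
      using D.cod.Comp_assoc[OF x D.FArr_hom[OF ab(1)] cocone_hom[OF t k]] cocone_natural[OF t ab(1)]
        D.cod.Comp_assoc[OF y D.FArr_hom[OF ab(2)] cocone_hom[OF t k]] cocone_natural[OF t ab(2)] eq
      by simp
    then obtain l u where u: "u \<in> hom I k l"
      "Comp C (FArr D u) (Comp C (FArr D a) x) = Comp C (FArr D u) (Comp C (FArr D b) y)"
      using fac x' y' k unfolding factors_essentially_uniquely_def by meson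
    have "\<phi> i x = \<phi> l (Comp C (FArr D u) (Comp C (FArr D a) x))"
      using nat[OF ab(1) x] nat[OF u(1) x'] by simp
    also have "\<dots> = \<phi> j y"
      using nat[OF ab(2) y] nat[OF u(1) y'] u(2) by simp
    finally show ?thesis .
  qed
  \<comment> \<open>\<open>z\<close> is the value that some factorization of \<open>y\<close> prescribes; it is unique by the preceding step.\<close>
  define P where "P z y \<longleftrightarrow> (\<exists>i\<in>Obj I. \<exists>x\<in>hom C A (FObj D i). Comp C (t i) x = y \<and> z = \<phi> i x)" for z y
  have "(SOME z. P z (Comp C (t i) x)) = \<phi> i x" if "i \<in> Obj I" "x \<in> hom C A (FObj D i)" for i x
  proof (rule some_equality)
    show "P (\<phi> i x) (Comp C (t i) x)" unfolding P_def using that by blast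
    show "z = \<phi> i x" if "P z (Comp C (t i) x)" for z
      using that wd \<open>i \<in> Obj I\<close> \<open>x \<in> hom C A (FObj D i)\<close> unfolding P_def by metis
  qed
  then show "\<exists>h. \<forall>i\<in>Obj I. \<forall>x\<in>hom C A (FObj D i). h (Comp C (t i) x) = \<phi> i x"
    by (intro exI[of _ "\<lambda>y. SOME z. P z y"]) simp
qed

lemma (in universe) presentable_iff:
  fixes C :: "('u, 'u) cat" and r :: "'u rel"
  assumes C: "category C" "locally_small C" and r: "regular_cardinal r"
  shows "presentable r C A \<longleftrightarrow> A \<in> Obj C \<and>
    (\<forall>(I :: ('u, 'u) cat) D c t. small_category I \<and> filtered r I \<and> cat_functor I C D \<and> colimit I C D c t \<longrightarrow>
       factors_essentially_uniquely I C D c t A)"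
proof -
  obtain p q :: 'u where pq: "p \<noteq> q"
    using infinite_univ by (metis (full_types) UNIV_eq_I finite.emptyI finite_insert insertI1)
  have two: "small {p, q}" by (rule small_finite) simp
  have "colimit I Set_cat (fctr_comp (hom_functor C A) D) (FObj (hom_functor C A) c) (\<lambda>i. FArr (hom_functor C A) (t i))
      \<longleftrightarrow> factors_essentially_uniquely I C D c t A"
    if A: "A \<in> Obj C" and I: "small_category I \<and> filtered r I \<and> cat_functor I C D \<and> colimit I C D c t"
    for I :: "('u, 'u) cat" and D c t
  proof -
    interpret D: cat_functor I C D using I by blast
    interpret hom_diagram I C D A
      using A C by unfold_locales
    have t: "cocone I C D c t" using I by (intro colimit_cocone) simp
    show ?thesis
      using Set_colimit_imp_factors[of r, OF _ r pq two t] factors_imp_Set_colimit[of r, OF _ r t] I by auto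
  qed
  then show ?thesis
    unfolding presentable_def preserves_filtered_colimits_def by meson
qed

section \<open>Small colimits and retracts of presentable objects\<close>

lemma preserves_filtered_colimitsD:
  fixes I :: "('u, 'u) cat" and r :: "'u rel"
  shows "preserves_filtered_colimits r C E F \<Longrightarrow> small_category I \<Longrightarrow> filtered r I \<Longrightarrow>
    cat_functor I C D \<Longrightarrow> colimit I C D c t \<Longrightarrow>
    colimit I E (fctr_comp F D) (FObj F c) (\<lambda>i. FArr F (t i))"
  by (simp add: preserves_filtered_colimits_def)

lemma preserves_filtered_colimits_mono:
  fixes r s :: "'u rel"
  assumes "preserves_filtered_colimits r C E F" "r \<le>o s"
  shows "preserves_filtered_colimits s C E F"
  unfolding preserves_filtered_colimits_def
proof (intro allI impI; elim conjE)
  fix I :: "('u, 'u) cat" and D c t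
  assume I: "small_category I" and s: "filtered s I" and D: "cat_functor I C D" and t: "colimit I C D c t"
  show "colimit I E (fctr_comp F D) (FObj F c) (\<lambda>i. FArr F (t i))"
    by (rule preserves_filtered_colimitsD[OF assms(1) I filtered_mono[OF s assms(2)] D t])
qed

lemma presentable_mono: "presentable r C A \<Longrightarrow> r \<le>o s \<Longrightarrow> presentable s C A"
  unfolding presentable_def by (elim conjE, intro conjI) (assumption, rule preserves_filtered_colimits_mono)

locale locally_small_category = universe universe_type + category C
  for universe_type :: "'u itself" and C :: "('u, 'u) cat" +
  assumes locally_small: "locally_small C"
begin

lemma presentable_Obj: "presentable r C A \<Longrightarrow> A \<in> Obj C"
  by (simp add: presentable_def)

lemma presentable_factors:
  fixes I :: "('u, 'u) cat"
  assumes "regular_cardinal r" "presentable r C A"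
    and "small_category I" "filtered r I" "cat_functor I C D" "colimit I C D c t"
  shows "factors_essentially_uniquely I C D c t A"
  using assms presentable_iff[OF category_axioms locally_small assms(1), of A] by blast

lemma presentable_factor:
  fixes I :: "('u, 'u) cat"
  assumes "regular_cardinal r" "presentable r C A"
    and "small_category I" "filtered r I" "cat_functor I C D" "colimit I C D c t"
    and "f \<in> hom C A c"
  obtains i g where "i \<in> Obj I" "g \<in> hom C A (FObj D i)" "Comp C (t i) g = f"
  using presentable_factors[OF assms(1-6)] assms(7) unfolding factors_essentially_uniquely_def by blast

lemma presentable_equal:
  fixes I :: "('u, 'u) cat"
  assumes "regular_cardinal r" "presentable r C A"
    and "small_category I" "filtered r I" "cat_functor I C D" "colimit I C D c t"
    and "i \<in> Obj I" "g \<in> hom C A (FObj D i)" "g' \<in> hom C A (FObj D i)" "Comp C (t i) g = Comp C (t i) g'"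
  obtains j u where "u \<in> hom I i j" "Comp C (FArr D u) g = Comp C (FArr D u) g'"
  using presentable_factors[OF assms(1-6)] assms(7-10) unfolding factors_essentially_uniquely_def by blast

lemma presentable_retract:
  assumes r: "regular_cardinal r" and A: "presentable r C A"
    and s: "s \<in> hom C B A" and e: "e \<in> hom C A B" and es: "Comp C e s = Ident C B"
  shows "presentable r C B"
  unfolding presentable_iff[OF category_axioms locally_small r] factors_essentially_uniquely_def
proof (intro conjI allI impI; (elim conjE)?)
  show "B \<in> Obj C" using hom_Dom[OF s] .
  fix I :: "('u, 'u) cat" and D c t
  assume I: "small_category I" "filtered r I" "cat_functor I C D" and t: "colimit I C D c t"
  note fac = presentable_factor[OF r A I t] and eq = presentable_equal[OF r A I t]
  have cancel: "Comp C (Comp C f e) s = f" if "f \<in> hom C B X" for f X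
    using Comp_assoc[OF s e that] es Comp_Ident[OF that] by simp
  show "\<forall>f\<in>hom C B c. \<exists>i\<in>Obj I. \<exists>g\<in>hom C B (FObj D i). Comp C (t i) g = f"
  proof
    fix f assume f: "f \<in> hom C B c"
    obtain i g where g: "i \<in> Obj I" "g \<in> hom C A (FObj D i)" "Comp C (t i) g = Comp C f e"
      by (rule fac[OF Comp_hom[OF e f]])
    have "Comp C (t i) (Comp C g s) = f"
      using Comp_assoc[OF s g(2) colimit_hom[OF t g(1)]] g(3) cancel[OF f] by simp
    then show "\<exists>i\<in>Obj I. \<exists>g\<in>hom C B (FObj D i). Comp C (t i) g = f"
      using g(1) Comp_hom[OF s g(2)] by blast
  qed
  show "\<forall>i\<in>Obj I. \<forall>g\<in>hom C B (FObj D i). \<forall>g'\<in>hom C B (FObj D i).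
      Comp C (t i) g = Comp C (t i) g' \<longrightarrow> (\<exists>j. \<exists>u\<in>hom I i j. Comp C (FArr D u) g = Comp C (FArr D u) g')"
  proof (intro ballI impI)
    fix i g g' assume i: "i \<in> Obj I" and g: "g \<in> hom C B (FObj D i)" and g': "g' \<in> hom C B (FObj D i)"
      and tg: "Comp C (t i) g = Comp C (t i) g'"
    interpret D: cat_functor I C D by fact
    have "Comp C (t i) (Comp C g e) = Comp C (t i) (Comp C g' e)"
      using Comp_assoc[OF e g colimit_hom[OF t i]] Comp_assoc[OF e g' colimit_hom[OF t i]] tg by simp
    then obtain j u where u: "u \<in> hom I i j"
      and Du: "Comp C (FArr D u) (Comp C g e) = Comp C (FArr D u) (Comp C g' e)"
      by (rule eq[OF i Comp_hom[OF e g] Comp_hom[OF e g']])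
    have "Comp C (Comp C (FArr D u) g) e = Comp C (Comp C (FArr D u) g') e"
      using Comp_assoc[OF e g D.FArr_hom[OF u]] Comp_assoc[OF e g' D.FArr_hom[OF u]] Du by simp
    then have "Comp C (FArr D u) g = Comp C (FArr D u) g'"
      using cancel[OF Comp_hom[OF g D.FArr_hom[OF u]]] cancel[OF Comp_hom[OF g' D.FArr_hom[OF u]]] by metis
    then show "\<exists>j. \<exists>u\<in>hom I i j. Comp C (FArr D u) g = Comp C (FArr D u) g'"
      using u by blast
  qed
qed

text \<open>
  Factorizations of the components of an arrow out of the colimit can be moved to a common stage and made
  compatible there, since there are fewer than \<open>r\<close> objects and fewer than \<open>r\<close> arrows to take care of.
\<close>

lemma presentable_small_colimit:
  fixes J :: "('u, 'u) cat"
  assumes r: "regular_cardinal r" and D: "cat_functor J C D" and J: "|Arr J| <o r"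
    and pres: "\<And>j. j \<in> Obj J \<Longrightarrow> presentable r C (FObj D j)" and t: "colimit J C D c t"
  shows "presentable r C c"
  unfolding presentable_iff[OF category_axioms locally_small r] factors_essentially_uniquely_def
proof (intro conjI allI impI; (elim conjE)?)
  interpret D: cat_functor J C D by fact
  show "c \<in> Obj C" using colimit_Obj[OF t] .
  have "Obj J \<subseteq> Dom J ` Arr J"
  proof
    fix j assume "j \<in> Obj J"
    then have "Ident J j \<in> Arr J \<and> Dom J (Ident J j) = j \<and> Cod J (Ident J j) = j"
      by (intro hom_simps D.dom.Ident_hom)
    then show "j \<in> Dom J ` Arr J" by force
  qed
  then have JO: "|Obj J| <o r"
    by (rule ordLeq_ordLess_trans[OF card_of_mono1 card_image_less[OF J]])
  fix M :: "('u, 'u) cat" and E e s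
  assume M: "small_category M" "filtered r M" "cat_functor M C E" and s: "colimit M C E e s"
  interpret E: cat_functor M C E by fact
  have catM: "category M" by unfold_locales
  have through: "Comp C (s k) (Comp C (FArr E u) f) = Comp C (s m) f"
    if u: "u \<in> hom M m k" and f: "f \<in> hom C X (FObj E m)" for m k u f X
    using Comp_assoc[OF f E.FArr_hom[OF u] colimit_hom[OF s E.dom.hom_Cod[OF u]]] colimit_natural[OF s u]
    by simp
  have Ecomp: "Comp C (FArr E (Comp M v u)) f = Comp C (FArr E v) (Comp C (FArr E u) f)"
    if u: "u \<in> hom M m k" and v: "v \<in> hom M k l" and f: "f \<in> hom C X (FObj E m)" for m k l u v f X
    using E.FArr_Comp[OF u v] Comp_assoc[OF f E.FArr_hom[OF u] E.FArr_hom[OF v]] by simp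
  note fac = presentable_factor[OF r pres M s] and eq = presentable_equal[OF r pres M s]
  show "\<forall>f\<in>hom C c e. \<exists>i\<in>Obj M. \<exists>g\<in>hom C c (FObj E i). Comp C (s i) g = f"
  proof
    fix f assume f: "f \<in> hom C c e"
    have ft: "Comp C f (t j) \<in> hom C (FObj D j) e" if "j \<in> Obj J" for j
      using Comp_hom[OF colimit_hom[OF t that] f] .
    have "\<exists>m g. m \<in> Obj M \<and> g \<in> hom C (FObj D j) (FObj E m) \<and> Comp C (s m) g = Comp C f (t j)"
      if "j \<in> Obj J" for j
      by (rule fac[OF that ft[OF that]]) blast
    then obtain m g where g: "\<And>j. j \<in> Obj J \<Longrightarrow> m j \<in> Obj M"
      "\<And>j. j \<in> Obj J \<Longrightarrow> g j \<in> hom C (FObj D j) (FObj E (m j))"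
      "\<And>j. j \<in> Obj J \<Longrightarrow> Comp C (s (m j)) (g j) = Comp C f (t j)"
      by metis
    have "\<exists>b\<in>Obj M. \<forall>x\<in>m ` Obj J. hom M x b \<noteq> {}"
      by (rule filteredD_bound[OF M(2) _ card_image_less[OF JO]]) (use g(1) in auto)
    then obtain b where b: "b \<in> Obj M" "\<forall>j\<in>Obj J. \<exists>a. a \<in> hom M (m j) b"
      by (auto simp flip: ex_in_conv)
    then obtain a where a: "\<And>j. j \<in> Obj J \<Longrightarrow> a j \<in> hom M (m j) b" by metis
    \<comment> \<open>The factorizations, moved to the common stage \<open>b\<close>.\<close>
    define h where "h j = Comp C (FArr E (a j)) (g j)" for j
    have h: "h j \<in> hom C (FObj D j) (FObj E b)" if "j \<in> Obj J" for j
      unfolding h_def using Comp_hom[OF g(2)[OF that] E.FArr_hom[OF a[OF that]]] .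
    have sh: "Comp C (s b) (h j) = Comp C f (t j)" if "j \<in> Obj J" for j
      unfolding h_def using through[OF a[OF that] g(2)[OF that]] g(3)[OF that] by simp
    \<comment> \<open>Compatibility with the arrow \<open>u\<close> of \<open>J\<close>, after the step \<open>w\<close> from \<open>b\<close>.\<close>
    define Q where "Q u w \<longleftrightarrow>
      Comp C (FArr E w) (Comp C (h (Cod J u)) (FArr D u)) = Comp C (FArr E w) (h (Dom J u))" for u w
    have hu: "Comp C (h (Cod J u)) (FArr D u) \<in> hom C (FObj D (Dom J u)) (FObj E b)" if "u \<in> Arr J" for u
      using Comp_hom[OF D.FArr_hom[OF D.dom.hom_Arr[OF that]] h[OF D.dom.Cod_Obj[OF that]]] .
    have ex: "\<exists>k. \<exists>w\<in>hom M b k. Q u w" if u: "u \<in> Arr J" for u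
    proof -
      note u' = D.dom.hom_Arr[OF u]
      have "Comp C (s b) (Comp C (h (Cod J u)) (FArr D u)) = Comp C (s b) (h (Dom J u))"
        using Comp_assoc[OF D.FArr_hom[OF u'] h[OF D.dom.Cod_Obj[OF u]] colimit_hom[OF s b(1)]]
          sh[OF D.dom.Cod_Obj[OF u]] sh[OF D.dom.Dom_Obj[OF u]] colimit_natural[OF t u']
          Comp_assoc[OF D.FArr_hom[OF u'] colimit_hom[OF t D.dom.Cod_Obj[OF u]] f] by simp
      then show ?thesis
        unfolding Q_def
        by (rule eq[OF D.dom.Dom_Obj[OF u] b(1) hu[OF u] h[OF D.dom.Dom_Obj[OF u]]]) blast
    qed
    have up: "Q u (Comp M v w)" if "u \<in> Arr J" "w \<in> hom M b k" "v \<in> hom M k l" "Q u w" for u k l w v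
      using that(4) Ecomp[OF that(2,3) hu[OF that(1)]] Ecomp[OF that(2,3) h[OF D.dom.Dom_Obj[OF that(1)]]]
      unfolding Q_def by simp
    have "\<exists>k. \<exists>w\<in>hom M b k. \<forall>u\<in>Arr J. Q u w"
      by (rule filtered_simultaneously[OF M(2) r catM b(1) J]) (fact ex, fact up)
    then obtain k w where w: "w \<in> hom M b k" and Qw: "\<forall>u\<in>Arr J. Q u w" by blast
    have "cocone J C D (FObj E k) (\<lambda>j. Comp C (FArr E w) (h j))"
    proof (rule coconeI)
      show "category J" by unfold_locales
      show "FObj E k \<in> Obj C" using E.FObj_Obj[OF E.dom.hom_Cod[OF w]] .
      show "Comp C (FArr E w) (h j) \<in> hom C (FObj D j) (FObj E k)" if "j \<in> Obj J" for j
        using Comp_hom[OF h[OF that] E.FArr_hom[OF w]] .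
      fix i j u assume u: "u \<in> hom J i j"
      then have u': "u \<in> Arr J" "Dom J u = i" "Cod J u = j" by (simp_all add: hom_def)
      show "Comp C (Comp C (FArr E w) (h j)) (FArr D u) = Comp C (FArr E w) (h i)"
        using bspec[OF Qw u'(1)] Comp_assoc[OF D.FArr_hom[OF u] h[OF D.dom.hom_Cod[OF u]] E.FArr_hom[OF w]] u'
        unfolding Q_def by simp
    qed
    then obtain g' where g': "g' \<in> hom C c (FObj E k)"
      "\<And>j. j \<in> Obj J \<Longrightarrow> Comp C g' (t j) = Comp C (FArr E w) (h j)"
      using colimit_factor[OF t] by metis
    have k: "k \<in> Obj M" using E.dom.hom_Cod[OF w] .
    have "Comp C (s k) g' = f"
    proof (rule colimit_eqI[OF D t Comp_hom[OF g'(1) colimit_hom[OF s k]] f])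
      fix j assume j: "j \<in> Obj J"
      show "Comp C (Comp C (s k) g') (t j) = Comp C f (t j)"
        using Comp_assoc[OF colimit_hom[OF t j] g'(1) colimit_hom[OF s k]] g'(2)[OF j]
          through[OF w h[OF j]] sh[OF j] by simp
    qed
    then show "\<exists>i\<in>Obj M. \<exists>g\<in>hom C c (FObj E i). Comp C (s i) g = f"
      using k g'(1) by blast
  qed
  show "\<forall>i\<in>Obj M. \<forall>g\<in>hom C c (FObj E i). \<forall>g'\<in>hom C c (FObj E i).
      Comp C (s i) g = Comp C (s i) g' \<longrightarrow> (\<exists>j. \<exists>u\<in>hom M i j. Comp C (FArr E u) g = Comp C (FArr E u) g')"
  proof (intro ballI impI)
    fix m g g' assume m: "m \<in> Obj M" and g: "g \<in> hom C c (FObj E m)" and g': "g' \<in> hom C c (FObj E m)"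
      and sg: "Comp C (s m) g = Comp C (s m) g'"
    define Q where "Q j w \<longleftrightarrow>
      Comp C (FArr E w) (Comp C g (t j)) = Comp C (FArr E w) (Comp C g' (t j))" for j w
    have gt: "Comp C g (t j) \<in> hom C (FObj D j) (FObj E m)" "Comp C g' (t j) \<in> hom C (FObj D j) (FObj E m)"
      if "j \<in> Obj J" for j
      using Comp_hom[OF colimit_hom[OF t that] g] Comp_hom[OF colimit_hom[OF t that] g'] by auto
    have ex: "\<exists>k. \<exists>w\<in>hom M m k. Q j w" if j: "j \<in> Obj J" for j
    proof -
      have "Comp C (s m) (Comp C g (t j)) = Comp C (s m) (Comp C g' (t j))"
        using Comp_assoc[OF colimit_hom[OF t j] g colimit_hom[OF s m]]
          Comp_assoc[OF colimit_hom[OF t j] g' colimit_hom[OF s m]] sg by simp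
      then show ?thesis
        unfolding Q_def by (rule eq[OF j m gt[OF j]]) blast
    qed
    have up: "Q j (Comp M v w)" if "j \<in> Obj J" "w \<in> hom M m k" "v \<in> hom M k l" "Q j w" for j k l w v
      using that(4) Ecomp[OF that(2,3) gt(1)[OF that(1)]] Ecomp[OF that(2,3) gt(2)[OF that(1)]]
      unfolding Q_def by simp
    have "\<exists>k. \<exists>w\<in>hom M m k. \<forall>j\<in>Obj J. Q j w"
      by (rule filtered_simultaneously[OF M(2) r catM m JO]) (fact ex, fact up)
    then obtain k w where w: "w \<in> hom M m k" and Qw: "\<forall>j\<in>Obj J. Q j w" by blast
    note Ew = E.FArr_hom[OF w]
    have "Comp C (FArr E w) g = Comp C (FArr E w) g'"
    proof (rule colimit_eqI[OF D t Comp_hom[OF g Ew] Comp_hom[OF g' Ew]])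
      fix j assume j: "j \<in> Obj J"
      show "Comp C (Comp C (FArr E w) g) (t j) = Comp C (Comp C (FArr E w) g') (t j)"
        using Comp_assoc[OF colimit_hom[OF t j] g Ew] Comp_assoc[OF colimit_hom[OF t j] g' Ew] bspec[OF Qw j]
        unfolding Q_def by simp
    qed
    then show "\<exists>j. \<exists>u\<in>hom M m j. Comp C (FArr E u) g = Comp C (FArr E u) g'"
      using w by blast
  qed
qed

lemma presentable_is_retract:
  fixes I :: "('u, 'u) cat"
  assumes r: "regular_cardinal r" and X: "presentable r C X"
    and I: "small_category I" "filtered r I" "cat_functor I C D" and t: "colimit I C D X t"
  obtains i s where "i \<in> Obj I" "s \<in> hom C X (FObj D i)" "Comp C (t i) s = Ident C X"
  by (rule presentable_factor[OF r X I t Ident_hom[OF presentable_Obj[OF X]]])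

end

section \<open>Subcategories and preorders as index categories\<close>

text \<open>
  A subcategory is given by its arrows alone; its objects are those whose identity belongs to it.
\<close>

definition subcategory :: "('o, 'a) cat \<Rightarrow> 'a set \<Rightarrow> bool" where
  "subcategory I T \<longleftrightarrow> T \<subseteq> Arr I \<and> (\<forall>u\<in>T. Ident I (Dom I u) \<in> T \<and> Ident I (Cod I u) \<in> T) \<and>
     (\<forall>u\<in>T. \<forall>v\<in>T. Cod I u = Dom I v \<longrightarrow> Comp I v u \<in> T)"

definition subcat :: "('o, 'a) cat \<Rightarrow> 'a set \<Rightarrow> ('o, 'a) cat" where
  "subcat I T = \<lparr> Obj = {a \<in> Obj I. Ident I a \<in> T}, Arr = T, Dom = Dom I, Cod = Cod I,
     Ident = Ident I, Comp = Comp I \<rparr>"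

lemma subcat_simps [simp]:
  "Obj (subcat I T) = {a \<in> Obj I. Ident I a \<in> T}" "Arr (subcat I T) = T" "Dom (subcat I T) = Dom I"
  "Cod (subcat I T) = Cod I" "Ident (subcat I T) = Ident I" "Comp (subcat I T) = Comp I"
  by (simp_all add: subcat_def)

lemma hom_subcat: "T \<subseteq> Arr I \<Longrightarrow> f \<in> hom (subcat I T) a b \<longleftrightarrow> f \<in> hom I a b \<and> f \<in> T"
  by (auto simp: hom_def)

lemma category_subcat:
  assumes "category I" "subcategory I T"
  shows "category (subcat I T)"
proof -
  interpret category I by fact
  have T: "T \<subseteq> Arr I" "\<And>u. u \<in> T \<Longrightarrow> Ident I (Dom I u) \<in> T \<and> Ident I (Cod I u) \<in> T"
    "\<And>u v. u \<in> T \<Longrightarrow> v \<in> T \<Longrightarrow> Cod I u = Dom I v \<Longrightarrow> Comp I v u \<in> T"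
    using assms(2) by (auto simp: subcategory_def)
  note h = hom_subcat[OF T(1)]
  show ?thesis
  proof
    fix f assume "f \<in> Arr (subcat I T)"
    then show "Dom (subcat I T) f \<in> Obj (subcat I T)" "Cod (subcat I T) f \<in> Obj (subcat I T)"
      using T Dom_Obj Cod_Obj by auto
  next
    fix A assume "A \<in> Obj (subcat I T)"
    then show "Ident (subcat I T) A \<in> hom (subcat I T) A A"
      using Ident_hom by (auto simp: h)
  next
    fix f A B assume "f \<in> hom (subcat I T) A B"
    then have f: "f \<in> hom I A B" by (simp add: h)
    show "Comp (subcat I T) f (Ident (subcat I T) A) = f" using Comp_Ident[OF f] by simp
    show "Comp (subcat I T) (Ident (subcat I T) B) f = f" using Ident_Comp[OF f] by simp
  next
    fix f A B g E assume "f \<in> hom (subcat I T) A B" "g \<in> hom (subcat I T) B E"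
    then have fg: "f \<in> hom I A B" "g \<in> hom I B E" "f \<in> T" "g \<in> T" by (simp_all add: h)
    then have "Comp I g f \<in> T" by (intro T(3)) (simp_all add: hom_def)
    then show "Comp (subcat I T) g f \<in> hom (subcat I T) A E"
      using Comp_hom[OF fg(1,2)] by (simp add: h)
    fix k H assume "k \<in> hom (subcat I T) E H"
    then have "k \<in> hom I E H" by (simp add: h)
    then show "Comp (subcat I T) k (Comp (subcat I T) g f) = Comp (subcat I T) (Comp (subcat I T) k g) f"
      using Comp_assoc[OF fg(1,2)] by simp
  qed
qed

lemma cat_functor_subcat:
  assumes "cat_functor I C D" "subcategory I T"
  shows "cat_functor (subcat I T) C D"
proof -
  interpret D: cat_functor I C D by fact
  have T: "T \<subseteq> Arr I" using assms(2) by (simp add: subcategory_def)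
  interpret S: category "subcat I T"
    using category_subcat[OF _ assms(2)] D.dom.category_axioms by blast
  show ?thesis
    by unfold_locales
      (auto simp: hom_subcat[OF T] D.FObj_Obj D.FArr_hom D.FArr_Ident intro: D.FArr_Comp)
qed

lemma (in universe) small_category_subcat:
  fixes I :: "('u, 'u) cat"
  assumes "small_category I" "subcategory I T"
  shows "small_category (subcat I T)"
  using assms category_subcat small_subset[of "Obj I"] small_subset[of "Arr I" T]
  by (auto simp: small_category_def subcategory_def)

definition preorder_cat :: "'u set \<Rightarrow> ('u \<Rightarrow> 'u \<Rightarrow> bool) \<Rightarrow> ('u, 'u) cat" where
  "preorder_cat Q le = \<lparr>
     Obj = Q,
     Arr = {vpair (p, q) | p q. p \<in> Q \<and> q \<in> Q \<and> le p q},
     Dom = vfst,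
     Cod = vsnd,
     Ident = (\<lambda>p. vpair (p, p)),
     Comp = (\<lambda>n m. vpair (vfst m, vsnd n)) \<rparr>"

definition preorder_fctr :: "('u \<Rightarrow> 'o) \<Rightarrow> ('u \<Rightarrow> 'u \<Rightarrow> 'a) \<Rightarrow> ('u, 'u, 'o, 'a) fctr" where
  "preorder_fctr X tr = \<lparr> FObj = X, FArr = (\<lambda>m. tr (vfst m) (vsnd m)) \<rparr>"

lemma preorder_simps [simp]:
  "Obj (preorder_cat Q le) = Q"
  "Dom (preorder_cat Q le) m = vfst m" "Cod (preorder_cat Q le) m = vsnd m"
  "Ident (preorder_cat Q le) p = vpair (p, p)" "Comp (preorder_cat Q le) n m = vpair (vfst m, vsnd n)"
  "FObj (preorder_fctr X tr) = X" "FArr (preorder_fctr X tr) m = tr (vfst m) (vsnd m)"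
  by (simp_all add: preorder_cat_def preorder_fctr_def)

context universe
begin

lemma hom_preorder_cat:
  "m \<in> hom (preorder_cat Q le) p q \<longleftrightarrow> m = (vpair (p, q) :: 'u) \<and> p \<in> Q \<and> q \<in> Q \<and> le p q"
  by (auto simp: hom_def preorder_cat_def)

lemma category_preorder_cat:
  fixes Q :: "'u set"
  assumes "\<And>p. p \<in> Q \<Longrightarrow> le p p"
    and "\<And>p q s. p \<in> Q \<Longrightarrow> q \<in> Q \<Longrightarrow> s \<in> Q \<Longrightarrow> le p q \<Longrightarrow> le q s \<Longrightarrow> le p s"
  shows "category (preorder_cat Q le)"
proof
  fix f assume "f \<in> Arr (preorder_cat Q le)"
  then show "Dom (preorder_cat Q le) f \<in> Obj (preorder_cat Q le)"
    "Cod (preorder_cat Q le) f \<in> Obj (preorder_cat Q le)"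
    by (auto simp: preorder_cat_def)
next
  fix f A B g E assume "f \<in> hom (preorder_cat Q le) A B" "g \<in> hom (preorder_cat Q le) B E"
  then show "Comp (preorder_cat Q le) g f \<in> hom (preorder_cat Q le) A E"
    using assms(2)[of A B E] by (simp add: hom_preorder_cat)
qed (auto simp: hom_preorder_cat assms(1))

lemma small_preorder_cat:
  fixes Q :: "'u set"
  assumes "category (preorder_cat Q le)" "small Q"
  shows "small_category (preorder_cat Q le)"
proof -
  have "Arr (preorder_cat Q le) \<subseteq> vpair ` (Q \<times> Q)"
    by (auto simp: preorder_cat_def)
  then have "small (Arr (preorder_cat Q le))"
    using small_Times_image[OF assms(2,2)] small_subset by blast
  then show ?thesis using assms by (simp add: small_category_def)
qed

lemma filtered_preorder_cat:
  fixes Q :: "'u set" and s :: "'u rel"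
  assumes cat: "category (preorder_cat Q le)"
    and dir: "\<And>S. S \<subseteq> Q \<Longrightarrow> |S| <o s \<Longrightarrow> \<exists>q\<in>Q. \<forall>p\<in>S. le p q"
  shows "filtered s (preorder_cat Q le)"
  unfolding filtered_def
proof (intro conjI ballI allI impI)
  fix S assume "S \<subseteq> Obj (preorder_cat Q le) \<and> |S| <o s"
  then have S: "S \<subseteq> Q" "|S| <o s" by auto
  obtain q where q: "q \<in> Q" "\<forall>p\<in>S. le p q" using dir[OF S] by blast
  have "vpair (p, q) \<in> hom (preorder_cat Q le) p q" if "p \<in> S" for p
    using that S(1) q by (auto simp: hom_preorder_cat)
  then show "\<exists>c\<in>Obj (preorder_cat Q le). \<forall>p\<in>S. hom (preorder_cat Q le) p c \<noteq> {}"
    using q(1) by (intro bexI[of _ q]) auto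
next
  fix a b S assume b: "b \<in> Obj (preorder_cat Q le)" and S: "S \<subseteq> hom (preorder_cat Q le) a b \<and> |S| <o s"
  have "f = vpair (a, b)" if "f \<in> S" for f
    using S that by (auto simp: hom_preorder_cat)
  then have eq: "\<forall>f\<in>S. \<forall>g\<in>S. Comp (preorder_cat Q le) (vpair (b, b)) f = Comp (preorder_cat Q le) (vpair (b, b)) g"
    by auto
  have bb: "vpair (b, b) \<in> hom (preorder_cat Q le) b b"
    using category.Ident_hom[OF cat b] by simp
  show "\<exists>c\<in>Obj (preorder_cat Q le). \<exists>h\<in>hom (preorder_cat Q le) b c.
      \<forall>f\<in>S. \<forall>g\<in>S. Comp (preorder_cat Q le) h f = Comp (preorder_cat Q le) h g"
    by (rule bexI[OF _ b], rule bexI[OF _ bb], rule eq)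
qed

lemma cat_functor_preorder:
  fixes Q :: "'u set"
  assumes cat: "category (preorder_cat Q le)" and C: "category C"
    and X: "\<And>p. p \<in> Q \<Longrightarrow> X p \<in> Obj C"
    and tr: "\<And>p q. p \<in> Q \<Longrightarrow> q \<in> Q \<Longrightarrow> le p q \<Longrightarrow> tr p q \<in> hom C (X p) (X q)"
    and id: "\<And>p. p \<in> Q \<Longrightarrow> tr p p = Ident C (X p)"
    and comp: "\<And>p q s. p \<in> Q \<Longrightarrow> q \<in> Q \<Longrightarrow> s \<in> Q \<Longrightarrow> le p q \<Longrightarrow> le q s \<Longrightarrow>
      Comp C (tr q s) (tr p q) = tr p s"
  shows "cat_functor (preorder_cat Q le) C (preorder_fctr X tr)"
proof -
  interpret category "preorder_cat Q le" by fact
  interpret C: category C by fact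
  show ?thesis
  proof
    fix f A B g E assume "f \<in> hom (preorder_cat Q le) A B" "g \<in> hom (preorder_cat Q le) B E"
    then show "FArr (preorder_fctr X tr) (Comp (preorder_cat Q le) g f) =
        Comp C (FArr (preorder_fctr X tr) g) (FArr (preorder_fctr X tr) f)"
      using comp[of A B E] by (simp add: hom_preorder_cat)
  qed (auto simp: hom_preorder_cat X tr id)
qed

end

section \<open>Decomposition of a colimit along subcategories\<close>

text \<open>
  A colimit \<open>X\<close> over \<open>I\<close> is decomposed along a directed family of subcategories that cover \<open>I\<close>: it is the
  colimit of the colimits \<open>Y_q\<close> over the members of the family. The family is indexed by a set \<open>Q\<close> of
  elements of the universe, preordered by inclusion of the subcategories, because sets of arrows cannot
  themselves be objects of an index category.
\<close>

locale decomposition = universe universe_type + D: cat_functor I C D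
  for universe_type :: "'u itself" and I :: "('u, 'u) cat" and C :: "('o, 'a) cat" and D +
  fixes Q :: "'u set" and sub :: "'u \<Rightarrow> 'u set"
    and X :: 'o and t :: "'u \<Rightarrow> 'a" and Y :: "'u \<Rightarrow> 'o" and \<tau> :: "'u \<Rightarrow> 'u \<Rightarrow> 'a"
  assumes t: "colimit I C D X t"
    and sub: "q \<in> Q \<Longrightarrow> subcategory I (sub q)"
    and \<tau>: "q \<in> Q \<Longrightarrow> colimit (subcat I (sub q)) C D (Y q) (\<tau> q)"
    and directed: "p \<in> Q \<Longrightarrow> q \<in> Q \<Longrightarrow> \<exists>s\<in>Q. sub p \<subseteq> sub s \<and> sub q \<subseteq> sub s"
    and cover: "u \<in> Arr I \<Longrightarrow> \<exists>q\<in>Q. u \<in> sub q"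
begin

abbreviation "PQ \<equiv> preorder_cat Q (\<lambda>p q. sub p \<subseteq> sub q)"

abbreviation "objs q \<equiv> Obj (subcat I (sub q))"

lemma sub_Arr: "q \<in> Q \<Longrightarrow> sub q \<subseteq> Arr I"
  using sub by (simp add: subcategory_def)

lemma D_sub: "q \<in> Q \<Longrightarrow> cat_functor (subcat I (sub q)) C D"
  using cat_functor_subcat[OF D.cat_functor_axioms sub] .

lemma category_PQ: "category PQ"
  by (rule category_preorder_cat) auto

lemma Y_Obj: "q \<in> Q \<Longrightarrow> Y q \<in> Obj C"
  using colimit_Obj[OF \<tau>] .

lemma \<tau>_hom: "q \<in> Q \<Longrightarrow> i \<in> objs q \<Longrightarrow> \<tau> q i \<in> hom C (FObj D i) (Y q)"
  using colimit_hom[OF \<tau>] .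

lemma \<tau>_natural: "q \<in> Q \<Longrightarrow> u \<in> hom I i j \<Longrightarrow> u \<in> sub q \<Longrightarrow> Comp C (\<tau> q j) (FArr D u) = \<tau> q i"
  using colimit_natural[OF \<tau>, of q u i j] sub_Arr by (simp add: hom_subcat)

lemma restrict_cocone:
  assumes p: "p \<in> Q" and s: "cocone I C D d s"
  shows "cocone (subcat I (sub p)) C D d s"
proof -
  interpret S: cat_functor "subcat I (sub p)" C D using D_sub[OF p] .
  show ?thesis
  proof (rule coconeI)
    show "category (subcat I (sub p))" by unfold_locales
    show "d \<in> Obj C" using cocone_Obj[OF s] .
    show "s i \<in> hom C (FObj D i) d" if "i \<in> objs p" for i
      using that cocone_hom[OF s] by simp
    show "Comp C (s j) (FArr D u) = s i" if "u \<in> hom (subcat I (sub p)) i j" for i j u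
      using that hom_subcat[OF sub_Arr[OF p]] cocone_natural[OF s] by blast
  qed
qed

lemma le_cocone:
  assumes p: "p \<in> Q" and q: "q \<in> Q" and pq: "sub p \<subseteq> sub q"
  shows "cocone (subcat I (sub p)) C D (Y q) (\<tau> q)"
proof -
  interpret S: cat_functor "subcat I (sub p)" C D using D_sub[OF p] .
  show ?thesis
  proof (rule coconeI)
    show "category (subcat I (sub p))" by unfold_locales
    show "Y q \<in> Obj C" using Y_Obj[OF q] .
    show "\<tau> q i \<in> hom C (FObj D i) (Y q)" if "i \<in> objs p" for i
      using that pq by (intro \<tau>_hom[OF q]) auto
    show "Comp C (\<tau> q j) (FArr D u) = \<tau> q i" if "u \<in> hom (subcat I (sub p)) i j" for i j u
      using that pq hom_subcat[OF sub_Arr[OF p], of u i j] by (intro \<tau>_natural[OF q]) auto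
  qed
qed

definition tr where
  "tr p q = (SOME h. h \<in> hom C (Y p) (Y q) \<and> (\<forall>i\<in>objs p. Comp C h (\<tau> p i) = \<tau> q i))"

definition x where
  "x q = (SOME h. h \<in> hom C (Y q) X \<and> (\<forall>i\<in>objs q. Comp C h (\<tau> q i) = t i))"

lemma tr:
  assumes "p \<in> Q" "q \<in> Q" "sub p \<subseteq> sub q"
  shows "tr p q \<in> hom C (Y p) (Y q)" "\<And>i. i \<in> objs p \<Longrightarrow> Comp C (tr p q) (\<tau> p i) = \<tau> q i"
proof -
  have "\<exists>h. h \<in> hom C (Y p) (Y q) \<and> (\<forall>i\<in>objs p. Comp C h (\<tau> p i) = \<tau> q i)"
    by (rule colimit_factor[OF \<tau>[OF assms(1)] le_cocone[OF assms]]) blast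
  from someI_ex[OF this] show "tr p q \<in> hom C (Y p) (Y q)"
    "\<And>i. i \<in> objs p \<Longrightarrow> Comp C (tr p q) (\<tau> p i) = \<tau> q i"
    unfolding tr_def by blast+
qed

lemma x:
  assumes "q \<in> Q"
  shows "x q \<in> hom C (Y q) X" "\<And>i. i \<in> objs q \<Longrightarrow> Comp C (x q) (\<tau> q i) = t i"
proof -
  have "\<exists>h. h \<in> hom C (Y q) X \<and> (\<forall>i\<in>objs q. Comp C h (\<tau> q i) = t i)"
    by (rule colimit_factor[OF \<tau>[OF assms(1)] restrict_cocone[OF assms colimit_cocone[OF t]]]) blast
  from someI_ex[OF this] show "x q \<in> hom C (Y q) X" "\<And>i. i \<in> objs q \<Longrightarrow> Comp C (x q) (\<tau> q i) = t i"
    unfolding x_def by blast+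
qed

abbreviation "Diag \<equiv> preorder_fctr Y tr"

lemma Y_eqI:
  assumes "q \<in> Q" "g \<in> hom C (Y q) d" "g' \<in> hom C (Y q) d"
    and "\<And>i. i \<in> objs q \<Longrightarrow> Comp C g (\<tau> q i) = Comp C g' (\<tau> q i)"
  shows "g = g'"
  by (rule colimit_eqI[OF D_sub[OF assms(1)] \<tau>[OF assms(1)] assms(2,3)]) (rule assms(4))

lemma objs_mono: "sub p \<subseteq> sub q \<Longrightarrow> i \<in> objs p \<Longrightarrow> i \<in> objs q"
  by auto

lemma functor_Diag: "cat_functor PQ C Diag"
proof (rule cat_functor_preorder[OF category_PQ D.cod.category_axioms Y_Obj tr(1)])
  fix p assume p: "p \<in> Q"
  have tp: "tr p p \<in> hom C (Y p) (Y p)" using tr(1)[OF p p] by simp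
  show "tr p p = Ident C (Y p)"
  proof (rule Y_eqI[OF p tp D.cod.Ident_hom[OF Y_Obj[OF p]]])
    fix i assume i: "i \<in> objs p"
    show "Comp C (tr p p) (\<tau> p i) = Comp C (Ident C (Y p)) (\<tau> p i)"
      using tr(2)[OF p p subset_refl i] D.cod.Ident_Comp[OF \<tau>_hom[OF p i]] by simp
  qed
next
  fix p q s assume Q: "p \<in> Q" "q \<in> Q" "s \<in> Q" and le: "sub p \<subseteq> sub q" "sub q \<subseteq> sub s"
  have le': "sub p \<subseteq> sub s" using le by blast
  note h = tr(1)[OF Q(1,2) le(1)] tr(1)[OF Q(2,3) le(2)]
  show "Comp C (tr q s) (tr p q) = tr p s"
  proof (rule Y_eqI[OF Q(1) D.cod.Comp_hom[OF h] tr(1)[OF Q(1,3) le']])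
    fix i assume i: "i \<in> objs p"
    show "Comp C (Comp C (tr q s) (tr p q)) (\<tau> p i) = Comp C (tr p s) (\<tau> p i)"
      using tr(2)[OF Q(1,2) le(1) i] tr(2)[OF Q(2,3) le(2) objs_mono[OF le(1) i]]
        tr(2)[OF Q(1,3) le' i] D.cod.Comp_assoc[OF \<tau>_hom[OF Q(1) i] h] by simp
  qed
qed

lemma x_natural:
  assumes "p \<in> Q" "q \<in> Q" "sub p \<subseteq> sub q"
  shows "Comp C (x q) (tr p q) = x p"
proof (rule Y_eqI[OF assms(1) D.cod.Comp_hom[OF tr(1)[OF assms] x(1)[OF assms(2)]] x(1)[OF assms(1)]])
  fix i assume i: "i \<in> objs p"
  show "Comp C (Comp C (x q) (tr p q)) (\<tau> p i) = Comp C (x p) (\<tau> p i)"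
    using tr(2)[OF assms i] x(2)[OF assms(1) i] x(2)[OF assms(2) objs_mono[OF assms(3) i]]
      D.cod.Comp_assoc[OF \<tau>_hom[OF assms(1) i] tr(1)[OF assms] x(1)[OF assms(2)]] by simp
qed

text \<open>
  A cocone under the \<open>Y_q\<close> restricts to the objects of \<open>I\<close>, independently of the chosen member \<open>q\<close> of the
  family by directedness, and compatibly with the arrows of \<open>I\<close> because each of them lies in some member.
\<close>

lemma colimit_Diag: "colimit PQ C Diag X x"
proof (rule colimitI)
  show "cocone PQ C Diag X x"
  proof (rule coconeI[OF category_PQ colimit_Obj[OF t]])
    show "x q \<in> hom C (FObj Diag q) X" if "q \<in> Obj PQ" for q
      using that x(1) by simp
    show "Comp C (x q) (FArr Diag u) = x p" if "u \<in> hom PQ p q" for p q u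
      using that x_natural by (auto simp: hom_preorder_cat)
  qed
next
  fix d s assume s: "cocone PQ C Diag d s"
  have s_hom: "s q \<in> hom C (Y q) d" if "q \<in> Q" for q
    using cocone_hom[OF s, of q] that by simp
  have s_nat: "Comp C (s q) (tr p q) = s p" if "p \<in> Q" "q \<in> Q" "sub p \<subseteq> sub q" for p q
    using cocone_natural[OF s, of "vpair (p, q)" p q] that by (simp add: hom_preorder_cat)
  have s_le: "Comp C (s p) (\<tau> p i) = Comp C (s q) (\<tau> q i)"
    if "p \<in> Q" "q \<in> Q" "sub p \<subseteq> sub q" "i \<in> objs p" for p q i
    using D.cod.Comp_assoc[OF \<tau>_hom[OF that(1,4)] tr(1)[OF that(1-3)] s_hom[OF that(2)]]
      tr(2)[OF that] s_nat[OF that(1-3)] by simp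
  \<comment> \<open>Compare both members with an upper bound.\<close>
  have s_indep: "Comp C (s p) (\<tau> p i) = Comp C (s q) (\<tau> q i)"
    if pq: "p \<in> Q" "q \<in> Q" and i: "i \<in> objs p" "i \<in> objs q" for p q i
  proof -
    obtain w where "w \<in> Q" "sub p \<subseteq> sub w" "sub q \<subseteq> sub w" using directed[OF pq] by blast
    then show ?thesis using s_le pq i by metis
  qed
  \<comment> \<open>Any member of the family that contains \<open>i\<close> serves.\<close>
  define at where "at i = (SOME q. q \<in> Q \<and> i \<in> objs q)" for i
  have at: "at i \<in> Q" "i \<in> objs (at i)" if "i \<in> Obj I" for i
  proof -
    have "Ident I i \<in> Arr I" using D.dom.Ident_hom[OF that] by (simp add: hom_def)
    then have "\<exists>q. q \<in> Q \<and> i \<in> objs q" using cover[of "Ident I i"] that by auto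
    from someI_ex[OF this] show "at i \<in> Q" "i \<in> objs (at i)" unfolding at_def by auto
  qed
  define w where "w i = Comp C (s (at i)) (\<tau> (at i) i)" for i
  have w_eq: "w i = Comp C (s q) (\<tau> q i)" if "q \<in> Q" "i \<in> objs q" for q i
  proof -
    have "i \<in> Obj I" using that(2) by simp
    then show ?thesis
      unfolding w_def using s_indep[OF at(1) that(1) at(2) that(2)] by simp
  qed
  have "cocone I C D d w"
  proof (rule coconeI)
    show "category I" by unfold_locales
    show "d \<in> Obj C" using cocone_Obj[OF s] .
    show "w i \<in> hom C (FObj D i) d" if i: "i \<in> Obj I" for i
      unfolding w_def using D.cod.Comp_hom[OF \<tau>_hom[OF at[OF i]] s_hom[OF at(1)[OF i]]] .
    fix i j u assume u: "u \<in> hom I i j"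
    then obtain q where q: "q \<in> Q" "u \<in> sub q" using cover[of u] by (auto simp: hom_def)
    have ij: "i \<in> objs q" "j \<in> objs q"
      using sub[OF q(1)] q(2) u D.dom.hom_Dom[OF u] D.dom.hom_Cod[OF u]
      by (auto simp: subcategory_def hom_def)
    show "Comp C (w j) (FArr D u) = w i"
      unfolding w_eq[OF q(1) ij(1)] w_eq[OF q(1) ij(2)]
      using D.cod.Comp_assoc[OF D.FArr_hom[OF u] \<tau>_hom[OF q(1) ij(2)] s_hom[OF q(1)]]
        \<tau>_natural[OF q(1) u q(2)] by simp
  qed
  then obtain h where h: "h \<in> hom C X d" "\<And>i. i \<in> Obj I \<Longrightarrow> Comp C h (t i) = w i"
    using colimit_factor[OF t] by metis
  have "Comp C h (x q) = s q" if q: "q \<in> Q" for q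
  proof (rule Y_eqI[OF q D.cod.Comp_hom[OF x(1)[OF q] h(1)] s_hom[OF q]])
    fix i assume i: "i \<in> objs q"
    show "Comp C (Comp C h (x q)) (\<tau> q i) = Comp C (s q) (\<tau> q i)"
      using D.cod.Comp_assoc[OF \<tau>_hom[OF q i] x(1)[OF q] h(1)] x(2)[OF q i] h(2)[of i] w_eq[OF q i] i
      by simp
  qed
  then show "\<exists>h\<in>hom C X d. \<forall>q\<in>Obj PQ. Comp C h (x q) = s q"
    using h(1) by auto
next
  fix d h h' assume h: "h \<in> hom C X d" "h' \<in> hom C X d"
    and eq: "\<forall>q\<in>Obj PQ. Comp C h (x q) = Comp C h' (x q)"
  show "h = h'"
  proof (rule colimit_eqI[OF D.cat_functor_axioms t h])
    fix i assume i: "i \<in> Obj I"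
    have "Ident I i \<in> Arr I" using D.dom.Ident_hom[OF i] by (simp add: hom_def)
    then obtain q where q: "q \<in> Q" "i \<in> objs q" using cover[of "Ident I i"] i by auto
    have "Comp C h (x q) = Comp C h' (x q)" using eq q(1) by simp
    then show "Comp C h (t i) = Comp C h' (t i)"
      using D.cod.Comp_assoc[OF \<tau>_hom[OF q] x(1)[OF q(1)] h(1)]
        D.cod.Comp_assoc[OF \<tau>_hom[OF q] x(1)[OF q(1)] h(2)] x(2)[OF q] by simp
  qed
qed

end

section \<open>Filtered subcategories of bounded size\<close>

text \<open>
  \<open>W\<close> contains what a subcategory containing \<open>S\<close> needs in order to be a category, and a bound and a
  coequalizer for \<open>S\<close>. A set that closes all its subsets with fewer than \<open>r\<close> elements is an
  \<open>r\<close>-filtered subcategory. An empty \<open>S\<close> is left out of the last clause, as it is parallel for all pairs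
  of objects; there an identity coequalizes.
\<close>

definition closes :: "('o, 'a) cat \<Rightarrow> 'a set \<Rightarrow> 'a set \<Rightarrow> bool" where
  "closes I S W \<longleftrightarrow>
     (\<forall>u\<in>S. Ident I (Dom I u) \<in> W \<and> Ident I (Cod I u) \<in> W) \<and>
     (\<forall>u\<in>S. \<forall>v\<in>S. Cod I u = Dom I v \<longrightarrow> Comp I v u \<in> W) \<and>
     (\<exists>c\<in>Obj I. Ident I c \<in> W \<and> (\<forall>u\<in>S. \<exists>h\<in>W. h \<in> hom I (Dom I u) c)) \<and>
     (\<forall>a b. S \<noteq> {} \<and> S \<subseteq> hom I a b \<longrightarrow>
        (\<exists>c\<in>Obj I. Ident I c \<in> W \<and> (\<exists>h\<in>W. h \<in> hom I b c \<and> (\<forall>f\<in>S. \<forall>g\<in>S. Comp I h f = Comp I h g))))"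

lemma closes_mono:
  assumes "closes I S W" and W: "W \<subseteq> W'"
  shows "closes I S W'"
  unfolding closes_def
proof (intro conjI)
  note c = assms(1)[unfolded closes_def]
  show "\<forall>u\<in>S. Ident I (Dom I u) \<in> W' \<and> Ident I (Cod I u) \<in> W'"
    using c[THEN conjunct1] W by blast
  show "\<forall>u\<in>S. \<forall>v\<in>S. Cod I u = Dom I v \<longrightarrow> Comp I v u \<in> W'"
    using c[THEN conjunct2, THEN conjunct1] W by blast
  show "\<exists>c\<in>Obj I. Ident I c \<in> W' \<and> (\<forall>u\<in>S. \<exists>h\<in>W'. h \<in> hom I (Dom I u) c)"
    using c[THEN conjunct2, THEN conjunct2, THEN conjunct1] W by blast
  show "\<forall>a b. S \<noteq> {} \<and> S \<subseteq> hom I a b \<longrightarrow>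
        (\<exists>c\<in>Obj I. Ident I c \<in> W' \<and> (\<exists>h\<in>W'. h \<in> hom I b c \<and> (\<forall>f\<in>S. \<forall>g\<in>S. Comp I h f = Comp I h g)))"
  proof (intro allI impI)
    fix a b assume "S \<noteq> {} \<and> S \<subseteq> hom I a b"
    from c[THEN conjunct2, THEN conjunct2, THEN conjunct2, rule_format, OF this]
    obtain c h where ch: "c \<in> Obj I" "Ident I c \<in> W" "h \<in> W" "h \<in> hom I b c" "\<forall>f\<in>S. \<forall>g\<in>S. Comp I h f = Comp I h g"
      by blast
    have "Ident I c \<in> W'" "h \<in> W'" using ch(2,3) W by auto
    then show "\<exists>c\<in>Obj I. Ident I c \<in> W' \<and> (\<exists>h\<in>W'. h \<in> hom I b c \<and> (\<forall>f\<in>S. \<forall>g\<in>S. Comp I h f = Comp I h g))"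
      using ch by (intro bexI[of _ c] conjI bexI[of _ h])
  qed
qed

lemma ex_closes:
  fixes I :: "('i, 'j) cat" and r s :: "'u rel"
  assumes r: "regular_cardinal r" and s: "regular_cardinal s" and rs: "r <o s"
    and I: "category I" "filtered r I" and S: "S \<subseteq> Arr I" "|S| <o r"
  shows "\<exists>W\<subseteq>Arr I. |W| <o s \<and> closes I S W"
proof -
  interpret category I by fact
  have Ss: "|S| <o s" using S(2) rs by (rule ordLess_transitive)
  have Sh: "u \<in> hom I (Dom I u) (Cod I u)" if "u \<in> S" for u
    using that S(1) by (auto intro: hom_Arr)
  let ?W1 = "(\<lambda>u. Ident I (Dom I u)) ` S \<union> (\<lambda>u. Ident I (Cod I u)) ` S"
  let ?W2 = "\<Union>u\<in>S. (\<lambda>v. Comp I v u) ` {v \<in> S. Cod I u = Dom I v}"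
  have DS: "Dom I ` S \<subseteq> Obj I" using S(1) Dom_Obj by auto
  have "\<exists>c\<in>Obj I. \<forall>a\<in>Dom I ` S. hom I a c \<noteq> {}"
    by (rule filteredD_bound[OF I(2) DS card_image_less[OF S(2)]])
  then obtain c where c: "c \<in> Obj I" "\<forall>u\<in>S. \<exists>h. h \<in> hom I (Dom I u) c"
    by (auto simp flip: ex_in_conv)
  then obtain h where h: "\<forall>u\<in>S. h u \<in> hom I (Dom I u) c" by metis
  let ?W3 = "insert (Ident I c) (h ` S)"
  have W4: "\<exists>W4\<subseteq>Arr I. finite W4 \<and> (\<forall>a b. S \<noteq> {} \<and> S \<subseteq> hom I a b \<longrightarrow>
      (\<exists>c\<in>Obj I. Ident I c \<in> W4 \<and> (\<exists>h\<in>W4. h \<in> hom I b c \<and> (\<forall>f\<in>S. \<forall>g\<in>S. Comp I h f = Comp I h g))))"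
  proof (cases "S \<noteq> {} \<and> (\<exists>a b. S \<subseteq> hom I a b)")
    case True
    then obtain u a b where u: "u \<in> S" "S \<subseteq> hom I a b" by blast
    then have u': "u \<in> hom I a b" by blast
    have ab: "a' = a \<and> b' = b" if "S \<subseteq> hom I a' b'" for a' b'
      using u that by (auto simp: hom_def)
    obtain d k where k: "k \<in> hom I b d" "\<forall>f\<in>S. \<forall>g\<in>S. Comp I k f = Comp I k g"
      by (rule filtered_coequalizer[OF I(2,1) hom_Cod[OF u'] u(2) S(2)])
    have d: "d \<in> Obj I" using hom_Cod[OF k(1)] .
    show ?thesis
    proof (intro exI[of _ "{Ident I d, k}"] conjI allI impI)
      show "{Ident I d, k} \<subseteq> Arr I" using k(1) Ident_hom[OF d] by (simp add: hom_def)
      show "finite {Ident I d, k}" by simp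
      fix a' b' assume "S \<noteq> {} \<and> S \<subseteq> hom I a' b'"
      then have bb: "b' = b" using ab by blast
      show "\<exists>c\<in>Obj I. Ident I c \<in> {Ident I d, k} \<and>
          (\<exists>h\<in>{Ident I d, k}. h \<in> hom I b' c \<and> (\<forall>f\<in>S. \<forall>g\<in>S. Comp I h f = Comp I h g))"
        unfolding bb using k d by (intro bexI[of _ d] conjI bexI[of _ k] insertI1 insertI2)
    qed
  next
    case False
    then show ?thesis by (intro exI[of _ "{}"]) auto
  qed
  then obtain W4 where W4: "W4 \<subseteq> Arr I" "finite W4"
    "\<forall>a b. S \<noteq> {} \<and> S \<subseteq> hom I a b \<longrightarrow>
      (\<exists>c\<in>Obj I. Ident I c \<in> W4 \<and> (\<exists>h\<in>W4. h \<in> hom I b c \<and> (\<forall>f\<in>S. \<forall>g\<in>S. Comp I h f = Comp I h g)))"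
    by blast
  let ?W = "?W1 \<union> ?W2 \<union> ?W3 \<union> W4"
  have "?W \<subseteq> Arr I"
  proof -
    have "?W1 \<subseteq> Arr I"
      using S(1) Ident_hom[OF Dom_Obj] Ident_hom[OF Cod_Obj] by (auto simp: hom_def)
    moreover have "?W2 \<subseteq> Arr I"
    proof clarify
      fix u v assume u: "u \<in> S" and v: "v \<in> S" "Cod I u = Dom I v"
      have "v \<in> hom I (Cod I u) (Cod I v)" using Sh[OF v(1)] v(2) by simp
      from Comp_hom[OF Sh[OF u] this] show "Comp I v u \<in> Arr I" by (simp add: hom_def)
    qed
    moreover have "?W3 \<subseteq> Arr I"
      using h Ident_hom[OF c(1)] by (auto simp: hom_def)
    ultimately show ?thesis using W4(1) by (simp only: Un_subset_iff simp_thms)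
  qed
  moreover have "|?W| <o s"
  proof -
    have 1: "|?W1| <o s" by (intro regular_Un[OF s] card_image_less Ss)
    have 2: "|?W2| <o s"
    proof (rule regular_UNION[OF s Ss])
      fix u assume "u \<in> S"
      have "|{v \<in> S. Cod I u = Dom I v}| <o s"
        by (rule ordLeq_ordLess_trans[OF card_of_mono1 Ss]) auto
      then show "|(\<lambda>v. Comp I v u) ` {v \<in> S. Cod I u = Dom I v}| <o s" by (rule card_image_less)
    qed
    have "|{Ident I c} \<union> h ` S| <o s" by (intro regular_Un[OF s] card_image_less Ss regular_finite[OF s]) simp
    then have 3: "|?W3| <o s" by simp
    show ?thesis by (intro regular_Un[OF s] 1 2 3 regular_finite[OF s] W4(2))
  qed
  moreover have "closes I S ?W"
    unfolding closes_def
  proof (intro conjI)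
    show "\<forall>u\<in>S. Ident I (Dom I u) \<in> ?W \<and> Ident I (Cod I u) \<in> ?W" by blast
    show "\<forall>u\<in>S. \<forall>v\<in>S. Cod I u = Dom I v \<longrightarrow> Comp I v u \<in> ?W" by blast
    show "\<exists>c\<in>Obj I. Ident I c \<in> ?W \<and> (\<forall>u\<in>S. \<exists>h\<in>?W. h \<in> hom I (Dom I u) c)"
      using h c(1) by (intro bexI[of _ c]) auto
    show "\<forall>a b. S \<noteq> {} \<and> S \<subseteq> hom I a b \<longrightarrow>
        (\<exists>c\<in>Obj I. Ident I c \<in> ?W \<and> (\<exists>h\<in>?W. h \<in> hom I b c \<and> (\<forall>f\<in>S. \<forall>g\<in>S. Comp I h f = Comp I h g)))"
    proof (intro allI impI)
      fix a b assume "S \<noteq> {} \<and> S \<subseteq> hom I a b"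
      from W4(3)[rule_format, OF this] obtain c h where ch:
        "c \<in> Obj I" "Ident I c \<in> W4" "h \<in> W4" "h \<in> hom I b c" "\<forall>f\<in>S. \<forall>g\<in>S. Comp I h f = Comp I h g"
        by blast
      then have "Ident I c \<in> ?W" "h \<in> ?W" by simp_all
      with ch show "\<exists>c\<in>Obj I. Ident I c \<in> ?W \<and>
          (\<exists>h\<in>?W. h \<in> hom I b c \<and> (\<forall>f\<in>S. \<forall>g\<in>S. Comp I h f = Comp I h g))"
        by (intro bexI[of _ c] conjI bexI[of _ h])
    qed
  qed
  ultimately show ?thesis by (intro exI[of _ ?W] conjI)
qed

lemma closed_subcategory:
  fixes I :: "('i, 'j) cat" and r :: "'u rel"
  assumes r: "regular_cardinal r" and I: "category I" and T: "T \<subseteq> Arr I"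
    and closed: "\<And>S. S \<subseteq> T \<Longrightarrow> |S| <o r \<Longrightarrow> closes I S T"
  shows "subcategory I T" "filtered r (subcat I T)"
proof -
  interpret category I by fact
  show sub: "subcategory I T"
    unfolding subcategory_def
  proof (intro conjI ballI impI T)
    fix u assume "u \<in> T"
    then have "closes I {u} T" by (intro closed regular_finite[OF r]) auto
    then show "Ident I (Dom I u) \<in> T" "Ident I (Cod I u) \<in> T" by (auto simp: closes_def)
  next
    fix u v assume "u \<in> T" "v \<in> T" and uv: "Cod I u = Dom I v"
    then have "closes I {u, v} T" by (intro closed regular_finite[OF r]) auto
    then have "\<forall>a\<in>{u, v}. \<forall>b\<in>{u, v}. Cod I a = Dom I b \<longrightarrow> Comp I b a \<in> T"
      unfolding closes_def by (elim conjE)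
    then show "Comp I v u \<in> T" using uv by simp
  qed
  show "filtered r (subcat I T)"
    unfolding filtered_def
  proof (intro conjI allI impI ballI)
    fix S assume "S \<subseteq> Obj (subcat I T) \<and> |S| <o r"
    then have S: "S \<subseteq> Obj I" "Ident I ` S \<subseteq> T" "|Ident I ` S| <o r" by (auto intro: card_image_less)
    have "\<exists>c\<in>Obj I. Ident I c \<in> T \<and> (\<forall>u\<in>Ident I ` S. \<exists>h\<in>T. h \<in> hom I (Dom I u) c)"
      using closed[OF S(2,3)] unfolding closes_def by (elim conjE)
    then obtain c where c: "c \<in> Obj I" "Ident I c \<in> T" "\<forall>u\<in>S. \<exists>h\<in>T. h \<in> hom I (Dom I (Ident I u)) c"
      by blast
    have "\<forall>a\<in>S. hom (subcat I T) a c \<noteq> {}"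
    proof
      fix a assume a: "a \<in> S"
      then have "Dom I (Ident I a) = a" using S(1) Ident_hom[of a] by (auto simp: hom_def)
      then obtain h where "h \<in> T" "h \<in> hom I a c" using c(3) a by auto
      then have "h \<in> hom (subcat I T) a c" by (simp add: hom_subcat[OF T])
      then show "hom (subcat I T) a c \<noteq> {}" by blast
    qed
    then show "\<exists>c\<in>Obj (subcat I T). \<forall>s\<in>S. hom (subcat I T) s c \<noteq> {}"
      using c(1,2) by auto
  next
    fix a b S assume a: "a \<in> Obj (subcat I T)" and b: "b \<in> Obj (subcat I T)"
      and "S \<subseteq> hom (subcat I T) a b \<and> |S| <o r"
    then have S: "S \<subseteq> hom I a b" "S \<subseteq> T" "|S| <o r" using hom_subcat[OF T] by blast+
    have "\<exists>c\<in>Obj I. Ident I c \<in> T \<and> (\<exists>h\<in>T. h \<in> hom I b c \<and> (\<forall>f\<in>S. \<forall>g\<in>S. Comp I h f = Comp I h g))"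
    proof (cases "S = {}")
      case True
      then show ?thesis using b Ident_hom[of b] by auto
    next
      case False
      then show ?thesis using closed[OF S(2,3)] S(1) unfolding closes_def by simp
    qed
    then obtain c h where "c \<in> Obj I" "Ident I c \<in> T" "h \<in> T" "h \<in> hom I b c"
      and eq: "\<forall>f\<in>S. \<forall>g\<in>S. Comp I h f = Comp I h g"
      by blast
    then have "c \<in> Obj (subcat I T)" "h \<in> hom (subcat I T) b c"
      by (simp_all add: hom_subcat[OF T])
    then show "\<exists>c\<in>Obj (subcat I T). \<exists>h\<in>hom (subcat I T) b c.
        \<forall>f\<in>S. \<forall>g\<in>S. Comp (subcat I T) h f = Comp (subcat I T) h g"
      using eq by auto
  qed
qed

lemma (in universe) index_subsets:
  fixes U :: "'u set"
  assumes "small U"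
  obtains Q :: "'u set" and sub where "small Q" "sub ` Q = {T. T \<subseteq> U \<and> P T}"
proof -
  have "|{T. T \<subseteq> U \<and> P T}| \<le>o |Pow U|" by (rule card_of_mono1) auto
  then have "|{T. T \<subseteq> U \<and> P T}| <o |UNIV :: 'u set|"
    using small_Pow[OF assms] by (rule ordLeq_ordLess_trans)
  then obtain Q :: "'u set" and sub where "bij_betw sub Q {T. T \<subseteq> U \<and> P T}" "small Q"
    by (rule copy_in_universe)
  then show thesis using that unfolding bij_betw_def by blast
qed

text \<open>
  The closure lemma applied to the arrows of \<open>I\<close>. The relation \<open>R\<close> is a further closure condition that the
  subcategories have to satisfy; for the inserter it makes the structure map restrict to them.
\<close>

lemma (in universe) filtered_subcategories:
  fixes I :: "('u, 'u) cat" and r s :: "'u rel"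
  assumes r: "regular_cardinal r" and s: "regular_cardinal s" and rs: "sharply_below r s"
    and I: "small_category I" "filtered r I"
    and R: "\<And>S. S \<subseteq> Arr I \<Longrightarrow> |S| <o r \<Longrightarrow> \<exists>W\<subseteq>Arr I. |W| <o s \<and> R S W"
    and R_mono: "\<And>S W W'. R S W \<Longrightarrow> W \<subseteq> W' \<Longrightarrow> R S W'"
  obtains Q :: "'u set" and sub where "small Q"
    "\<forall>q\<in>Q. subcategory I (sub q) \<and> |sub q| <o s \<and> filtered r (subcat I (sub q)) \<and>
       (\<forall>S. S \<subseteq> sub q \<and> |S| <o r \<longrightarrow> R S (sub q))"
    "\<forall>A. A \<subseteq> Arr I \<and> |A| <o s \<longrightarrow> (\<exists>q\<in>Q. A \<subseteq> sub q)"
proof -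
  have catI: "category I" and smallI: "small (Arr I)" using I(1) by (simp_all add: small_category_def)
  have r_s: "r <o s" using rs by (simp add: sharply_below_def)
  let ?closed = "\<lambda>T. \<forall>S. S \<subseteq> T \<and> |S| <o r \<longrightarrow> closes I S T \<and> R S T"
  obtain Q :: "'u set" and sub where Q: "small Q"
    and sub: "sub ` Q = {T. T \<subseteq> Arr I \<and> ( |T| <o s \<and> ?closed T)}"
    by (rule index_subsets[OF smallI])
  have step: "\<exists>W. W \<subseteq> Arr I \<and> |W| <o s \<and> (closes I S W \<and> R S W)" if S: "S \<subseteq> Arr I" "|S| <o r" for S
  proof -
    obtain W1 where W1: "W1 \<subseteq> Arr I" "|W1| <o s" "closes I S W1"
      using ex_closes[OF r s r_s catI I(2) S] by blast
    obtain W2 where W2: "W2 \<subseteq> Arr I" "|W2| <o s" "R S W2" using R[OF S] by blast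
    have "closes I S (W1 \<union> W2)" by (rule closes_mono[OF W1(3)]) simp
    moreover have "R S (W1 \<union> W2)" by (rule R_mono[OF W2(3)]) simp
    ultimately show ?thesis using W1(1) W2(1) regular_Un[OF s W1(2) W2(2)] by blast
  qed
  have cover: "\<exists>q\<in>Q. A \<subseteq> sub q" if A: "A \<subseteq> Arr I" "|A| <o s" for A
  proof -
    have "\<exists>T. A \<subseteq> T \<and> T \<subseteq> Arr I \<and> |T| <o s \<and>
        (\<forall>S. S \<subseteq> T \<and> |S| <o r \<longrightarrow> (\<exists>W\<subseteq>T. closes I S W \<and> R S W))"
      by (rule closure_under_small_operations[OF r s rs A]) (rule step)
    then obtain T where T: "A \<subseteq> T" "T \<subseteq> Arr I" "|T| <o s"
      "\<forall>S. S \<subseteq> T \<and> |S| <o r \<longrightarrow> (\<exists>W\<subseteq>T. closes I S W \<and> R S W)"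
      by blast
    have "?closed T"
    proof (intro allI impI)
      fix S assume "S \<subseteq> T \<and> |S| <o r"
      then obtain W where "W \<subseteq> T" "closes I S W" "R S W" using T(4) by blast
      then show "closes I S T \<and> R S T" using closes_mono[of I S W T] R_mono[of S W T] by simp
    qed
    then have "T \<in> sub ` Q" unfolding sub using T(2,3) by simp
    then show ?thesis using T(1) by blast
  qed
  have "subcategory I (sub q) \<and> |sub q| <o s \<and> filtered r (subcat I (sub q)) \<and>
       (\<forall>S. S \<subseteq> sub q \<and> |S| <o r \<longrightarrow> R S (sub q))" if q: "q \<in> Q" for q
  proof -
    have "sub q \<in> {T. T \<subseteq> Arr I \<and> ( |T| <o s \<and> ?closed T)}"
      using q sub by blast
    then have T: "sub q \<subseteq> Arr I" "|sub q| <o s" "?closed (sub q)" by simp_all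
    have "closes I S (sub q)" if "S \<subseteq> sub q" "|S| <o r" for S using T(3) that by simp
    from closed_subcategory[OF r catI T(1) this] show ?thesis using T(2,3) by simp
  qed
  then have "\<forall>q\<in>Q. subcategory I (sub q) \<and> |sub q| <o s \<and> filtered r (subcat I (sub q)) \<and>
       (\<forall>S. S \<subseteq> sub q \<and> |S| <o r \<longrightarrow> R S (sub q))"
    by (intro ballI)
  then show thesis
    by (rule that[OF Q]) (intro allI impI, elim conjE, rule cover)
qed

text \<open>
  The closed subcategories form an \<open>s\<close>-directed family, since by regularity of \<open>s\<close> a union of fewer than
  \<open>s\<close> of them still has fewer than \<open>s\<close> arrows and so lies in another one.
\<close>

lemma (in universe) ex_decomposition:
  fixes I C :: "('u, 'u) cat" and r s :: "'u rel"
  assumes r: "regular_cardinal r" and s: "regular_cardinal s" and rs: "sharply_below r s"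
    and C: "has_filtered_colimits r C"
    and I: "small_category I" "filtered r I" and D: "cat_functor I C D" and t: "colimit I C D X t"
    and R: "\<And>S. S \<subseteq> Arr I \<Longrightarrow> |S| <o r \<Longrightarrow> \<exists>W\<subseteq>Arr I. |W| <o s \<and> R S W"
    and R_mono: "\<And>S W W'. R S W \<Longrightarrow> W \<subseteq> W' \<Longrightarrow> R S W'"
  obtains Q sub Y \<tau> where "decomposition I C D Q sub X t Y \<tau>"
    "small_category (preorder_cat Q (\<lambda>p q. sub p \<subseteq> sub q))"
    "filtered s (preorder_cat Q (\<lambda>p q. sub p \<subseteq> sub q))"
    "\<forall>q\<in>Q. |sub q| <o s \<and> small_category (subcat I (sub q)) \<and> filtered r (subcat I (sub q)) \<and>
       (\<forall>S. S \<subseteq> sub q \<and> |S| <o r \<longrightarrow> R S (sub q))"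
proof -
  obtain Q :: "'u set" and sub where Q: "small Q"
    and subQ: "\<forall>q\<in>Q. subcategory I (sub q) \<and> |sub q| <o s \<and> filtered r (subcat I (sub q)) \<and>
       (\<forall>S. S \<subseteq> sub q \<and> |S| <o r \<longrightarrow> R S (sub q))"
    and cover: "\<forall>A. A \<subseteq> Arr I \<and> |A| <o s \<longrightarrow> (\<exists>q\<in>Q. A \<subseteq> sub q)"
    by (rule filtered_subcategories[OF r s rs I R R_mono])
  have subD: "subcategory I (sub q)" "|sub q| <o s" "filtered r (subcat I (sub q))" "sub q \<subseteq> Arr I"
    if "q \<in> Q" for q
    using subQ that by (simp_all add: subcategory_def)
  have small_sub: "small_category (subcat I (sub q))" if "q \<in> Q" for q
    using small_category_subcat[OF I(1) subD(1)[OF that]] .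
  have "\<exists>c u. colimit (subcat I (sub q)) C D c u" if "q \<in> Q" for q
    using C small_sub[OF that] subD(3)[OF that] cat_functor_subcat[OF D subD(1)[OF that]]
    by (simp add: has_filtered_colimits_def)
  then obtain Y \<tau> where Y: "\<And>q. q \<in> Q \<Longrightarrow> colimit (subcat I (sub q)) C D (Y q) (\<tau> q)"
    by metis
  have dir: "\<exists>q\<in>Q. \<forall>p\<in>S. sub p \<subseteq> sub q" if S: "S \<subseteq> Q" "|S| <o s" for S
  proof -
    have "|\<Union>p\<in>S. sub p| <o s"
      by (rule regular_UNION[OF s S(2)]) (use S(1) subD(2) in auto)
    moreover have "(\<Union>p\<in>S. sub p) \<subseteq> Arr I" using S(1) subD(4) by blast
    ultimately obtain q where "q \<in> Q" "(\<Union>p\<in>S. sub p) \<subseteq> sub q" using cover by meson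
    then show ?thesis by blast
  qed
  have dec: "decomposition I C D Q sub X t Y \<tau>"
  proof (intro decomposition.intro decomposition_axioms.intro universe_axioms D t)
    show "subcategory I (sub q)" if "q \<in> Q" for q using subD(1)[OF that] .
    show "colimit (subcat I (sub q)) C D (Y q) (\<tau> q)" if "q \<in> Q" for q using Y[OF that] .
    show "\<exists>w\<in>Q. sub p \<subseteq> sub w \<and> sub q \<subseteq> sub w" if "p \<in> Q" "q \<in> Q" for p q
      using dir[of "{p, q}"] regular_finite[OF s, of "{p, q}"] that by auto
    show "\<exists>q\<in>Q. u \<in> sub q" if "u \<in> Arr I" for u
      using cover[rule_format, of "{u}"] regular_finite[OF s, of "{u}"] that by auto
  qed
  then interpret decomposition universe_type I C D Q sub X t Y \<tau> .
  show thesis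
  proof (rule that[OF dec])
    show "small_category PQ" using small_preorder_cat[OF category_PQ Q] .
    show "filtered s PQ" using filtered_preorder_cat[OF category_PQ dir] .
    show "\<forall>q\<in>Q. |sub q| <o s \<and> small_category (subcat I (sub q)) \<and> filtered r (subcat I (sub q)) \<and>
       (\<forall>S. S \<subseteq> sub q \<and> |S| <o r \<longrightarrow> R S (sub q))"
      using subQ small_sub by simp
  qed
qed

section \<open>Raising the index of accessibility\<close>

text \<open>
  The filtered colimits with fewer than \<open>s\<close> arrows of \<open>r\<close>-presentable objects. They generate for \<open>s\<close>, and in
  contrast to arbitrary \<open>s\<close>-presentable objects they are visibly preserved by a functor that is strongly
  class-\<open>r\<close>-accessible.
\<close>

definition bounded_filtered_colimit :: "'u rel \<Rightarrow> 'u rel \<Rightarrow> ('u, 'u) cat \<Rightarrow> 'u \<Rightarrow> bool" where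
  "bounded_filtered_colimit r s C Y \<longleftrightarrow>
     (\<exists>(J :: ('u, 'u) cat) D t. small_category J \<and> filtered r J \<and> |Arr J| <o s \<and> cat_functor J C D \<and>
        (\<forall>j\<in>Obj J. presentable r C (FObj D j)) \<and> colimit J C D Y t)"

lemma (in locally_small_category) bounded_filtered_colimit_presentable:
  assumes s: "regular_cardinal s" and rs: "r <o s" and Y: "bounded_filtered_colimit r s C Y"
  shows "presentable s C Y"
proof -
  obtain J :: "('u, 'u) cat" and D t where J: "|Arr J| <o s" "cat_functor J C D"
    "\<forall>j\<in>Obj J. presentable r C (FObj D j)" "colimit J C D Y t"
    using Y unfolding bounded_filtered_colimit_def by blast
  show ?thesis
    by (rule presentable_small_colimit[OF s J(2,1) presentable_mono[OF bspec[OF J(3)] ordLess_imp_ordLeq[OF rs]] J(4)])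
qed

lemma (in universe) class_accessible_locally_small_category:
  "class_accessible_at (r :: 'u rel) C \<Longrightarrow> locally_small_category C"
  by (simp add: class_accessible_at_def locally_small_category_def locally_small_category_axioms_def
      universe_axioms)

lemma (in universe) class_accessible_atD:
  fixes C :: "('u, 'u) cat"
  assumes "class_accessible_at r C"
  shows "regular_cardinal r" "category C" "locally_small C" "has_filtered_colimits r C"
    "\<And>X. X \<in> Obj C \<Longrightarrow> \<exists>(I :: ('u, 'u) cat) D t. small_category I \<and> filtered r I \<and> cat_functor I C D \<and>
       (\<forall>i\<in>Obj I. presentable r C (FObj D i)) \<and> colimit I C D X t"
proof -
  show "regular_cardinal r" "category C" "locally_small C" "has_filtered_colimits r C"
    using assms by (simp_all add: class_accessible_at_def)
  fix X assume X: "X \<in> Obj C"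
  obtain \<A> where A: "\<forall>A\<in>\<A>. presentable r C A"
    "\<forall>X\<in>Obj C. \<exists>(I :: ('u, 'u) cat) D t. small_category I \<and> filtered r I \<and> cat_functor I C D \<and>
       (\<forall>i\<in>Obj I. FObj D i \<in> \<A>) \<and> colimit I C D X t"
    using assms unfolding class_accessible_at_def by (elim conjE exE) blast
  from bspec[OF A(2) X] obtain I :: "('u, 'u) cat" and D t where
    "small_category I" "filtered r I" "cat_functor I C D" "\<forall>i\<in>Obj I. FObj D i \<in> \<A>" "colimit I C D X t"
    by blast
  then show "\<exists>(I :: ('u, 'u) cat) D t. small_category I \<and> filtered r I \<and> cat_functor I C D \<and>
       (\<forall>i\<in>Obj I. presentable r C (FObj D i)) \<and> colimit I C D X t"
    using A(1) by (intro exI[of _ I] exI[of _ D] exI[of _ t]) simp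
qed

lemma (in universe) bounded_filtered_colimits_generate:
  fixes C :: "('u, 'u) cat"
  assumes C: "class_accessible_at r C" and s: "regular_cardinal s" and rs: "sharply_below r s"
    and X: "X \<in> Obj C"
  shows "\<exists>(I :: ('u, 'u) cat) D t. small_category I \<and> filtered s I \<and> cat_functor I C D \<and>
    (\<forall>i\<in>Obj I. bounded_filtered_colimit r s C (FObj D i)) \<and> colimit I C D X t"
proof -
  note acc = class_accessible_atD[OF C]
  obtain I :: "('u, 'u) cat" and D t where I: "small_category I" "filtered r I" and D: "cat_functor I C D"
    and pres: "\<forall>i\<in>Obj I. presentable r C (FObj D i)" and t: "colimit I C D X t"
    using acc(5)[OF X] by blast
  \<comment> \<open>The decomposition of a bare object imposes no further closure condition.\<close>
  have "\<exists>W\<subseteq>Arr I. |W| <o s \<and> True" if "S \<subseteq> Arr I" for S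
    using regular_finite[OF s, of "{}"] by (intro exI[of _ "{}"]) simp
  then obtain Q sub Y \<tau> where dec: "decomposition I C D Q sub X t Y \<tau>"
    and PQ: "small_category (preorder_cat Q (\<lambda>p q. sub p \<subseteq> sub q))"
      "filtered s (preorder_cat Q (\<lambda>p q. sub p \<subseteq> sub q))"
    and subQ: "\<forall>q\<in>Q. |sub q| <o s \<and> small_category (subcat I (sub q)) \<and> filtered r (subcat I (sub q)) \<and>
       (\<forall>S. S \<subseteq> sub q \<and> |S| <o r \<longrightarrow> True)"
    by (rule ex_decomposition[OF acc(1) s rs acc(4) I D t, of "\<lambda>S W. True"])
  interpret decomposition universe_type I C D Q sub X t Y \<tau> by fact
  have "bounded_filtered_colimit r s C (Y q)" if q: "q \<in> Q" for q
    unfolding bounded_filtered_colimit_def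
    using subQ q D_sub[OF q] pres \<tau>[OF q]
    by (intro exI[of _ "subcat I (sub q)"] exI[of _ D] exI[of _ "\<tau> q"]) simp
  then show ?thesis
    using PQ functor_Diag colimit_Diag by (intro exI[of _ PQ] exI[of _ Diag] exI[of _ x]) simp
qed

lemma (in universe) class_accessible_at_raise:
  fixes C :: "('u, 'u) cat"
  assumes C: "class_accessible_at r C" and s: "regular_cardinal s" and rs: "sharply_below r s"
  shows "class_accessible_at s C"
proof -
  note acc = class_accessible_atD[OF C]
  interpret locally_small_category universe_type C
    using class_accessible_locally_small_category[OF C] .
  have r_s: "r <o s" using rs by (simp add: sharply_below_def)
  show ?thesis
    unfolding class_accessible_at_def
  proof (intro conjI exI[of _ "{Y. bounded_filtered_colimit r s C Y}"] ballI)
    show "regular_cardinal s" "category C" "locally_small C" by (fact s acc)+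
    show "has_filtered_colimits s C"
      unfolding has_filtered_colimits_def
    proof (intro allI impI; elim conjE)
      fix I :: "('u, 'u) cat" and D
      assume I: "small_category I" "filtered s I" and D: "cat_functor I C D"
      show "\<exists>c t. colimit I C D c t"
        using acc(4) I(1) filtered_mono[OF I(2) ordLess_imp_ordLeq[OF r_s]] D
        by (simp add: has_filtered_colimits_def)
    qed
    show "presentable s C A" if "A \<in> {Y. bounded_filtered_colimit r s C Y}" for A
      using bounded_filtered_colimit_presentable[OF s r_s] that by simp
    show "\<exists>(I :: ('u, 'u) cat) D t. small_category I \<and> filtered s I \<and> cat_functor I C D \<and>
      (\<forall>i\<in>Obj I. FObj D i \<in> {Y. bounded_filtered_colimit r s C Y}) \<and> colimit I C D X t"
      if "X \<in> Obj C" for X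
      using bounded_filtered_colimits_generate[OF C s rs that] by simp
  qed
qed

text \<open>
  An \<open>s\<close>-presentable object is a retract of a bounded filtered colimit, because its identity factors through
  a member of the decomposition; functors preserve retracts. This allows \<open>F\<close> and \<open>G\<close>, which may be strongly
  accessible for different cardinals, to be compared at a common one.
\<close>

lemma (in universe) strongly_class_accessible_at_raise:
  fixes K L :: "('u, 'u) cat"
  assumes F: "strongly_class_accessible_at r K L F" and s: "regular_cardinal s" and rs: "sharply_below r s"
  shows "strongly_class_accessible_at s K L F"
proof -
  have r_s: "r <o s" using rs by (simp add: sharply_below_def)
  note r_s' = ordLess_imp_ordLeq[OF r_s]
  have K: "class_accessible_at r K" and L: "class_accessible_at r L" and fct: "cat_functor K L F"
    and cont: "preserves_filtered_colimits r K L F"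
    and pres: "\<And>A. presentable r K A \<Longrightarrow> presentable r L (FObj F A)"
    using F by (simp_all add: strongly_class_accessible_at_def class_accessible_functor_at_def)
  interpret K: locally_small_category universe_type K
    using class_accessible_locally_small_category[OF K] .
  interpret L: locally_small_category universe_type L
    using class_accessible_locally_small_category[OF L] .
  interpret F: cat_functor K L F by fact
  have bounded: "presentable s L (FObj F Y)" if Y: "bounded_filtered_colimit r s K Y" for Y
  proof -
    obtain J :: "('u, 'u) cat" and D t where J: "small_category J" "filtered r J" "|Arr J| <o s"
      and D: "cat_functor J K D" and presD: "\<forall>j\<in>Obj J. presentable r K (FObj D j)" and t: "colimit J K D Y t"
      using Y unfolding bounded_filtered_colimit_def by blast
    have "bounded_filtered_colimit r s L (FObj F Y)"
      unfolding bounded_filtered_colimit_def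
      using J cat_functor_comp[OF D fct] presD pres preserves_filtered_colimitsD[OF cont J(1,2) D t]
      by (intro exI[of _ J] exI[of _ "fctr_comp F D"] exI[of _ "\<lambda>i. FArr F (t i)"]) simp
    then show ?thesis by (rule L.bounded_filtered_colimit_presentable[OF s r_s])
  qed
  have "presentable s L (FObj F A)" if A: "presentable s K A" for A
  proof -
    obtain I :: "('u, 'u) cat" and D t where I: "small_category I" "filtered s I" and D: "cat_functor I K D"
      and bd: "\<forall>i\<in>Obj I. bounded_filtered_colimit r s K (FObj D i)" and t: "colimit I K D A t"
      using bounded_filtered_colimits_generate[OF K s rs K.presentable_Obj[OF A]] by blast
    obtain i m where i: "i \<in> Obj I" and m: "m \<in> hom K A (FObj D i)" "Comp K (t i) m = Ident K A"
      by (rule K.presentable_is_retract[OF s A I D t])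
    have ti: "t i \<in> hom K (FObj D i) A" using colimit_hom[OF t i] .
    have "Comp L (FArr F (t i)) (FArr F m) = Ident L (FObj F A)"
      using F.FArr_Comp[OF m(1) ti] m(2) F.FArr_Ident[OF K.presentable_Obj[OF A]] by simp
    then show ?thesis
      by (rule L.presentable_retract[OF s bounded[OF bspec[OF bd i]] F.FArr_hom[OF m(1)] F.FArr_hom[OF ti]])
  qed
  then show ?thesis
    using class_accessible_at_raise[OF K s rs] class_accessible_at_raise[OF L s rs] fct
      preserves_filtered_colimits_mono[OF cont r_s']
    by (simp add: strongly_class_accessible_at_def class_accessible_functor_at_def)
qed

section \<open>The inserter category and its colimits\<close>

lemma functor_cocone:
  assumes D: "cat_functor I C D" and F: "cat_functor C E F" and t: "cocone I C D c t"
  shows "cocone I E (fctr_comp F D) (FObj F c) (\<lambda>i. FArr F (t i))"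
proof -
  interpret D: cat_functor I C D by fact
  interpret F: cat_functor C E F by fact
  show ?thesis
  proof (rule coconeI)
    show "category I" by unfold_locales
    show "FObj F c \<in> Obj E" using F.FObj_Obj[OF cocone_Obj[OF t]] .
    show "FArr F (t i) \<in> hom E (FObj (fctr_comp F D) i) (FObj F c)" if "i \<in> Obj I" for i
      using F.FArr_hom[OF cocone_hom[OF t that]] by simp
    show "Comp E (FArr F (t j)) (FArr (fctr_comp F D) u) = FArr F (t i)" if u: "u \<in> hom I i j" for i j u
      using F.FArr_Comp[OF D.FArr_hom[OF u] cocone_hom[OF t D.dom.hom_Cod[OF u]]] cocone_natural[OF t u]
      by simp
  qed
qed

locale inserter = universe universe_type + F: cat_functor K L F + G: cat_functor K L G
  for universe_type :: "'u itself" and K L :: "('u, 'u) cat" and F G :: "('u, 'u, 'u, 'u) fctr"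
begin

abbreviation "M \<equiv> Ins K L F G"

abbreviation "P \<equiv> Ins_proj :: ('u, 'u, 'u, 'u) fctr"

lemma ins_arr_simps [simp]:
  "ins_dom (ins_arr x k y :: 'u) = x" "ins_mor (ins_arr x k y :: 'u) = k" "ins_cod (ins_arr x k y :: 'u) = y"
  by (simp_all add: ins_arr_def ins_dom_def ins_mor_def ins_cod_def)

lemma P_simps [simp]: "FObj P x = vfst x" "FArr P m = ins_mor m"
  by (simp_all add: Ins_proj_def)

text \<open>
  The condition on an arrow \<open>k\<close> of the base to be an arrow of the inserter. Since objects of the inserter are
  encoded pairs, the object of the base and the structure map are read off by the projections.
\<close>

definition square :: "'u \<Rightarrow> 'u \<Rightarrow> 'u \<Rightarrow> bool" where
  "square x k y \<longleftrightarrow> k \<in> hom K (vfst x) (vfst y) \<and>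
     Comp L (FArr G k) (vsnd x) = Comp L (vsnd y) (FArr F k)"

lemma Obj_M: "x \<in> Obj M \<longleftrightarrow>
    x = vpair (vfst x, vsnd x) \<and> vfst x \<in> Obj K \<and> vsnd x \<in> hom L (FObj F (vfst x)) (FObj G (vfst x))"
  by (auto simp: Ins_def)

lemma Obj_M_vpair: "vpair (A, f) \<in> Obj M \<longleftrightarrow> A \<in> Obj K \<and> f \<in> hom L (FObj F A) (FObj G A)"
  by (simp add: Obj_M)

lemma Obj_M_fst: "x \<in> Obj M \<Longrightarrow> vfst x \<in> Obj K"
  by (simp add: Obj_M)

lemma Obj_M_snd: "x \<in> Obj M \<Longrightarrow> vsnd x \<in> hom L (FObj F (vfst x)) (FObj G (vfst x))"
  by (simp add: Obj_M)

lemma Arr_M: "m \<in> Arr M \<longleftrightarrow> (\<exists>x k y. m = ins_arr x k y \<and> x \<in> Obj M \<and> y \<in> Obj M \<and> square x k y)"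
proof
  assume "m \<in> Arr M"
  then obtain A f A' f' k where "m = ins_arr (vpair (A, f)) k (vpair (A', f'))"
    "A \<in> Obj K" "f \<in> hom L (FObj F A) (FObj G A)" "A' \<in> Obj K" "f' \<in> hom L (FObj F A') (FObj G A')"
    "k \<in> hom K A A'" "Comp L (FArr G k) f = Comp L f' (FArr F k)"
    by (auto simp: Ins_def)
  then show "\<exists>x k y. m = ins_arr x k y \<and> x \<in> Obj M \<and> y \<in> Obj M \<and> square x k y"
    by (intro exI[of _ "vpair (A, f)"] exI[of _ k] exI[of _ "vpair (A', f')"]) (simp add: Obj_M_vpair square_def)
next
  assume "\<exists>x k y. m = ins_arr x k y \<and> x \<in> Obj M \<and> y \<in> Obj M \<and> square x k y"
  then obtain x k y where m: "m = ins_arr x k y" and x: "x \<in> Obj M" and y: "y \<in> Obj M" and sq: "square x k y"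
    by blast
  obtain A f where x': "x = vpair (A, f)" using x by (auto simp: Ins_def)
  obtain A' f' where y': "y = vpair (A', f')" using y by (auto simp: Ins_def)
  have "A \<in> Obj K \<and> f \<in> hom L (FObj F A) (FObj G A) \<and> A' \<in> Obj K \<and> f' \<in> hom L (FObj F A') (FObj G A') \<and>
      k \<in> hom K A A' \<and> Comp L (FArr G k) f = Comp L f' (FArr F k)"
    using x y sq unfolding x' y' Obj_M_vpair square_def by simp
  then show "m \<in> Arr M"
    unfolding m x' y' Ins_def cat.simps mem_Collect_eq by blast
qed

lemma Dom_M [simp]: "Dom M (ins_arr x k y) = x" and Cod_M [simp]: "Cod M (ins_arr x k y) = y"
  and Ident_M [simp]: "Ident M x = ins_arr x (Ident K (vfst x)) x"
  and Comp_M [simp]: "Comp M n m = ins_arr (ins_dom m) (Comp K (ins_mor n) (ins_mor m)) (ins_cod n)"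
  by (simp_all add: Ins_def)

lemma hom_M: "m \<in> hom M x y \<longleftrightarrow>
    m = ins_arr x (ins_mor m) y \<and> x \<in> Obj M \<and> y \<in> Obj M \<and> square x (ins_mor m) y"
proof
  assume "m \<in> hom M x y"
  then have m: "m \<in> Arr M" "Dom M m = x" "Cod M m = y" by (simp_all add: hom_def)
  then show "m = ins_arr x (ins_mor m) y \<and> x \<in> Obj M \<and> y \<in> Obj M \<and> square x (ins_mor m) y"
    unfolding Arr_M by auto
next
  assume m: "m = ins_arr x (ins_mor m) y \<and> x \<in> Obj M \<and> y \<in> Obj M \<and> square x (ins_mor m) y"
  then have "m \<in> Arr M" unfolding Arr_M by blast
  moreover have "Dom M m = x" "Cod M m = y" using m Dom_M Cod_M by metis+
  ultimately show "m \<in> hom M x y" by (simp add: hom_def)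
qed

lemma hom_M_ins_arr: "ins_arr x k y \<in> hom M x y \<longleftrightarrow> x \<in> Obj M \<and> y \<in> Obj M \<and> square x k y"
  by (simp add: hom_M)

lemma hom_M_D:
  assumes "m \<in> hom M x y"
  shows "m = ins_arr x (ins_mor m) y" "x \<in> Obj M" "y \<in> Obj M" "ins_mor m \<in> hom K (vfst x) (vfst y)"
    "Comp L (FArr G (ins_mor m)) (vsnd x) = Comp L (vsnd y) (FArr F (ins_mor m))"
  using iffD1[OF hom_M assms] by (simp_all add: square_def)

lemma hom_M_dom_cod:
  assumes "m \<in> hom M x y"
  shows "ins_dom m = x" "ins_cod m = y"
  using hom_M_D(1)[OF assms] ins_arr_simps by metis+

lemma square_Ident: "x \<in> Obj M \<Longrightarrow> square x (Ident K (vfst x)) x"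
  using F.dom.Ident_hom[OF Obj_M_fst] F.FArr_Ident[OF Obj_M_fst] G.FArr_Ident[OF Obj_M_fst]
    F.cod.Ident_Comp[OF Obj_M_snd] F.cod.Comp_Ident[OF Obj_M_snd]
  by (simp add: square_def)

lemma square_Comp:
  assumes x: "x \<in> Obj M" and y: "y \<in> Obj M" and z: "z \<in> Obj M" and k: "square x k y" and l: "square y l z"
  shows "square x (Comp K l k) z"
proof -
  have k': "k \<in> hom K (vfst x) (vfst y)" and l': "l \<in> hom K (vfst y) (vfst z)"
    using k l by (simp_all add: square_def)
  note f = Obj_M_snd[OF x] Obj_M_snd[OF y] Obj_M_snd[OF z]
  have "Comp L (FArr G (Comp K l k)) (vsnd x) = Comp L (FArr G l) (Comp L (FArr G k) (vsnd x))"
    using F.cod.Comp_assoc[OF f(1) G.FArr_hom[OF k'] G.FArr_hom[OF l']] G.FArr_Comp[OF k' l'] by simp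
  also have "\<dots> = Comp L (Comp L (FArr G l) (vsnd y)) (FArr F k)"
    using k F.cod.Comp_assoc[OF F.FArr_hom[OF k'] f(2) G.FArr_hom[OF l']] by (simp add: square_def)
  also have "\<dots> = Comp L (vsnd z) (FArr F (Comp K l k))"
    using l F.cod.Comp_assoc[OF F.FArr_hom[OF k'] F.FArr_hom[OF l'] f(3)] F.FArr_Comp[OF k' l']
    by (simp add: square_def)
  finally show ?thesis
    using F.dom.Comp_hom[OF k' l'] by (simp add: square_def)
qed

lemma category_M: "category M"
proof
  fix m assume "m \<in> Arr M"
  then show "Dom M m \<in> Obj M" "Cod M m \<in> Obj M" unfolding Arr_M by auto
next
  fix x assume x: "x \<in> Obj M"
  show "Ident M x \<in> hom M x x" using x square_Ident[OF x] by (simp add: hom_M_ins_arr)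
next
  fix m x y n z assume m: "m \<in> hom M x y" and n: "n \<in> hom M y z"
  have "square x (Comp K (ins_mor n) (ins_mor m)) z"
    using m n by (intro square_Comp[of x y z]) (simp_all add: hom_M)
  then show "Comp M n m \<in> hom M x z"
    using hom_M_dom_cod[OF m] hom_M_dom_cod[OF n] hom_M_D(2)[OF m] hom_M_D(3)[OF n]
    by (simp add: hom_M_ins_arr)
  fix p w assume p: "p \<in> hom M z w"
  show "Comp M p (Comp M n m) = Comp M (Comp M p n) m"
    using F.dom.Comp_assoc[OF hom_M_D(4)[OF m] hom_M_D(4)[OF n] hom_M_D(4)[OF p]] by simp
next
  fix m x y assume m: "m \<in> hom M x y"
  show "Comp M m (Ident M x) = m"
    using F.dom.Comp_Ident[OF hom_M_D(4)[OF m]] hom_M_dom_cod[OF m] hom_M_D(1)[OF m] by simp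
  show "Comp M (Ident M y) m = m"
    using F.dom.Ident_Comp[OF hom_M_D(4)[OF m]] hom_M_dom_cod[OF m] hom_M_D(1)[OF m] by simp
qed

lemma functor_P: "cat_functor M K P"
proof -
  interpret M: category M by (fact category_M)
  show ?thesis
  proof
    show "FObj P x \<in> Obj K" if "x \<in> Obj M" for x using Obj_M_fst[OF that] by simp
    show "FArr P m \<in> hom K (FObj P x) (FObj P y)" if "m \<in> hom M x y" for m x y
      using hom_M_D(4)[OF that] by simp
  qed simp_all
qed

lemma faithful_P:
  assumes "m \<in> hom M x y" "n \<in> hom M x y" "ins_mor m = ins_mor n"
  shows "m = n"
  using hom_M_D(1)[OF assms(1)] hom_M_D(1)[OF assms(2)] assms(3) by simp

lemma locally_small_M:
  assumes "locally_small K"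
  shows "locally_small M"
  unfolding locally_small_def
proof (intro ballI)
  fix x y assume x: "x \<in> Obj M" and y: "y \<in> Obj M"
  have "small (hom K (vfst x) (vfst y))"
    using assms Obj_M_fst[OF x] Obj_M_fst[OF y] by (simp add: locally_small_def)
  moreover have "inj_on ins_mor (hom M x y)" using faithful_P by (auto intro: inj_onI)
  moreover have "ins_mor ` hom M x y \<subseteq> hom K (vfst x) (vfst y)" using hom_M_D(4) by auto
  ultimately show "small (hom M x y)" by (rule small_inj)
qed

text \<open>
  The projection creates the colimits that \<open>F\<close> preserves: the arrow induced in the base is compatible with the
  structure maps since it is so on every component, and the \<open>F(t_i)\<close> are jointly epic.
\<close>

lemma colimit_lift:
  assumes D: "cat_functor I M D" and t: "colimit I K (fctr_comp P D) c t"
    and Ft: "colimit I L (fctr_comp F (fctr_comp P D)) (FObj F c) (\<lambda>i. FArr F (t i))"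
    and f: "f \<in> hom L (FObj F c) (FObj G c)"
    and ft: "\<And>i. i \<in> Obj I \<Longrightarrow> Comp L f (FArr F (t i)) = Comp L (FArr G (t i)) (vsnd (FObj D i))"
  shows "colimit I M D (vpair (c, f)) (\<lambda>i. ins_arr (FObj D i) (t i) (vpair (c, f)))"
proof (rule colimitI)
  interpret D: cat_functor I M D by fact
  have PD: "cat_functor I K (fctr_comp P D)" by (rule cat_functor_comp[OF D functor_P])
  have FPD: "cat_functor I L (fctr_comp F (fctr_comp P D))" by (rule cat_functor_comp[OF PD F.cat_functor_axioms])
  let ?c = "vpair (c, f)" and ?t = "\<lambda>i. ins_arr (FObj D i) (t i) (vpair (c, f))"
  have c: "?c \<in> Obj M" using colimit_Obj[OF t] f by (simp add: Obj_M_vpair)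
  have t_hom: "t i \<in> hom K (vfst (FObj D i)) c" if "i \<in> Obj I" for i
    using colimit_hom[OF t that] by simp
  have Di: "FObj D i \<in> Obj M" if "i \<in> Obj I" for i using D.FObj_Obj[OF that] .
  have t'_hom: "?t i \<in> hom M (FObj D i) ?c" if "i \<in> Obj I" for i
    using Di[OF that] c t_hom[OF that] ft[OF that] by (simp add: hom_M_ins_arr square_def)
  show "cocone I M D ?c ?t"
  proof (rule coconeI)
    show "category I" by unfold_locales
    show "?c \<in> Obj M" by (fact c)
    show "?t i \<in> hom M (FObj D i) ?c" if "i \<in> Obj I" for i by (rule t'_hom[OF that])
    show "Comp M (?t j) (FArr D u) = ?t i" if u: "u \<in> hom I i j" for i j u
      using colimit_natural[OF t u] hom_M_dom_cod[OF D.FArr_hom[OF u]] by simp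
  qed
  show "\<exists>h\<in>hom M ?c y. \<forall>i\<in>Obj I. Comp M h (?t i) = s i" if s: "cocone I M D y s" for y s
  proof -
    have Ps: "cocone I K (fctr_comp P D) (vfst y) (\<lambda>i. ins_mor (s i))"
      using functor_cocone[OF D functor_P s] by simp
    obtain h where h: "h \<in> hom K c (vfst y)" "\<And>i. i \<in> Obj I \<Longrightarrow> Comp K h (t i) = ins_mor (s i)"
      using colimit_factor[OF t Ps] by metis
    have y: "y \<in> Obj M" using cocone_Obj[OF s] .
    have "Comp L (FArr G h) f = Comp L (vsnd y) (FArr F h)"
    proof (rule colimit_eqI[OF FPD Ft])
      show "Comp L (FArr G h) f \<in> hom L (FObj F c) (FObj G (vfst y))"
        by (rule F.cod.Comp_hom[OF f G.FArr_hom[OF h(1)]])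
      show "Comp L (vsnd y) (FArr F h) \<in> hom L (FObj F c) (FObj G (vfst y))"
        by (rule F.cod.Comp_hom[OF F.FArr_hom[OF h(1)] Obj_M_snd[OF y]])
      fix i assume i: "i \<in> Obj I"
      note ti = t_hom[OF i] and si = hom_M_D[OF cocone_hom[OF s i]]
      have "Comp L (Comp L (FArr G h) f) (FArr F (t i)) = Comp L (FArr G h) (Comp L (FArr G (t i)) (vsnd (FObj D i)))"
        using F.cod.Comp_assoc[OF F.FArr_hom[OF ti] f G.FArr_hom[OF h(1)]] ft[OF i] by simp
      also have "\<dots> = Comp L (FArr G (ins_mor (s i))) (vsnd (FObj D i))"
        using F.cod.Comp_assoc[OF Obj_M_snd[OF Di[OF i]] G.FArr_hom[OF ti] G.FArr_hom[OF h(1)]]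
          G.FArr_Comp[OF ti h(1)] h(2)[OF i] by simp
      also have "\<dots> = Comp L (vsnd y) (FArr F (ins_mor (s i)))" by (rule si(5))
      also have "\<dots> = Comp L (Comp L (vsnd y) (FArr F h)) (FArr F (t i))"
        using F.cod.Comp_assoc[OF F.FArr_hom[OF ti] F.FArr_hom[OF h(1)] Obj_M_snd[OF y]]
          F.FArr_Comp[OF ti h(1)] h(2)[OF i] by simp
      finally show "Comp L (Comp L (FArr G h) f) (FArr F (t i)) = Comp L (Comp L (vsnd y) (FArr F h)) (FArr F (t i))" .
    qed
    then have "ins_arr ?c h y \<in> hom M ?c y"
      using c y h(1) by (simp add: hom_M_ins_arr square_def)
    moreover have "Comp M (ins_arr ?c h y) (?t i) = s i" if i: "i \<in> Obj I" for i
      using h(2)[OF i] hom_M_D(1)[OF cocone_hom[OF s i]] by simp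
    ultimately show ?thesis by blast
  qed
  show "h = h'" if h: "h \<in> hom M ?c y" "h' \<in> hom M ?c y"
    and eq: "\<forall>i\<in>Obj I. Comp M h (?t i) = Comp M h' (?t i)" for y h h'
  proof (rule faithful_P[OF h])
    have hh: "ins_mor h \<in> hom K c (vfst y)" "ins_mor h' \<in> hom K c (vfst y)"
      using hom_M_D(4)[OF h(1)] hom_M_D(4)[OF h(2)] by simp_all
    show "ins_mor h = ins_mor h'"
    proof (rule colimit_eqI[OF PD t hh])
      fix i assume i: "i \<in> Obj I"
      have "ins_mor (Comp M h (?t i)) = ins_mor (Comp M h' (?t i))" using eq i by metis
      then show "Comp K (ins_mor h) (t i) = Comp K (ins_mor h') (t i)" by simp
    qed
  qed
qed

text \<open>
  The structure maps of the diagram form a cocone under the image of \<open>F\<close>, which induces the structure map of the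
  colimit.
\<close>

lemma ex_colimit_lift:
  assumes D: "cat_functor I M D" and t: "colimit I K (fctr_comp P D) c t"
    and Ft: "colimit I L (fctr_comp F (fctr_comp P D)) (FObj F c) (\<lambda>i. FArr F (t i))"
  obtains f where "colimit I M D (vpair (c, f)) (\<lambda>i. ins_arr (FObj D i) (t i) (vpair (c, f)))"
proof -
  interpret D: cat_functor I M D by fact
  have PD: "cat_functor I K (fctr_comp P D)" by (rule cat_functor_comp[OF D functor_P])
  have t_hom: "t i \<in> hom K (vfst (FObj D i)) c" if "i \<in> Obj I" for i
    using colimit_hom[OF t that] by simp
  have Di: "FObj D i \<in> Obj M" if "i \<in> Obj I" for i using D.FObj_Obj[OF that] .
  have "cocone I L (fctr_comp F (fctr_comp P D)) (FObj G c) (\<lambda>i. Comp L (FArr G (t i)) (vsnd (FObj D i)))"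
  proof (rule coconeI)
    show "category I" by unfold_locales
    show "FObj G c \<in> Obj L" using G.FObj_Obj[OF colimit_Obj[OF t]] .
    show "Comp L (FArr G (t i)) (vsnd (FObj D i)) \<in> hom L (FObj (fctr_comp F (fctr_comp P D)) i) (FObj G c)"
      if "i \<in> Obj I" for i
      using F.cod.Comp_hom[OF Obj_M_snd[OF Di[OF that]] G.FArr_hom[OF t_hom[OF that]]] by simp
    fix i j u assume u: "u \<in> hom I i j"
    note Du = hom_M_D[OF D.FArr_hom[OF u]]
    note j = D.dom.hom_Cod[OF u] and i = D.dom.hom_Dom[OF u]
    have nat: "Comp K (t j) (ins_mor (FArr D u)) = t i" using colimit_natural[OF t u] by simp
    have "Comp L (Comp L (FArr G (t j)) (vsnd (FObj D j))) (FArr F (ins_mor (FArr D u))) =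
        Comp L (FArr G (t j)) (Comp L (FArr G (ins_mor (FArr D u))) (vsnd (FObj D i)))"
      using F.cod.Comp_assoc[OF F.FArr_hom[OF Du(4)] Obj_M_snd[OF Du(3)] G.FArr_hom[OF t_hom[OF j]]] Du(5)
      by simp
    also have "\<dots> = Comp L (FArr G (t i)) (vsnd (FObj D i))"
      using F.cod.Comp_assoc[OF Obj_M_snd[OF Du(2)] G.FArr_hom[OF Du(4)] G.FArr_hom[OF t_hom[OF j]]]
        G.FArr_Comp[OF Du(4) t_hom[OF j]] nat by simp
    finally show "Comp L (Comp L (FArr G (t j)) (vsnd (FObj D j))) (FArr (fctr_comp F (fctr_comp P D)) u) =
        Comp L (FArr G (t i)) (vsnd (FObj D i))" by simp
  qed
  from colimit_factor[OF Ft this]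
  obtain f where f: "f \<in> hom L (FObj F c) (FObj G c)"
    and ft: "\<And>i. i \<in> Obj I \<Longrightarrow> Comp L f (FArr F (t i)) = Comp L (FArr G (t i)) (vsnd (FObj D i))"
    by blast
  show thesis
    by (rule that[OF colimit_lift[OF D t Ft f ft]])
qed

end

context inserter
begin

lemma has_filtered_colimits_M:
  fixes s :: "'u rel"
  assumes K: "has_filtered_colimits s K" and F: "preserves_filtered_colimits s K L F"
  shows "has_filtered_colimits s M"
  unfolding has_filtered_colimits_def
proof (intro allI impI; elim conjE)
  fix I :: "('u, 'u) cat" and D
  assume I: "small_category I" "filtered s I" and D: "cat_functor I M D"
  note PD = cat_functor_comp[OF D functor_P]
  obtain c t where t: "colimit I K (fctr_comp P D) c t"
    using K I PD unfolding has_filtered_colimits_def by blast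
  obtain f where "colimit I M D (vpair (c, f)) (\<lambda>i. ins_arr (FObj D i) (t i) (vpair (c, f)))"
    by (rule ex_colimit_lift[OF D t preserves_filtered_colimitsD[OF F I PD t]])
  then show "\<exists>c t. colimit I M D c t" by blast
qed

lemma preserves_filtered_colimits_P:
  fixes s :: "'u rel"
  assumes K: "has_filtered_colimits s K" and F: "preserves_filtered_colimits s K L F"
  shows "preserves_filtered_colimits s M K P"
  unfolding preserves_filtered_colimits_def
proof (intro allI impI; elim conjE)
  fix I :: "('u, 'u) cat" and D y u
  assume I: "small_category I" "filtered s I" and D: "cat_functor I M D" and u: "colimit I M D y u"
  note PD = cat_functor_comp[OF D functor_P]
  obtain c t where t: "colimit I K (fctr_comp P D) c t"
    using K I PD unfolding has_filtered_colimits_def by blast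
  obtain f where f: "colimit I M D (vpair (c, f)) (\<lambda>i. ins_arr (FObj D i) (t i) (vpair (c, f)))"
    by (rule ex_colimit_lift[OF D t preserves_filtered_colimitsD[OF F I PD t]])
  have "colimit I K (fctr_comp P D) (FObj P (vpair (c, f))) (\<lambda>i. FArr P (ins_arr (FObj D i) (t i) (vpair (c, f))))"
    using t by simp
  then show "colimit I K (fctr_comp P D) (FObj P y) (\<lambda>i. FArr P (u i))"
    by (rule colimit_preserved_of_one[OF D functor_P f _ u])
qed

text \<open>
  A factorization of the underlying arrow need not be compatible with the structure maps. The two sides of the
  square become equal in the colimit of the \<open>G(D i)\<close>, hence at a later stage, because \<open>F\<close> of the
  underlying object is presentable.
\<close>

lemma presentable_M:
  fixes s :: "'u rel"
  assumes s: "regular_cardinal s" and small: "locally_small K" "locally_small L"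
    and K: "has_filtered_colimits s K" and F: "preserves_filtered_colimits s K L F"
    and G: "preserves_filtered_colimits s K L G"
    and x: "x \<in> Obj M" and px: "presentable s K (vfst x)" and pFx: "presentable s L (FObj F (vfst x))"
  shows "presentable s M x"
proof -
  interpret K: locally_small_category universe_type K
    using small by unfold_locales
  interpret L: locally_small_category universe_type L
    using small by unfold_locales
  show ?thesis
    unfolding presentable_iff[OF category_M locally_small_M[OF small(1)] s] factors_essentially_uniquely_def
  proof (intro conjI allI impI; (elim conjE)?)
    show "x \<in> Obj M" by fact
    fix I :: "('u, 'u) cat" and D c t
    assume I: "small_category I" "filtered s I" and D: "cat_functor I M D" and t: "colimit I M D c t"
    interpret D: cat_functor I M D by fact
    note PD = cat_functor_comp[OF D functor_P]
    note Pt = preserves_filtered_colimitsD[OF preserves_filtered_colimits_P[OF K F] I D t]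
    note GPD = cat_functor_comp[OF PD G.cat_functor_axioms]
    note GPt = preserves_filtered_colimitsD[OF G I PD Pt]
    show "\<forall>h\<in>hom M x c. \<exists>i\<in>Obj I. \<exists>g\<in>hom M x (FObj D i). Comp M (t i) g = h"
    proof
      fix h assume h: "h \<in> hom M x c"
      have "ins_mor h \<in> hom K (vfst x) (FObj P c)" using hom_M_D(4)[OF h] by simp
      from K.presentable_factor[OF s px I PD Pt this] obtain i g where i: "i \<in> Obj I"
        and g0: "g \<in> hom K (vfst x) (FObj (fctr_comp P D) i)" and tg0: "Comp K (FArr P (t i)) g = ins_mor h"
        by blast
      have g: "g \<in> hom K (vfst x) (vfst (FObj D i))" using g0 by simp
      have tg: "Comp K (ins_mor (t i)) g = ins_mor h" using tg0 by simp
      note ti = hom_M_D[OF colimit_hom[OF t i]]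
      note Di = Obj_M_snd[OF ti(2)] and xx = Obj_M_snd[OF x]
      define a where "a = Comp L (FArr G g) (vsnd x)"
      define b where "b = Comp L (vsnd (FObj D i)) (FArr F g)"
      have a: "a \<in> hom L (FObj F (vfst x)) (FObj G (vfst (FObj D i)))"
        unfolding a_def by (rule F.cod.Comp_hom[OF xx G.FArr_hom[OF g]])
      have b: "b \<in> hom L (FObj F (vfst x)) (FObj G (vfst (FObj D i)))"
        unfolding b_def by (rule F.cod.Comp_hom[OF F.FArr_hom[OF g] Di])
      \<comment> \<open>\<open>a\<close> and \<open>b\<close> are the two sides of the square for the arrow \<open>g\<close>.\<close>
      have "Comp L (FArr G (ins_mor (t i))) a = Comp L (FArr G (ins_mor h)) (vsnd x)"
        unfolding a_def using F.cod.Comp_assoc[OF xx G.FArr_hom[OF g] G.FArr_hom[OF ti(4)]]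
          G.FArr_Comp[OF g ti(4)] tg by simp
      also have "\<dots> = Comp L (vsnd c) (FArr F (ins_mor h))" by (rule hom_M_D(5)[OF h])
      also have "\<dots> = Comp L (Comp L (vsnd c) (FArr F (ins_mor (t i)))) (FArr F g)"
        using F.cod.Comp_assoc[OF F.FArr_hom[OF g] F.FArr_hom[OF ti(4)] Obj_M_snd[OF ti(3)]]
          F.FArr_Comp[OF g ti(4)] tg by simp
      also have "\<dots> = Comp L (FArr G (ins_mor (t i))) b"
        unfolding b_def using ti(5) F.cod.Comp_assoc[OF F.FArr_hom[OF g] Di G.FArr_hom[OF ti(4)]] by simp
      finally have eq: "Comp L (FArr G (FArr P (t i))) a = Comp L (FArr G (FArr P (t i))) b" by simp
      have ab: "a \<in> hom L (FObj F (vfst x)) (FObj (fctr_comp G (fctr_comp P D)) i)"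
        "b \<in> hom L (FObj F (vfst x)) (FObj (fctr_comp G (fctr_comp P D)) i)"
        using a b by simp_all
      from L.presentable_equal[OF s pFx I GPD GPt i ab eq] obtain j u where u: "u \<in> hom I i j"
        and uab0: "Comp L (FArr (fctr_comp G (fctr_comp P D)) u) a = Comp L (FArr (fctr_comp G (fctr_comp P D)) u) b"
        by blast
      have uab: "Comp L (FArr G (ins_mor (FArr D u))) a = Comp L (FArr G (ins_mor (FArr D u))) b"
        using uab0 by simp
      note Du = hom_M_D[OF D.FArr_hom[OF u]]
      define k where "k = Comp K (ins_mor (FArr D u)) g"
      have k: "k \<in> hom K (vfst x) (vfst (FObj D j))"
        unfolding k_def by (rule F.dom.Comp_hom[OF g Du(4)])
      have "Comp L (FArr G k) (vsnd x) = Comp L (FArr G (ins_mor (FArr D u))) a"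
        unfolding a_def k_def using F.cod.Comp_assoc[OF xx G.FArr_hom[OF g] G.FArr_hom[OF Du(4)]]
          G.FArr_Comp[OF g Du(4)] by simp
      also have "\<dots> = Comp L (Comp L (FArr G (ins_mor (FArr D u))) (vsnd (FObj D i))) (FArr F g)"
        unfolding uab unfolding b_def using F.cod.Comp_assoc[OF F.FArr_hom[OF g] Di G.FArr_hom[OF Du(4)]] by simp
      also have "\<dots> = Comp L (vsnd (FObj D j)) (FArr F k)"
        unfolding k_def using Du(5) F.cod.Comp_assoc[OF F.FArr_hom[OF g] F.FArr_hom[OF Du(4)] Obj_M_snd[OF Du(3)]]
          F.FArr_Comp[OF g Du(4)] by simp
      finally have k': "ins_arr x k (FObj D j) \<in> hom M x (FObj D j)"
        using x Du(3) k by (simp add: hom_M_ins_arr square_def)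
      have j: "j \<in> Obj I" using D.dom.hom_Cod[OF u] .
      note tj = hom_M_D[OF colimit_hom[OF t j]]
      have nat: "Comp K (ins_mor (t j)) (ins_mor (FArr D u)) = ins_mor (t i)"
        using colimit_natural[OF Pt u] by simp
      have "Comp K (ins_mor (t j)) k = ins_mor h"
        unfolding k_def using F.dom.Comp_assoc[OF g Du(4) tj(4)] nat tg by simp
      then have "Comp M (t j) (ins_arr x k (FObj D j)) = h"
        using hom_M_dom_cod[OF colimit_hom[OF t j]] hom_M_D(1)[OF h] by simp
      then show "\<exists>i\<in>Obj I. \<exists>g\<in>hom M x (FObj D i). Comp M (t i) g = h"
        using j k' by blast
    qed
    show "\<forall>i\<in>Obj I. \<forall>g\<in>hom M x (FObj D i). \<forall>g'\<in>hom M x (FObj D i).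
        Comp M (t i) g = Comp M (t i) g' \<longrightarrow> (\<exists>j. \<exists>u\<in>hom I i j. Comp M (FArr D u) g = Comp M (FArr D u) g')"
    proof (intro ballI impI)
      fix i g g' assume i: "i \<in> Obj I" and g: "g \<in> hom M x (FObj D i)" and g': "g' \<in> hom M x (FObj D i)"
        and tg: "Comp M (t i) g = Comp M (t i) g'"
      have "ins_mor (Comp M (t i) g) = ins_mor (Comp M (t i) g')" using tg by metis
      then have eq: "Comp K (FArr P (t i)) (ins_mor g) = Comp K (FArr P (t i)) (ins_mor g')" by simp
      have gg: "ins_mor g \<in> hom K (vfst x) (FObj (fctr_comp P D) i)"
        "ins_mor g' \<in> hom K (vfst x) (FObj (fctr_comp P D) i)"
        using hom_M_D(4)[OF g] hom_M_D(4)[OF g'] by simp_all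
      from K.presentable_equal[OF s px I PD Pt i gg eq] obtain j u where u: "u \<in> hom I i j"
        and "Comp K (FArr (fctr_comp P D) u) (ins_mor g) = Comp K (FArr (fctr_comp P D) u) (ins_mor g')"
        by blast
      then have "Comp M (FArr D u) g = Comp M (FArr D u) g'"
        using hom_M_dom_cod[OF g] hom_M_dom_cod[OF g'] by simp
      then show "\<exists>j. \<exists>u\<in>hom I i j. Comp M (FArr D u) g = Comp M (FArr D u) g'"
        using u by blast
    qed
  qed
qed

end

section \<open>Decomposition of an object of the inserter\<close>

text \<open>
  Two cardinals are at work: the pieces of the object \<open>(X, f)\<close> of the inserter are found at level \<open>r\<close>, where
  \<open>F\<close> and \<open>G\<close> are strongly accessible, while the subcategories that carry them are bounded by \<open>s\<close>.
\<close>

locale inserter_object = inserter universe_type K L F G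
  for universe_type :: "'u itself" and K L :: "('u, 'u) cat" and F G :: "('u, 'u, 'u, 'u) fctr" +
  fixes r s :: "'u rel" and X f :: 'u and I :: "('u, 'u) cat" and D :: "('u, 'u, 'u, 'u) fctr" and t :: "'u \<Rightarrow> 'u"
  assumes F_acc: "strongly_class_accessible_at r K L F" and G_acc: "strongly_class_accessible_at r K L G"
    and s: "regular_cardinal s" and rs: "sharply_below r s"
    and f: "f \<in> hom L (FObj F X) (FObj G X)"
    and I: "small_category I" "filtered r I" and D: "cat_functor I K D"
    and presD: "i \<in> Obj I \<Longrightarrow> presentable r K (FObj D i)" and t: "colimit I K D X t"
begin

sublocale D: cat_functor I K D by (fact D)

lemma acc:
  "class_accessible_at r K" "class_accessible_at r L"
  "preserves_filtered_colimits r K L F" "preserves_filtered_colimits r K L G"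
  "presentable r K A \<Longrightarrow> presentable r L (FObj F A)"
  using F_acc G_acc by (simp_all add: strongly_class_accessible_at_def class_accessible_functor_at_def)

lemmas K = class_accessible_atD[OF acc(1)]

sublocale L: locally_small_category universe_type L
  using class_accessible_locally_small_category[OF acc(2)] .

lemma Gt: "colimit I L (fctr_comp G D) (FObj G X) (\<lambda>i. FArr G (t i))"
  by (rule preserves_filtered_colimitsD[OF acc(4) I D t])

lemma GD: "cat_functor I L (fctr_comp G D)"
  by (rule cat_functor_comp[OF D G.cat_functor_axioms])

lemma t_hom: "i \<in> Obj I \<Longrightarrow> t i \<in> hom K (FObj D i) X"
  by (rule colimit_hom[OF t])

text \<open>
  The piece of \<open>f\<close> over \<open>i\<close>: a lift \<open>\<phi>\<close> of \<open>f \<circ> F(t_i)\<close> along \<open>G(t_n)\<close>.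
\<close>

definition lifts :: "'u \<Rightarrow> 'u \<Rightarrow> 'u \<Rightarrow> bool" where
  "lifts i n \<phi> \<longleftrightarrow> n \<in> Obj I \<and> \<phi> \<in> hom L (FObj F (FObj D i)) (FObj G (FObj D n)) \<and>
     Comp L (FArr G (t n)) \<phi> = Comp L f (FArr F (t i))"

lemma ex_lifts:
  assumes i: "i \<in> Obj I"
  shows "\<exists>n \<phi>. lifts i n \<phi>"
proof -
  have "Comp L f (FArr F (t i)) \<in> hom L (FObj F (FObj D i)) (FObj G X)"
    by (rule F.cod.Comp_hom[OF F.FArr_hom[OF t_hom[OF i]] f])
  from L.presentable_factor[OF K(1) acc(5)[OF presD[OF i]] I GD Gt this]
  show ?thesis unfolding lifts_def by simp blast
qed

definition n where "n i = (SOME n. \<exists>\<phi>. lifts i n \<phi>)"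

definition \<phi> where "\<phi> i = (SOME \<phi>. lifts i (n i) \<phi>)"

lemma lifts: "i \<in> Obj I \<Longrightarrow> lifts i (n i) (\<phi> i)"
  unfolding \<phi>_def n_def using someI_ex[OF someI_ex[OF ex_lifts]] .

lemma n_Obj: "i \<in> Obj I \<Longrightarrow> n i \<in> Obj I"
  and \<phi>_hom: "i \<in> Obj I \<Longrightarrow> \<phi> i \<in> hom L (FObj F (FObj D i)) (FObj G (FObj D (n i)))"
  and \<phi>_eq: "i \<in> Obj I \<Longrightarrow> Comp L (FArr G (t (n i))) (\<phi> i) = Comp L f (FArr F (t i))"
  using lifts by (simp_all add: lifts_def)

text \<open>
  The chosen pieces need not be natural in \<open>i\<close>. For an arrow \<open>u\<close> of \<open>I\<close>, the arrows \<open>v\<close> and \<open>v'\<close> lead to a stage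
  where the naturality square of \<open>u\<close> commutes.
\<close>

definition merges :: "'u \<Rightarrow> 'u \<Rightarrow> 'u \<Rightarrow> bool" where
  "merges u v v' \<longleftrightarrow> (\<exists>k. v \<in> hom I (n (Dom I u)) k \<and> v' \<in> hom I (n (Cod I u)) k \<and>
     Comp L (FArr G (FArr D v)) (\<phi> (Dom I u)) =
       Comp L (FArr G (FArr D v')) (Comp L (\<phi> (Cod I u)) (FArr F (FArr D u))))"

text \<open>
  The square commutes after composition with the colimit cocone of \<open>G D\<close>, hence at a later stage, since
  \<open>F(D i)\<close> is presentable.
\<close>

lemma ex_merges:
  assumes u: "u \<in> hom I i j"
  shows "\<exists>v v'. merges u v v'"
proof -
  have Dom: "Dom I u = i" and Cod: "Cod I u = j" using u by (simp_all add: hom_def)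
  note i = D.dom.hom_Dom[OF u] and j = D.dom.hom_Cod[OF u]
  note Du = D.FArr_hom[OF u]
  define b where "b = Comp L (\<phi> j) (FArr F (FArr D u))"
  have b: "b \<in> hom L (FObj F (FObj D i)) (FObj G (FObj D (n j)))"
    unfolding b_def by (rule F.cod.Comp_hom[OF F.FArr_hom[OF Du] \<phi>_hom[OF j]])
  have Gb: "Comp L (FArr G (t (n j))) b = Comp L f (FArr F (t i))"
  proof -
    have "Comp L (FArr G (t (n j))) b = Comp L (Comp L f (FArr F (t j))) (FArr F (FArr D u))"
      unfolding b_def
      using F.cod.Comp_assoc[OF F.FArr_hom[OF Du] \<phi>_hom[OF j] G.FArr_hom[OF t_hom[OF n_Obj[OF j]]]] \<phi>_eq[OF j]
      by simp
    also have "\<dots> = Comp L f (FArr F (t i))"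
      using F.cod.Comp_assoc[OF F.FArr_hom[OF Du] F.FArr_hom[OF t_hom[OF j]] f]
        F.FArr_Comp[OF Du t_hom[OF j]] colimit_natural[OF t u] by simp
    finally show ?thesis .
  qed
  have through: "Comp L (FArr G (t m)) (Comp L (FArr G (FArr D v)) g) = Comp L (FArr G (t l)) g"
    if v: "v \<in> hom I l m" and g: "g \<in> hom L Z (FObj G (FObj D l))" for v l m g Z
  proof -
    have m: "m \<in> Obj I" using D.dom.hom_Cod[OF v] .
    show ?thesis
      using F.cod.Comp_assoc[OF g G.FArr_hom[OF D.FArr_hom[OF v]] G.FArr_hom[OF t_hom[OF m]]]
        G.FArr_Comp[OF D.FArr_hom[OF v] t_hom[OF m]] colimit_natural[OF t v] by simp
  qed
  have assoc: "Comp L (FArr G (FArr D (Comp I w v))) g = Comp L (FArr G (FArr D w)) (Comp L (FArr G (FArr D v)) g)"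
    if v: "v \<in> hom I l m" and w: "w \<in> hom I m k" and g: "g \<in> hom L Z (FObj G (FObj D l))" for v w l m k g Z
    using F.cod.Comp_assoc[OF g G.FArr_hom[OF D.FArr_hom[OF v]] G.FArr_hom[OF D.FArr_hom[OF w]]]
      G.FArr_Comp[OF D.FArr_hom[OF v] D.FArr_hom[OF w]] D.FArr_Comp[OF v w] by simp
  obtain m v v' where v: "v \<in> hom I (n i) m" "v' \<in> hom I (n j) m"
    by (rule filtered_pair[OF I(2) K(1) n_Obj[OF i] n_Obj[OF j]])
  have m: "m \<in> Obj I" using D.dom.hom_Cod[OF v(1)] .
  have g: "Comp L (FArr G (FArr D v)) (\<phi> i) \<in> hom L (FObj F (FObj D i)) (FObj (fctr_comp G D) m)"
    "Comp L (FArr G (FArr D v')) b \<in> hom L (FObj F (FObj D i)) (FObj (fctr_comp G D) m)"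
    using F.cod.Comp_hom[OF \<phi>_hom[OF i] G.FArr_hom[OF D.FArr_hom[OF v(1)]]]
      F.cod.Comp_hom[OF b G.FArr_hom[OF D.FArr_hom[OF v(2)]]] by simp_all
  have "Comp L (FArr G (t m)) (Comp L (FArr G (FArr D v)) (\<phi> i)) = Comp L (FArr G (t m)) (Comp L (FArr G (FArr D v')) b)"
    using through[OF v(1) \<phi>_hom[OF i]] through[OF v(2) b] \<phi>_eq[OF i] Gb by simp
  from L.presentable_equal[OF K(1) acc(5)[OF presD[OF i]] I GD Gt m g this]
  obtain k w where w: "w \<in> hom I m k" and
    eq0: "Comp L (FArr (fctr_comp G D) w) (Comp L (FArr G (FArr D v)) (\<phi> i)) =
      Comp L (FArr (fctr_comp G D) w) (Comp L (FArr G (FArr D v')) b)"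
    by blast
  have "Comp L (FArr G (FArr D (Comp I w v))) (\<phi> i) = Comp L (FArr G (FArr D (Comp I w v'))) b"
    using eq0 assoc[OF v(1) w \<phi>_hom[OF i]] assoc[OF v(2) w b] by simp
  then have "merges u (Comp I w v) (Comp I w v')"
    unfolding merges_def Dom Cod b_def
    using D.dom.Comp_hom[OF v(1) w] D.dom.Comp_hom[OF v(2) w] by blast
  then show ?thesis by blast
qed

text \<open>
  The closure condition under which the pieces \<open>\<phi>_i\<close> restrict to a subcategory: it contains the targets
  of its pieces and witnesses for their naturality.
\<close>

definition coherent :: "'u set \<Rightarrow> 'u set \<Rightarrow> bool" where
  "coherent S W \<longleftrightarrow> (\<forall>u\<in>S. Ident I (n (Dom I u)) \<in> W \<and> (\<exists>v\<in>W. \<exists>v'\<in>W. merges u v v'))"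

lemma coherent_mono: "coherent S W \<Longrightarrow> W \<subseteq> W' \<Longrightarrow> coherent S W'"
  unfolding coherent_def by blast

lemma ex_coherent:
  assumes S: "S \<subseteq> Arr I" "|S| <o r"
  shows "\<exists>W\<subseteq>Arr I. |W| <o s \<and> coherent S W"
proof -
  have "\<forall>u\<in>S. \<exists>v v'. merges u v v'"
  proof
    fix u assume "u \<in> S"
    then have "u \<in> Arr I" using S(1) by blast
    then show "\<exists>v v'. merges u v v'" by (rule ex_merges[OF D.dom.hom_Arr])
  qed
  then obtain v v' where v: "\<forall>u\<in>S. merges u (v u) (v' u)" by metis
  have Ss: "|S| <o s"
    using S(2) rs ordLess_transitive unfolding sharply_below_def by blast
  let ?W = "((\<lambda>u. Ident I (n (Dom I u))) ` S \<union> v ` S) \<union> v' ` S"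
  have "?W \<subseteq> Arr I"
  proof (intro Un_least image_subsetI)
    fix u assume u: "u \<in> S"
    show "v u \<in> Arr I" "v' u \<in> Arr I" using v u by (auto simp: merges_def hom_def)
    have "n (Dom I u) \<in> Obj I" using n_Obj[OF D.dom.Dom_Obj] S(1) u by blast
    then show "Ident I (n (Dom I u)) \<in> Arr I" using D.dom.Ident_hom by (simp add: hom_def)
  qed
  moreover have "|?W| <o s" by (intro regular_Un[OF s] card_image_less Ss)
  moreover have "coherent S ?W" unfolding coherent_def using v by blast
  ultimately show ?thesis by (intro exI[of _ ?W] conjI)
qed

text \<open>
  On a coherent subcategory the pieces of \<open>f\<close> glue to a structure map \<open>g_q\<close> on the colimit \<open>Y_q\<close>. These maps are
  compatible with the transition maps and with \<open>f\<close>, so the decomposition of \<open>X\<close> lifts to the inserter.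
\<close>

lemma presentable_decomposition:
  "\<exists>(J :: ('u, 'u) cat) E w. small_category J \<and> filtered s J \<and> cat_functor J M E \<and>
     (\<forall>j\<in>Obj J. FObj E j \<in> Obj M \<and> presentable s K (vfst (FObj E j))) \<and> colimit J M E (vpair (X, f)) w"
proof -
  have r_s: "r <o s" using rs by (simp add: sharply_below_def)
  interpret K: locally_small_category universe_type K
    using class_accessible_locally_small_category[OF acc(1)] .
  obtain Q sub Y \<tau> where dec: "decomposition I K D Q sub X t Y \<tau>"
    and PQ: "small_category (preorder_cat Q (\<lambda>p q. sub p \<subseteq> sub q))"
      "filtered s (preorder_cat Q (\<lambda>p q. sub p \<subseteq> sub q))"
    and subQ: "\<forall>q\<in>Q. |sub q| <o s \<and> small_category (subcat I (sub q)) \<and> filtered r (subcat I (sub q)) \<and>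
       (\<forall>S. S \<subseteq> sub q \<and> |S| <o r \<longrightarrow> coherent S (sub q))"
    by (rule ex_decomposition[OF K(1) s rs K(4) I D t ex_coherent coherent_mono])
  interpret dec: decomposition universe_type I K D Q sub X t Y \<tau> by fact
  have coh: "Ident I (n (Dom I u)) \<in> sub q \<and> (\<exists>v\<in>sub q. \<exists>v'\<in>sub q. merges u v v')"
    if "q \<in> Q" "u \<in> sub q" for q u
  proof -
    have "coherent {u} (sub q)" using subQ that regular_finite[OF K(1), of "{u}"] by simp
    then show ?thesis by (simp add: coherent_def)
  qed
  have n_objs: "n i \<in> dec.objs q" if q: "q \<in> Q" and i: "i \<in> dec.objs q" for q i
  proof -
    have i': "i \<in> Obj I" "Ident I i \<in> sub q" using i by simp_all
    have "Dom I (Ident I i) = i" using D.dom.Ident_hom[OF i'(1)] by (simp add: hom_def)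
    then show ?thesis using coh[OF q i'(2)] n_Obj[OF i'(1)] by simp
  qed
  have F\<tau>: "colimit (subcat I (sub q)) L (fctr_comp F D) (FObj F (Y q)) (\<lambda>i. FArr F (\<tau> q i))"
    if q: "q \<in> Q" for q
    using subQ q preserves_filtered_colimitsD[OF acc(3) _ _ dec.D_sub[OF q] dec.\<tau>[OF q]] by simp
  have FD: "cat_functor (subcat I (sub q)) L (fctr_comp F D)" if "q \<in> Q" for q
    by (rule cat_functor_comp[OF dec.D_sub[OF that] F.cat_functor_axioms])
  \<comment> \<open>The piece over \<open>i\<close>, with values in the colimit over the subcategory.\<close>
  define \<psi> where "\<psi> q i = Comp L (FArr G (\<tau> q (n i))) (\<phi> i)" for q i
  have \<psi>_hom: "\<psi> q i \<in> hom L (FObj F (FObj D i)) (FObj G (Y q))" if "q \<in> Q" "i \<in> dec.objs q" for q i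
  proof -
    have "i \<in> Obj I" using that(2) by simp
    then show ?thesis
      unfolding \<psi>_def using F.cod.Comp_hom[OF \<phi>_hom G.FArr_hom[OF dec.\<tau>_hom[OF that(1) n_objs[OF that]]]] by simp
  qed
  have "\<exists>g. g \<in> hom L (FObj F (Y q)) (FObj G (Y q)) \<and>
      (\<forall>i\<in>dec.objs q. Comp L g (FArr F (\<tau> q i)) = \<psi> q i)" if q: "q \<in> Q" for q
  proof -
    interpret S: cat_functor "subcat I (sub q)" K D by (rule dec.D_sub[OF q])
    have "cocone (subcat I (sub q)) L (fctr_comp F D) (FObj G (Y q)) (\<psi> q)"
    proof (rule coconeI)
      show "category (subcat I (sub q))" by unfold_locales
      show "FObj G (Y q) \<in> Obj L" using G.FObj_Obj[OF dec.Y_Obj[OF q]] .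
      show "\<psi> q i \<in> hom L (FObj (fctr_comp F D) i) (FObj G (Y q))" if "i \<in> dec.objs q" for i
        using \<psi>_hom[OF q that] by simp
      fix i j u assume u0: "u \<in> hom (subcat I (sub q)) i j"
      then have u: "u \<in> hom I i j" and uq: "u \<in> sub q" using hom_subcat[OF dec.sub_Arr[OF q]] by blast+
      note io = S.dom.hom_Dom[OF u0] and jo = S.dom.hom_Cod[OF u0]
      note i = D.dom.hom_Dom[OF u] and j = D.dom.hom_Cod[OF u]
      have Dom: "Dom I u = i" "Cod I u = j" using u by (simp_all add: hom_def)
      obtain v v' where vq: "v \<in> sub q" "v' \<in> sub q" and "merges u v v'" using coh[OF q uq] by blast
      then obtain k where v: "v \<in> hom I (n i) k" "v' \<in> hom I (n j) k" and
        eq: "Comp L (FArr G (FArr D v)) (\<phi> i) = Comp L (FArr G (FArr D v')) (Comp L (\<phi> j) (FArr F (FArr D u)))"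
        unfolding merges_def Dom by blast
      have ko: "k \<in> dec.objs q"
        using S.dom.hom_Cod[of v "n i" k] v(1) vq(1) hom_subcat[OF dec.sub_Arr[OF q]] by blast
      note Du = F.FArr_hom[OF D.FArr_hom[OF u]] and \<tau>k = dec.\<tau>_hom[OF q ko]
      have through: "Comp L (FArr G (\<tau> q k)) (Comp L (FArr G (FArr D w)) g) = Comp L (FArr G (\<tau> q l)) g"
        if w: "w \<in> hom I l k" "w \<in> sub q" and g: "g \<in> hom L Z (FObj G (FObj D l))" for w l g Z
        using F.cod.Comp_assoc[OF g G.FArr_hom[OF D.FArr_hom[OF w(1)]] G.FArr_hom[OF \<tau>k]]
          G.FArr_Comp[OF D.FArr_hom[OF w(1)] \<tau>k] dec.\<tau>_natural[OF q w] by simp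
      have "Comp L (\<psi> q j) (FArr F (FArr D u)) = Comp L (FArr G (\<tau> q (n j))) (Comp L (\<phi> j) (FArr F (FArr D u)))"
        unfolding \<psi>_def
        using F.cod.Comp_assoc[OF Du \<phi>_hom[OF j] G.FArr_hom[OF dec.\<tau>_hom[OF q n_objs[OF q jo]]]] by simp
      also have "\<dots> = Comp L (FArr G (\<tau> q k)) (Comp L (FArr G (FArr D v)) (\<phi> i))"
        using through[OF v(2) vq(2) F.cod.Comp_hom[OF Du \<phi>_hom[OF j]]] eq by simp
      also have "\<dots> = \<psi> q i"
        unfolding \<psi>_def by (rule through[OF v(1) vq(1) \<phi>_hom[OF i]])
      finally show "Comp L (\<psi> q j) (FArr (fctr_comp F D) u) = \<psi> q i" by simp
    qed
    then show ?thesis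
      by (rule colimit_factor[OF F\<tau>[OF q]]) (intro exI conjI ballI, assumption, simp)
  qed
  then obtain g where g: "\<And>q. q \<in> Q \<Longrightarrow> g q \<in> hom L (FObj F (Y q)) (FObj G (Y q))"
    and g\<tau>: "\<And>q i. q \<in> Q \<Longrightarrow> i \<in> dec.objs q \<Longrightarrow> Comp L (g q) (FArr F (\<tau> q i)) = \<psi> q i"
    by metis
  have X: "X \<in> Obj K" using colimit_Obj[OF t] .
  \<comment> \<open>An arrow out of \<open>Y_q\<close> is compatible with structure maps if it is so on the pieces.\<close>
  have sq: "Comp L (FArr G m) (g q) = Comp L h (FArr F m)"
    if q: "q \<in> Q" and m: "m \<in> hom K (Y q) Z" and h: "h \<in> hom L (FObj F Z) (FObj G Z)"
      and mh: "\<And>i. i \<in> dec.objs q \<Longrightarrow> Comp L h (FArr F (Comp K m (\<tau> q i))) =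
          Comp L (FArr G (Comp K m (\<tau> q (n i)))) (\<phi> i)" for q m Z h
  proof (rule colimit_eqI[OF FD[OF q] F\<tau>[OF q] F.cod.Comp_hom[OF g[OF q] G.FArr_hom[OF m]]
        F.cod.Comp_hom[OF F.FArr_hom[OF m] h]])
    fix i assume i: "i \<in> dec.objs q"
    note \<tau>i = dec.\<tau>_hom[OF q i] and \<tau>n = dec.\<tau>_hom[OF q n_objs[OF q i]]
    have i': "i \<in> Obj I" using i by simp
    have "Comp L (Comp L (FArr G m) (g q)) (FArr F (\<tau> q i)) = Comp L (FArr G m) (\<psi> q i)"
      using F.cod.Comp_assoc[OF F.FArr_hom[OF \<tau>i] g[OF q] G.FArr_hom[OF m]] g\<tau>[OF q i] by simp
    also have "\<dots> = Comp L (FArr G (Comp K m (\<tau> q (n i)))) (\<phi> i)"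
      unfolding \<psi>_def using F.cod.Comp_assoc[OF \<phi>_hom[OF i'] G.FArr_hom[OF \<tau>n] G.FArr_hom[OF m]]
        G.FArr_Comp[OF \<tau>n m] by simp
    also have "\<dots> = Comp L (Comp L h (FArr F m)) (FArr F (\<tau> q i))"
      using mh[OF i] F.cod.Comp_assoc[OF F.FArr_hom[OF \<tau>i] F.FArr_hom[OF m] h] F.FArr_Comp[OF \<tau>i m] by simp
    finally show "Comp L (Comp L (FArr G m) (g q)) (FArr F (\<tau> q i)) = Comp L (Comp L h (FArr F m)) (FArr F (\<tau> q i))" .
  qed
  have sq_tr: "Comp L (FArr G (dec.tr p q)) (g p) = Comp L (g q) (FArr F (dec.tr p q))"
    if pq: "p \<in> Q" "q \<in> Q" "sub p \<subseteq> sub q" for p q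
  proof (rule sq[OF pq(1) dec.tr(1)[OF pq] g[OF pq(2)]])
    fix i assume i: "i \<in> dec.objs p"
    show "Comp L (g q) (FArr F (Comp K (dec.tr p q) (\<tau> p i))) =
        Comp L (FArr G (Comp K (dec.tr p q) (\<tau> p (n i)))) (\<phi> i)"
      using dec.tr(2)[OF pq i] dec.tr(2)[OF pq n_objs[OF pq(1) i]]
        g\<tau>[OF pq(2) dec.objs_mono[OF pq(3) i]] by (simp add: \<psi>_def)
  qed
  have sq_x: "Comp L (FArr G (dec.x q)) (g q) = Comp L f (FArr F (dec.x q))" if q: "q \<in> Q" for q
  proof (rule sq[OF q dec.x(1)[OF q] f])
    fix i assume i: "i \<in> dec.objs q"
    show "Comp L f (FArr F (Comp K (dec.x q) (\<tau> q i))) = Comp L (FArr G (Comp K (dec.x q) (\<tau> q (n i)))) (\<phi> i)"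
      using dec.x(2)[OF q i] dec.x(2)[OF q n_objs[OF q i]] \<phi>_eq[of i] i by simp
  qed
  define Z where "Z q = vpair (Y q, g q)" for q
  define T where "T p q = ins_arr (Z p) (dec.tr p q) (Z q)" for p q
  have Z: "Z q \<in> Obj M" if "q \<in> Q" for q
    unfolding Z_def Obj_M_vpair using dec.Y_Obj[OF that] g[OF that] by simp
  interpret Diag: cat_functor dec.PQ K dec.Diag by (rule dec.functor_Diag)
  have hom_PQ: "vpair (p, q) \<in> hom dec.PQ p q" if "p \<in> Q" "q \<in> Q" "sub p \<subseteq> sub q" for p q
    using that by (simp add: hom_preorder_cat)
  have E: "cat_functor dec.PQ M (preorder_fctr Z T)"
  proof (rule cat_functor_preorder[OF dec.category_PQ category_M Z])
    show "T p q \<in> hom M (Z p) (Z q)" if pq: "p \<in> Q" "q \<in> Q" "sub p \<subseteq> sub q" for p q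
      unfolding T_def using Z[OF pq(1)] Z[OF pq(2)] dec.tr(1)[OF pq] sq_tr[OF pq]
      by (simp add: hom_M_ins_arr square_def) (simp add: Z_def)
    show "T p p = Ident M (Z p)" if p: "p \<in> Q" for p
      using Diag.FArr_Ident[of p] p by (simp add: T_def) (simp add: Z_def)
    show "Comp M (T q w) (T p q) = T p w"
      if "p \<in> Q" "q \<in> Q" "w \<in> Q" "sub p \<subseteq> sub q" "sub q \<subseteq> sub w" for p q w
      using Diag.FArr_Comp[OF hom_PQ[OF that(1,2,4)] hom_PQ[OF that(2,3,5)]] by (simp add: T_def)
  qed
  have PE: "fctr_comp P (preorder_fctr Z T) = dec.Diag"
    by (simp add: fctr_comp_def preorder_fctr_def Ins_proj_def Z_def T_def)
  have Fx: "colimit dec.PQ L (fctr_comp F dec.Diag) (FObj F X) (\<lambda>q. FArr F (dec.x q))"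
    by (rule preserves_filtered_colimitsD[OF preserves_filtered_colimits_mono[OF acc(3) ordLess_imp_ordLeq[OF r_s]]
          PQ dec.functor_Diag dec.colimit_Diag])
  have "colimit dec.PQ M (preorder_fctr Z T) (vpair (X, f))
      (\<lambda>q. ins_arr (FObj (preorder_fctr Z T) q) (dec.x q) (vpair (X, f)))"
  proof (rule colimit_lift[OF E])
    show "colimit dec.PQ K (fctr_comp P (preorder_fctr Z T)) X dec.x"
      unfolding PE by (rule dec.colimit_Diag)
    show "colimit dec.PQ L (fctr_comp F (fctr_comp P (preorder_fctr Z T))) (FObj F X) (\<lambda>q. FArr F (dec.x q))"
      unfolding PE by (rule Fx)
    show "f \<in> hom L (FObj F X) (FObj G X)" by (rule f)
    show "Comp L f (FArr F (dec.x q)) = Comp L (FArr G (dec.x q)) (vsnd (FObj (preorder_fctr Z T) q))"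
      if "q \<in> Obj dec.PQ" for q
      using sq_x[of q] that by (simp add: Z_def)
  qed
  moreover have "presentable s K (Y q)" if q: "q \<in> Q" for q
  proof (rule K.bounded_filtered_colimit_presentable[OF s r_s])
    show "bounded_filtered_colimit r s K (Y q)"
      unfolding bounded_filtered_colimit_def
      using subQ q dec.D_sub[OF q] presD dec.\<tau>[OF q]
      by (intro exI[of _ "subcat I (sub q)"] exI[of _ D] exI[of _ "\<tau> q"]) simp
  qed
  then have "\<forall>q\<in>Obj dec.PQ. FObj (preorder_fctr Z T) q \<in> Obj M \<and>
      presentable s K (vfst (FObj (preorder_fctr Z T) q))"
    using Z by (simp add: Z_def)
  ultimately show ?thesis
    using PQ E by blast
qed

end

section \<open>Accessibility of the inserter\<close>

theorem proposition3p7: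
  fixes K L :: "('u, 'u) cat"
    and F G :: "('u, 'u, 'u, 'u) fctr"
  assumes "inaccessible |UNIV :: 'u set|"
    and "strongly_class_accessible K L F"
    and "strongly_class_accessible K L G"
  shows "class_accessible (Ins K L F G) \<and>
    strongly_class_accessible (Ins K L F G) K Ins_proj"
proof -
  interpret universe "TYPE('u)"
    using assms(1) by unfold_locales
  obtain rF rG where F0: "strongly_class_accessible_at rF K L F" and G0: "strongly_class_accessible_at rG K L G"
    using assms(2,3) unfolding strongly_class_accessible_def by blast
  have "regular_cardinal rF" "regular_cardinal rG"
    using F0 G0 by (simp_all add: strongly_class_accessible_at_def class_accessible_functor_at_def class_accessible_at_def)
  then obtain r :: "'u rel" where r: "regular_cardinal r" "sharply_below rF r" "sharply_below rG r"
    by (rule ex_sharply_above)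
  have Fr: "strongly_class_accessible_at r K L F" and Gr: "strongly_class_accessible_at r K L G"
    using strongly_class_accessible_at_raise[OF F0 r(1,2)] strongly_class_accessible_at_raise[OF G0 r(1,3)] by auto
  \<comment> \<open>Objects of the inserter are decomposed into pieces of size below a still larger cardinal.\<close>
  obtain s :: "'u rel" where s: "regular_cardinal s" and rs: "sharply_below r s" "sharply_below r s"
    by (rule ex_sharply_above[OF r(1) r(1)])
  have Fs: "strongly_class_accessible_at s K L F" and Gs: "strongly_class_accessible_at s K L G"
    using strongly_class_accessible_at_raise[OF Fr s rs(1)] strongly_class_accessible_at_raise[OF Gr s rs(1)] by auto
  have K: "class_accessible_at s K" and L: "class_accessible_at s L"
    and F: "cat_functor K L F" "preserves_filtered_colimits s K L F"
    and G: "cat_functor K L G" "preserves_filtered_colimits s K L G"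
    and presF: "\<And>A. presentable s K A \<Longrightarrow> presentable s L (FObj F A)"
    using Fs Gs by (simp_all add: strongly_class_accessible_at_def class_accessible_functor_at_def)
  note Ks = class_accessible_atD[OF K] and Ls = class_accessible_atD[OF L]
  have Kr: "class_accessible_at r K"
    using Fr by (simp add: strongly_class_accessible_at_def class_accessible_functor_at_def)
  interpret ins: inserter "TYPE('u)" K L F G
    by (intro inserter.intro universe_axioms F G)
  interpret K: locally_small_category "TYPE('u)" K
    using class_accessible_locally_small_category[OF K] .
  interpret M: locally_small_category "TYPE('u)" "Ins K L F G"
    by (intro locally_small_category.intro locally_small_category_axioms.intro universe_axioms
        ins.category_M ins.locally_small_M Ks(3))
  \<comment> \<open>The generating class: the objects whose underlying object is presentable.\<close>
  let ?A = "{y \<in> Obj (Ins K L F G). presentable s K (vfst y)}"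
  have pres: "presentable s (Ins K L F G) y" if "y \<in> ?A" for y
    using that presF[of "vfst y"] by (intro ins.presentable_M[OF s Ks(3) Ls(3) Ks(4) F(2) G(2)]) simp_all
  have gen: "\<exists>(J :: ('u, 'u) cat) E w. small_category J \<and> filtered s J \<and> cat_functor J (Ins K L F G) E \<and>
      (\<forall>j\<in>Obj J. FObj E j \<in> ?A) \<and> colimit J (Ins K L F G) E x w" if x: "x \<in> Obj (Ins K L F G)" for x
  proof -
    obtain I :: "('u, 'u) cat" and D t where I: "small_category I" "filtered r I" and D: "cat_functor I K D"
      and presD: "\<forall>i\<in>Obj I. presentable r K (FObj D i)" and t: "colimit I K D (vfst x) t"
      using class_accessible_atD(5)[OF Kr ins.Obj_M_fst[OF x]] by blast
    interpret o: inserter_object "TYPE('u)" K L F G r s "vfst x" "vsnd x" I D t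
      by (intro inserter_object.intro inserter_object_axioms.intro ins.inserter_axioms Fr Gr s rs(1)
          ins.Obj_M_snd[OF x] I D t bspec[OF presD])
    have "vpair (vfst x, vsnd x) = x" using x unfolding ins.Obj_M by simp
    then show ?thesis using o.presentable_decomposition by simp
  qed
  have M: "class_accessible_at s (Ins K L F G)"
    unfolding class_accessible_at_def
    by (intro conjI s ins.category_M ins.locally_small_M Ks(3) ins.has_filtered_colimits_M[OF Ks(4) F(2)]
        exI[of _ ?A] ballI pres gen)
  \<comment> \<open>A presentable object of the inserter is a retract of a generator, and so is its image in the base.\<close>
  have "presentable s K (FObj Ins_proj y)" if y: "presentable s (Ins K L F G) y" for y
  proof -
    obtain J :: "('u, 'u) cat" and E w where J: "small_category J" "filtered s J"
      and E: "cat_functor J (Ins K L F G) E" and EA: "\<forall>j\<in>Obj J. FObj E j \<in> ?A"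
      and w: "colimit J (Ins K L F G) E y w"
      using gen[OF M.presentable_Obj[OF y]] by blast
    obtain j m where j: "j \<in> Obj J" and m: "m \<in> hom (Ins K L F G) y (FObj E j)"
      and wm: "Comp (Ins K L F G) (w j) m = Ident (Ins K L F G) y"
      by (rule M.presentable_is_retract[OF s y J E w])
    have wj: "w j \<in> hom (Ins K L F G) (FObj E j) y" using colimit_hom[OF w j] .
    have "ins_mor (Comp (Ins K L F G) (w j) m) = ins_mor (Ident (Ins K L F G) y)" using wm by metis
    then have "Comp K (ins_mor (w j)) (ins_mor m) = Ident K (vfst y)" by simp
    moreover have "presentable s K (vfst (FObj E j))" using EA j by simp
    ultimately show ?thesis
      using K.presentable_retract[OF s _ ins.hom_M_D(4)[OF m] ins.hom_M_D(4)[OF wj]] by simp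
  qed
  then have "strongly_class_accessible_at s (Ins K L F G) K Ins_proj"
    unfolding strongly_class_accessible_at_def class_accessible_functor_at_def
    by (intro conjI M K ins.functor_P ins.preserves_filtered_colimits_P[OF Ks(4) F(2)]) blast
  then show ?thesis
    using M unfolding class_accessible_def strongly_class_accessible_def by blast
qed

end
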